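(* Let $(W,S)$ be an irreducible, nontrivially $\mathbf{a}(2)$-finite Coxeter system of type $X$, and for $x,y\in\mathcal{S}(W)$ let $I(x,y)=R_x\cap R_y^{-1}$. Then: (1) if $X=A_n$, $n\ge3$: $I(13,13)=\{13\}$; (2) if $X=B_3$: $I(13,13)=\{13\}$; (3) if $X=B_n$, $n>3$: $I(24,24)=\{24,2124\}$; (4) if $X=\tilde C_{n-1}$, $n\ge5$: $I(24,24)=\{24,\ 2124,\ 2z,\ 212z\}$ where $z=45\cdots(n-1)n(n-1)\cdots54$; (5) if $X=E_{q,r}$, $r\ge q\ge1$: $I(x,x)=\{x\}$ for every $x\in\{(-1)v,\ 1v,\ (-1)1\}$; (6) if $X=F_4$: $I(24,24)=\{24\}$; (7) if $X=F_n$, $n>4$: $I(24,24)=\{24,243524\}$; (8) if $X=H_3$: $I(13,13)=\{13\}$; (9) if $X=H_n$, $n>3$: $I(24,24)=\{24,2124\}$.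
   Context: $\mathbf{a}$ is Lusztig's $\mathbf{a}$-function (boundedness conjecture assumed); nontrivially $\mathbf{a}(2)$-finite: $\{w:\mathbf{a}(w)=2\}$ finite and nonempty. Labels: $A_n$: path $1-\cdots-n$; $B_n$: same with $m(1,2)=4$; $\tilde C_{n-1}$: same with $m(1,2)=m(n-1,n)=4$; $F_n$: same with $m(2,3)=4$; $H_n$: same with $m(1,2)=5$; $E_{q,r}$: vertices $-q,\dots,0,\dots,r,v$, path $-q-\cdots-r$ plus edge $0-v$; remaining edge weights 3, non-adjacent generators commute; strings of generators denote products. Star operations: for $I=\{s,t\}$, $m=m(s,t)\ge3$, write $w=w^Iw_I$ (length-additive, $w_I\in\langle s,t\rangle$, no right descent of $w^I$ in $I$); if $w_I$ is alternating of length $i\in[1,m-1]$, the right upper (resp. lower) star operation is defined iff $i\le m-2$ (resp. $i\ge2$) and replaces $w_I$ by the alternating product of length $i+1$ (resp. $i-1$) with the same first letter. Left stub: no right lower star operation applies; $\mathcal{S}(W)$: left stubs of $\mathbf{a}$-value 2. $R_x$: elements obtainable from $x$ by finitely many right upper star operations; $R_y^{-1}=\{z^{-1}:z\in R_y\}$. *)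

theory Defs
  imports "HOL-Algebra.Algebra" "HOL-Library.Poly_Mapping"
begin

section \<open>Coxeter systems\<close>

text \<open>The entry \<open>m(s,t)\<close> of the Coxeter matrix is the order of \<open>s t\<close> in \<open>W\<close>; by the convention
  of \<^const>\<open>group.ord\<close>, the value 0 stands for \<open>\<infinity>\<close>.\<close>

definition cox_m :: "('a, 'b) monoid_scheme \<Rightarrow> 'a \<Rightarrow> 'a \<Rightarrow> nat" where
  "cox_m W s t = group.ord W (s \<otimes>\<^bsub>W\<^esub> t)"

definition word_prod :: "('a, 'b) monoid_scheme \<Rightarrow> 'a list \<Rightarrow> 'a" where
  "word_prod W ws = foldr (\<lambda>s w. s \<otimes>\<^bsub>W\<^esub> w) ws \<one>\<^bsub>W\<^esub>"

inductive cox_step :: "('a, 'b) monoid_scheme \<Rightarrow> 'a set \<Rightarrow> 'a list \<Rightarrow> 'a list \<Rightarrow> bool"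
  for W S where
  "\<lbrakk>xs \<in> lists S; ys \<in> lists S; s \<in> S; t \<in> S; cox_m W s t \<noteq> 0\<rbrakk>
    \<Longrightarrow> cox_step W S (xs @ concat (replicate (cox_m W s t) [s, t]) @ ys) (xs @ ys)"

text \<open>The last conjunct says that the generators \<open>S\<close> and the relations \<open>(s t)^m(s,t) = 1\<close> with
  \<open>m(s,t) < \<infinity>\<close> present \<open>W\<close>. As these include \<open>s s = 1\<close>, it is enough to consider positive words.\<close>

definition coxeter_system :: "('a, 'b) monoid_scheme \<Rightarrow> 'a set \<Rightarrow> bool" where
  "coxeter_system W S \<longleftrightarrow>
     group W \<and> S \<subseteq> carrier W \<and> generate W S = carrier W \<and>
     (\<forall>s\<in>S. s \<noteq> \<one>\<^bsub>W\<^esub> \<and> s \<otimes>\<^bsub>W\<^esub> s = \<one>\<^bsub>W\<^esub>) \<and>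
     (\<forall>ws\<in>lists S. word_prod W ws = \<one>\<^bsub>W\<^esub> \<longrightarrow> equivclp (cox_step W S) ws [])"

definition irreducible_coxeter :: "('a, 'b) monoid_scheme \<Rightarrow> 'a set \<Rightarrow> bool" where
  "irreducible_coxeter W S \<longleftrightarrow>
     S \<noteq> {} \<and>
     (\<forall>s\<in>S. \<forall>t\<in>S. (s, t) \<in> {(a, b). a \<in> S \<and> b \<in> S \<and> (cox_m W a b = 0 \<or> 3 \<le> cox_m W a b)}\<^sup>*)"

definition cox_length :: "('a, 'b) monoid_scheme \<Rightarrow> 'a set \<Rightarrow> 'a \<Rightarrow> nat" where
  "cox_length W S w = (LEAST k. \<exists>ws\<in>lists S. word_prod W ws = w \<and> length ws = k)"

definition reduced_word :: "('a, 'b) monoid_scheme \<Rightarrow> 'a set \<Rightarrow> 'a \<Rightarrow> 'a list" where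
  "reduced_word W S w =
     (SOME ws. ws \<in> lists S \<and> word_prod W ws = w \<and> length ws = cox_length W S w)"

definition right_descent :: "('a, 'b) monoid_scheme \<Rightarrow> 'a set \<Rightarrow> 'a \<Rightarrow> 'a set" where
  "right_descent W S w = {s \<in> S. cox_length W S (w \<otimes>\<^bsub>W\<^esub> s) < cox_length W S w}"


section \<open>The Hecke algebra and Lusztig's a-function\<close>

text \<open>\<open>int \<Rightarrow>\<^sub>0 int\<close> with its convolution product is the ring of integral Laurent polynomials in \<open>v\<close>.
  Normalization: \<open>(T\<^sub>s - v) (T\<^sub>s + v\<inverse>) = 0\<close>.\<close>

type_synonym laurent = "int \<Rightarrow>\<^sub>0 int"

definition v_diff :: laurent where
  "v_diff = Poly_Mapping.single 1 1 - Poly_Mapping.single (- 1) 1"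

definition laurent_bar :: "laurent \<Rightarrow> laurent" where
  "laurent_bar p = Poly_Mapping.map_key uminus p"

text \<open>An element of the Hecke algebra is represented by its coefficients on the basis \<open>T\<^sub>w\<close>.\<close>

definition hecke_space :: "('a, 'b) monoid_scheme \<Rightarrow> ('a \<Rightarrow> laurent) set" where
  "hecke_space W = {f. finite {w. f w \<noteq> 0} \<and> {w. f w \<noteq> 0} \<subseteq> carrier W}"

definition T_basis :: "'a \<Rightarrow> 'a \<Rightarrow> laurent" where
  "T_basis w = (\<lambda>u. if u = w then 1 else 0)"

text \<open>Left multiplication by \<open>T\<^sub>s\<close>, from \<open>T\<^sub>s T\<^sub>w = T\<^sub>s\<^sub>w\<close> if \<open>\<ell>(sw) > \<ell>(w)\<close> and
  \<open>T\<^sub>s T\<^sub>w = T\<^sub>s\<^sub>w + (v - v\<inverse>) T\<^sub>w\<close> if \<open>\<ell>(sw) < \<ell>(w)\<close>; and by \<open>T\<^sub>s\<inverse> = T\<^sub>s - (v - v\<inverse>)\<close>.\<close>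

definition Ts_mult :: "('a, 'b) monoid_scheme \<Rightarrow> 'a set \<Rightarrow> 'a \<Rightarrow> ('a \<Rightarrow> laurent) \<Rightarrow> 'a \<Rightarrow> laurent" where
  "Ts_mult W S s f = (\<lambda>w. if w \<in> carrier W
     then f (s \<otimes>\<^bsub>W\<^esub> w) +
       (if cox_length W S (s \<otimes>\<^bsub>W\<^esub> w) < cox_length W S w then v_diff * f w else 0)
     else 0)"

definition Ts_inv_mult :: "('a, 'b) monoid_scheme \<Rightarrow> 'a set \<Rightarrow> 'a \<Rightarrow> ('a \<Rightarrow> laurent) \<Rightarrow> 'a \<Rightarrow> laurent" where
  "Ts_inv_mult W S s f = (\<lambda>w. Ts_mult W S s f w - v_diff * f w)"

text \<open>For \<open>w = s\<^sub>1 \<dots> s\<^sub>k\<close> reduced, \<open>T\<^sub>w\<close> is the product of the \<open>T\<^sub>s\<close> over this word, and its image under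
  the bar involution is the product of the \<open>T\<^sub>s\<inverse>\<close> in the same order; neither depends on the word.\<close>

definition hecke_mult ::
  "('a, 'b) monoid_scheme \<Rightarrow> 'a set \<Rightarrow> ('a \<Rightarrow> laurent) \<Rightarrow> ('a \<Rightarrow> laurent) \<Rightarrow> 'a \<Rightarrow> laurent" where
  "hecke_mult W S f g = (\<lambda>u. \<Sum>w | f w \<noteq> 0. f w * foldr (Ts_mult W S) (reduced_word W S w) g u)"

definition hecke_bar ::
  "('a, 'b) monoid_scheme \<Rightarrow> 'a set \<Rightarrow> ('a \<Rightarrow> laurent) \<Rightarrow> 'a \<Rightarrow> laurent" where
  "hecke_bar W S f = (\<lambda>u. \<Sum>w | f w \<noteq> 0.
     laurent_bar (f w) * foldr (Ts_inv_mult W S) (reduced_word W S w) (T_basis \<one>\<^bsub>W\<^esub>) u)"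

text \<open>The Kazhdan--Lusztig basis element: bar-invariant, and congruent to \<open>T\<^sub>w\<close> modulo combinations
  of the \<open>T\<^sub>y\<close> with coefficients in \<open>v\<inverse> \<int>[v\<inverse>]\<close>.\<close>

definition kl_basis :: "('a, 'b) monoid_scheme \<Rightarrow> 'a set \<Rightarrow> 'a \<Rightarrow> 'a \<Rightarrow> laurent" where
  "kl_basis W S w = (THE c. c \<in> hecke_space W \<and> hecke_bar W S c = c \<and>
     (\<forall>y. \<forall>k \<in> Poly_Mapping.keys (c y - T_basis w y). k < 0))"

text \<open>\<open>kl_const W S x y z\<close> is the coefficient of the basis element of \<open>z\<close> in the product of those of
  \<open>x\<close> and \<open>y\<close>.\<close>

definition kl_const :: "('a, 'b) monoid_scheme \<Rightarrow> 'a set \<Rightarrow> 'a \<Rightarrow> 'a \<Rightarrow> 'a \<Rightarrow> laurent" where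
  "kl_const W S x y = (THE h. h \<in> hecke_space W \<and>
     hecke_mult W S (kl_basis W S x) (kl_basis W S y) =
       (\<lambda>u. \<Sum>z | h z \<noteq> 0. h z * kl_basis W S z u))"

text \<open>Lusztig's boundedness: the degrees in \<open>v\<close> of the structure constants of the basis \<open>T\<^sub>w\<close> are
  bounded above. It ensures that the minimum defining the a-function exists.\<close>

definition lusztig_bounded :: "('a, 'b) monoid_scheme \<Rightarrow> 'a set \<Rightarrow> bool" where
  "lusztig_bounded W S \<longleftrightarrow> (\<exists>N::nat. \<forall>x\<in>carrier W. \<forall>y\<in>carrier W. \<forall>z\<in>carrier W.
     \<forall>k \<in> Poly_Mapping.keys (hecke_mult W S (T_basis x) (T_basis y) z). k \<le> int N)"

definition a_fun :: "('a, 'b) monoid_scheme \<Rightarrow> 'a set \<Rightarrow> 'a \<Rightarrow> nat" where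
  "a_fun W S z = (LEAST n. \<forall>x\<in>carrier W. \<forall>y\<in>carrier W.
     \<forall>k \<in> Poly_Mapping.keys (kl_const W S x y z). k \<le> int n)"

definition nontrivially_a2_finite :: "('a, 'b) monoid_scheme \<Rightarrow> 'a set \<Rightarrow> bool" where
  "nontrivially_a2_finite W S \<longleftrightarrow>
     finite {w \<in> carrier W. a_fun W S w = 2} \<and> {w \<in> carrier W. a_fun W S w = 2} \<noteq> {}"


section \<open>Star operations\<close>

definition right_coset_decomp ::
  "('a, 'b) monoid_scheme \<Rightarrow> 'a set \<Rightarrow> 'a set \<Rightarrow> 'a \<Rightarrow> 'a \<Rightarrow> 'a \<Rightarrow> bool" where
  "right_coset_decomp W S I w u x \<longleftrightarrow>
     u \<in> carrier W \<and> x \<in> generate W I \<and> w = u \<otimes>\<^bsub>W\<^esub> x \<and>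
     cox_length W S w = cox_length W S u + cox_length W S x \<and> right_descent W S u \<inter> I = {}"

fun alternating :: "nat \<Rightarrow> 'a \<Rightarrow> 'a \<Rightarrow> 'a list" where
  "alternating 0 s t = []"
| "alternating (Suc n) s t = s # alternating n t s"

text \<open>Here \<open>I = {s, t}\<close>, with \<open>s\<close> the first letter of \<open>w\<^sub>I\<close> and \<open>i\<close> its length.\<close>

definition right_upper_star :: "('a, 'b) monoid_scheme \<Rightarrow> 'a set \<Rightarrow> 'a \<Rightarrow> 'a \<Rightarrow> bool" where
  "right_upper_star W S w w' \<longleftrightarrow>
     (\<exists>s\<in>S. \<exists>t\<in>S. \<exists>u i. s \<noteq> t \<and> (cox_m W s t = 0 \<or> 3 \<le> cox_m W s t) \<and>
        1 \<le> i \<and> (cox_m W s t = 0 \<or> i \<le> cox_m W s t - 2) \<and>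
        right_coset_decomp W S {s, t} w u (word_prod W (alternating i s t)) \<and>
        w' = u \<otimes>\<^bsub>W\<^esub> word_prod W (alternating (i + 1) s t))"

definition right_upper_closure :: "('a, 'b) monoid_scheme \<Rightarrow> 'a set \<Rightarrow> 'a \<Rightarrow> 'a set" where
  "right_upper_closure W S x = {w. (right_upper_star W S)\<^sup>*\<^sup>* x w}"

text \<open>The set \<open>I(x,y) = R\<^sub>x \<inter> R\<^sub>y\<inverse>\<close>. It is of interest for left stubs \<open>x\<close>, \<open>y\<close> of a-value 2, but
  the formula makes sense for all elements.\<close>

definition I_set :: "('a, 'b) monoid_scheme \<Rightarrow> 'a set \<Rightarrow> 'a \<Rightarrow> 'a \<Rightarrow> 'a set" where
  "I_set W S x y =
     right_upper_closure W S x \<inter> (\<lambda>z. inv\<^bsub>W\<^esub> z) ` right_upper_closure W S y"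


section \<open>Coxeter types\<close>

text \<open>\<open>\<sigma>\<close> labels the generators by the vertices \<open>L\<close> of a Coxeter diagram with matrix \<open>M\<close>.\<close>

definition has_type ::
  "('a, 'b) monoid_scheme \<Rightarrow> 'a set \<Rightarrow> 'l set \<Rightarrow> ('l \<Rightarrow> 'l \<Rightarrow> nat) \<Rightarrow> ('l \<Rightarrow> 'a) \<Rightarrow> bool" where
  "has_type W S L M \<sigma> \<longleftrightarrow>
     bij_betw \<sigma> L S \<and> (\<forall>i\<in>L. \<forall>j\<in>L. cox_m W (\<sigma> i) (\<sigma> j) = M i j)"

text \<open>A path, where \<open>b i\<close> is the weight of the edge joining \<open>i\<close> and \<open>i + 1\<close>.\<close>

definition path_matrix :: "(nat \<Rightarrow> nat) \<Rightarrow> nat \<Rightarrow> nat \<Rightarrow> nat" where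
  "path_matrix b i j =
     (if i = j then 1 else if j = i + 1 then b i else if i = j + 1 then b j else 2)"

definition type_A :: "('a, 'b) monoid_scheme \<Rightarrow> 'a set \<Rightarrow> nat \<Rightarrow> (nat \<Rightarrow> 'a) \<Rightarrow> bool" where
  "type_A W S n \<sigma> \<longleftrightarrow> has_type W S {1..n} (path_matrix (\<lambda>i. 3)) \<sigma>"

definition type_B :: "('a, 'b) monoid_scheme \<Rightarrow> 'a set \<Rightarrow> nat \<Rightarrow> (nat \<Rightarrow> 'a) \<Rightarrow> bool" where
  "type_B W S n \<sigma> \<longleftrightarrow> has_type W S {1..n} (path_matrix (\<lambda>i. if i = 1 then 4 else 3)) \<sigma>"

text \<open>Type \<open>C\<close>-tilde with \<open>n\<close> generators, that is, of rank index \<open>n - 1\<close>.\<close>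

definition type_C_tilde :: "('a, 'b) monoid_scheme \<Rightarrow> 'a set \<Rightarrow> nat \<Rightarrow> (nat \<Rightarrow> 'a) \<Rightarrow> bool" where
  "type_C_tilde W S n \<sigma> \<longleftrightarrow>
     has_type W S {1..n} (path_matrix (\<lambda>i. if i = 1 \<or> i = n - 1 then 4 else 3)) \<sigma>"

definition type_F :: "('a, 'b) monoid_scheme \<Rightarrow> 'a set \<Rightarrow> nat \<Rightarrow> (nat \<Rightarrow> 'a) \<Rightarrow> bool" where
  "type_F W S n \<sigma> \<longleftrightarrow> has_type W S {1..n} (path_matrix (\<lambda>i. if i = 2 then 4 else 3)) \<sigma>"

definition type_H :: "('a, 'b) monoid_scheme \<Rightarrow> 'a set \<Rightarrow> nat \<Rightarrow> (nat \<Rightarrow> 'a) \<Rightarrow> bool" where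
  "type_H W S n \<sigma> \<longleftrightarrow> has_type W S {1..n} (path_matrix (\<lambda>i. if i = 1 then 5 else 3)) \<sigma>"

text \<open>\<open>Arm i\<close> are the vertices \<open>-q, \<dots>, r\<close> of the path, \<open>Vtx\<close> is the extra vertex \<open>v\<close>.\<close>

datatype E_vertex = Arm int | Vtx

fun E_matrix :: "E_vertex \<Rightarrow> E_vertex \<Rightarrow> nat" where
  "E_matrix (Arm i) (Arm j) = (if i = j then 1 else if \<bar>i - j\<bar> = 1 then 3 else 2)"
| "E_matrix (Arm i) Vtx = (if i = 0 then 3 else 2)"
| "E_matrix Vtx (Arm i) = (if i = 0 then 3 else 2)"
| "E_matrix Vtx Vtx = 1"

definition type_E :: "('a, 'b) monoid_scheme \<Rightarrow> 'a set \<Rightarrow> nat \<Rightarrow> nat \<Rightarrow> (E_vertex \<Rightarrow> 'a) \<Rightarrow> bool" where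
  "type_E W S q r \<sigma> \<longleftrightarrow> has_type W S (insert Vtx (Arm ` {- int q..int r})) E_matrix \<sigma>"

definition labelled_word :: "('a, 'b) monoid_scheme \<Rightarrow> ('l \<Rightarrow> 'a) \<Rightarrow> 'l list \<Rightarrow> 'a" where
  "labelled_word W \<sigma> ls = word_prod W (map \<sigma> ls)"

definition z_word :: "nat \<Rightarrow> nat list" where
  "z_word n = [4..<n] @ [n] @ rev [4..<n]"

end

theory Submission
  imports Defs
begin

text \<open>Call an element thin if no reduced word of it has a long braid word \<open>s t s \<dots>\<close> of length
  \<open>m(s,t) \<ge> 3\<close> or a product of three pairwise commuting generators as a factor. Right upper star
  operations preserve thinness and the left descent set. For \<open>x = s t\<close> with commuting \<open>s\<close>, \<open>t\<close>, every
  element of \<open>I(x,x)\<close> is therefore thin, with both its left and its right descent set equal to \<open>{s,t}\<close>.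
  Such elements can be listed by looking at words up to commutation: cut the word at the occurrences of
  the generator that joins \<open>s\<close> and \<open>t\<close> in the diagram. A generator can recur in consecutive segments only
  if its outer neighbour occurs in the gap, and two such recurrences at once produce three
  commuting generators. Hence only very few segments are possible. Conversely, the listed elements are
  reached from \<open>x\<close> by explicit star operations, and they are involutions.\<close>

section \<open>Coxeter groups: reflections and the exchange condition\<close>

text \<open>Thinness is full commutativity together with a bound on width: no three commuting
  letters side by side. Its use is that the descents of a thin element can be read off any one of
  its reduced words. From then on the group can be forgotten: the word analysis knows only closure
  under factors and commutations and three forbidden patterns (a square, a long braid, a commuting
  triple). The obstacle to preservation is that after \<open>w\<close> becomes \<open>w t\<close> a
  forbidden pattern might sit anywhere in some reduced word. Peeling letters off the right reduces
  this to a pattern at the end; by exchange that pattern involves \<open>t\<close>, and then the old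
  descent \<open>s\<close>, which has to disappear, leads back to a pattern or to two non-commuting
  descents in a thin element. In the classification the first and the last segment contain both
  prescribed descents, while every inner segment must contain enough neighbours of the joining
  generator to keep its two occurrences apart. These demands clash as soon as there are several
  segments. An edge of weight 4 or 5 may allow one more recurrence of a letter, and this is where
  the additional elements come from.\<close>

lemma count_list_map_inj:
  assumes "inj_on f A" "set xs \<subseteq> A" "x \<in> A"
  shows "count_list (map f xs) (f x) = count_list xs x"
  using assms(2) by (induction xs) (use assms(1,3) in \<open>auto dest: inj_onD\<close>)

lemma count_list_distinct: "distinct xs \<Longrightarrow> x \<in> set xs \<Longrightarrow> count_list xs x = 1"
  by (induction xs) (auto simp: count_notin)

text \<open>Locates a letter deleted by the exchange condition relative to a chosen cut of the
  word.\<close>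

lemma append_eq_append_Cons_cases:
  assumes "us @ vs = xs @ a # ys"
  obtains us' where "us = xs @ a # us'" "ys = us' @ vs" | xs' where "xs = us @ xs'" "vs = xs' @ a # ys"
proof -
  from assms consider zs where "us = xs @ zs" "zs @ vs = a # ys" | zs where "us @ zs = xs" "vs = zs @ a # ys"
    by (auto simp: append_eq_append_conv2)
  then show ?thesis
  proof cases
    case 1
    then show ?thesis using that by (cases zs) auto
  qed (use that in blast)
qed

lemma length_alternating [simp]: "length (alternating n s t) = n"
  by (induction n arbitrary: s t) auto

lemma set_alternating: "set (alternating n s t) \<subseteq> {s, t}"
  by (induction n arbitrary: s t) auto

lemma alternating_snoc:
  "alternating (Suc n) s t = alternating n s t @ [if even n then s else t]"
  by (induction n arbitrary: s t) (simp_all del: alternating.simps(2) add: alternating.simps(2)[of "Suc _"], auto)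

lemma rev_alternating:
  "rev (alternating n s t) = (if odd n then alternating n s t else alternating n t s)"
proof (induction n arbitrary: s t)
  case (Suc n)
  have "rev (alternating (Suc n) s t) = (if even n then s else t) # rev (alternating n s t)"
    unfolding alternating_snoc by simp
  then show ?case using Suc by simp
qed simp

lemma alternating_add:
  "alternating (k + l) s t = alternating k s t @ (if even k then alternating l s t else alternating l t s)"
  by (induction k arbitrary: s t) auto

section \<open>Words, length and reflections\<close>

locale coxeter = group W for W (structure) +
  fixes S :: "'a set"
  assumes coxeter_system: "coxeter_system W S"
begin

abbreviation "len \<equiv> cox_length W S"
abbreviation "wp \<equiv> word_prod W"
abbreviation "m \<equiv> cox_m W"
abbreviation "R \<equiv> right_descent W S"

lemma S_sub: "S \<subseteq> carrier W" and S_ne: "s \<in> S \<Longrightarrow> s \<noteq> \<one>" and S_sq: "s \<in> S \<Longrightarrow> s \<otimes> s = \<one>"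
  and generate_S: "generate W S = carrier W"
  and presentation: "set ws \<subseteq> S \<Longrightarrow> wp ws = \<one> \<Longrightarrow> equivclp (cox_step W S) ws []"
  using coxeter_system by (auto simp: coxeter_system_def lists_eq_set)

lemma S_carrier [simp]: "s \<in> S \<Longrightarrow> s \<in> carrier W"
  using S_sub by auto

lemma S_inv: "s \<in> S \<Longrightarrow> inv s = s"
  using S_sq inv_equality by simp

lemma S_cancel: "s \<in> S \<Longrightarrow> x \<in> carrier W \<Longrightarrow> x \<otimes> s \<otimes> s = x"
  by (simp add: m_assoc S_sq)

lemma wp_Nil [simp]: "wp [] = \<one>" and wp_Cons [simp]: "wp (s # ws) = s \<otimes> wp ws"
  by (simp_all add: word_prod_def)

lemma wp_closed [simp]: "set ws \<subseteq> S \<Longrightarrow> wp ws \<in> carrier W"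
  by (induction ws) auto

lemma wp_append [simp]: "set xs \<subseteq> S \<Longrightarrow> set ys \<subseteq> S \<Longrightarrow> wp (xs @ ys) = wp xs \<otimes> wp ys"
  by (induction xs) (auto simp: m_assoc)

lemma wp_rev: "set ws \<subseteq> S \<Longrightarrow> wp (rev ws) = inv (wp ws)"
proof (induction ws)
  case (Cons s ws)
  then show ?case
    using wp_append[of "rev ws" "[s]"] by (auto simp: inv_mult_group S_inv)
qed simp

lemma word_exists: "w \<in> carrier W \<Longrightarrow> \<exists>ws. set ws \<subseteq> S \<and> wp ws = w"
proof -
  assume "w \<in> carrier W"
  then have "w \<in> generate W S" using generate_S by simp
  then show ?thesis
  proof (induction rule: generate.induct)
    case one
    show ?case by (rule exI[of _ "[]"]) auto
  next
    case (incl h)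
    then show ?case by (intro exI[of _ "[h]"]) auto
  next
    case (inv h)
    then show ?case by (intro exI[of _ "[h]"]) (auto simp: S_inv)
  next
    case (eng h1 h2)
    then obtain a b where "set a \<subseteq> S" "set b \<subseteq> S" "wp a = h1" "wp b = h2" by auto
    then show ?case by (intro exI[of _ "a @ b"]) auto
  qed
qed

lemma len_le: "set ws \<subseteq> S \<Longrightarrow> len (wp ws) \<le> length ws"
  unfolding cox_length_def by (rule Least_le) (auto simp: lists_eq_set)

lemma reduced_exists: "w \<in> carrier W \<Longrightarrow> \<exists>ws. set ws \<subseteq> S \<and> wp ws = w \<and> length ws = len w"
proof -
  assume "w \<in> carrier W"
  then have "\<exists>k. \<exists>ws\<in>lists S. wp ws = w \<and> length ws = k"
    using word_exists[of w] by (auto simp: lists_eq_set)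
  from LeastI_ex[OF this] show ?thesis
    unfolding cox_length_def by (auto simp: lists_eq_set)
qed

lemma len_mult_le:
  assumes "x \<in> carrier W" "y \<in> carrier W"
  shows "len (x \<otimes> y) \<le> len x + len y"
proof -
  obtain a b where "set a \<subseteq> S" "set b \<subseteq> S" "wp a = x" "wp b = y" "length a = len x" "length b = len y"
    using reduced_exists assms by metis
  then show ?thesis using len_le[of "a @ b"] by auto
qed

lemma len_one [simp]: "len \<one> = 0"
  using len_le[of "[]"] by simp

lemma len_inv: "x \<in> carrier W \<Longrightarrow> len (inv x) = len x"
proof -
  have le: "len (inv x) \<le> len x" if x: "x \<in> carrier W" for x
  proof -
    obtain a where "set a \<subseteq> S" "wp a = x" "length a = len x" using reduced_exists x by metis
    then show ?thesis using len_le[of "rev a"] wp_rev[of a] by auto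
  qed
  assume "x \<in> carrier W"
  then show ?thesis using le[of x] le[of "inv x"] by auto
qed

lemma len_zero: "x \<in> carrier W \<Longrightarrow> len x = 0 \<Longrightarrow> x = \<one>"
  using reduced_exists by fastforce

lemma len_gen: "s \<in> S \<Longrightarrow> len s = 1"
  using len_le[of "[s]"] len_zero[of s] S_ne[of s] by (cases "len s") auto

text \<open>The parity with which a reflection occurs in this list depends only on the element that the word
  represents, because in the list of a braid relation every reflection occurs an even number of times.
  The exchange condition follows.\<close>

primrec refls :: "'a list \<Rightarrow> 'a list" where
  "refls [] = []"
| "refls (s # ws) = (inv (wp ws) \<otimes> s \<otimes> wp ws) # refls ws"

lemma length_refls [simp]: "length (refls ws) = length ws"
  by (induction ws) auto

lemma refls_carrier: "set ws \<subseteq> S \<Longrightarrow> set (refls ws) \<subseteq> carrier W"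
  by (induction ws) auto

lemma refls_append:
  assumes "set xs \<subseteq> S" "set ys \<subseteq> S"
  shows "refls (xs @ ys) = map (\<lambda>r. inv (wp ys) \<otimes> r \<otimes> wp ys) (refls xs) @ refls ys"
  using assms by (induction xs) (auto simp: inv_mult_group m_assoc)

abbreviation par :: "'a list \<Rightarrow> 'a \<Rightarrow> bool" where
  "par ws t \<equiv> odd (count_list (refls ws) t)"

text \<open>Cocycle rule: the reflections of the left factor get conjugated by the right factor.
  Conjugation is injective, so their multiplicities are only transported.\<close>

lemma count_refls_append:
  assumes "set xs \<subseteq> S" "set ys \<subseteq> S" "t \<in> carrier W"
  shows "count_list (refls (xs @ ys)) t
    = count_list (refls xs) (wp ys \<otimes> t \<otimes> inv (wp ys)) + count_list (refls ys) t"
proof -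
  let ?y = "wp ys"
  let ?f = "\<lambda>r. inv ?y \<otimes> r \<otimes> ?y"
  have y: "?y \<in> carrier W" using assms by simp
  have "inj_on ?f (carrier W)"
    by (rule inj_onI) (use y in \<open>simp add: m_assoc\<close>)
  moreover have "?f (?y \<otimes> t \<otimes> inv ?y) = t"
  proof -
    have "?f (?y \<otimes> t \<otimes> inv ?y) = (inv ?y \<otimes> ?y) \<otimes> t \<otimes> (inv ?y \<otimes> ?y)"
      using y assms(3) by (simp only: m_assoc m_closed inv_closed)
    then show ?thesis using y assms(3) by simp
  qed
  ultimately show ?thesis
    using count_list_map_inj[of ?f "carrier W" "refls xs" "?y \<otimes> t \<otimes> inv ?y"]
      refls_carrier[OF assms(1)] y assms by (simp add: refls_append)
qed

text \<open>The reversal fixes the last letter \<open>s\<close>. The letter in front of the suffix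
  of length \<open>j\<close> then contributes the palindrome of length \<open>2 j + 1\<close> that
  starts with \<open>s\<close>, which is \<open>(s t)^j s\<close>.\<close>

lemma refls_alternating:
  assumes "s \<in> S" "t \<in> S"
  shows "refls (rev (alternating k s t)) = map (\<lambda>j. (s \<otimes> t) [^] j \<otimes> s) (rev [0..<k])"
  using assms
proof (induction k arbitrary: s t)
  case (Suc k)
  have l: "set (rev (alternating k t s)) \<subseteq> S"
    using set_alternating[of k t s] Suc.prems by auto
  have conj: "inv s \<otimes> ((t \<otimes> s) [^] j \<otimes> t) \<otimes> s = (s \<otimes> t) [^] Suc j \<otimes> s" for j :: nat
  proof -
    have "s \<otimes> (t \<otimes> s) [^] j = (s \<otimes> t) [^] j \<otimes> s"
    proof (induction j)
      case (Suc j)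
      have "s \<otimes> (t \<otimes> s) [^] Suc j = (s \<otimes> (t \<otimes> s) [^] j) \<otimes> (t \<otimes> s)"
        using Suc.prems \<open>s \<in> S\<close> \<open>t \<in> S\<close> by (simp add: m_assoc)
      also have "\<dots> = (s \<otimes> t) [^] Suc j \<otimes> s"
        unfolding Suc using \<open>s \<in> S\<close> \<open>t \<in> S\<close> by (simp add: m_assoc)
      finally show ?case .
    qed (use Suc.prems in auto)
    moreover have "inv s \<otimes> ((t \<otimes> s) [^] j \<otimes> t) \<otimes> s = (s \<otimes> (t \<otimes> s) [^] j) \<otimes> t \<otimes> s"
      using Suc.prems by (simp add: S_inv m_assoc)
    ultimately show ?thesis
      using Suc.prems by (simp add: m_assoc)
  qed
  have "refls (rev (alternating (Suc k) s t)) =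
      map (\<lambda>r. inv s \<otimes> r \<otimes> s) (refls (rev (alternating k t s))) @ [s]"
    using refls_append[OF l, of "[s]"] Suc.prems by (simp add: S_inv S_sq)
  also have "\<dots> = map (\<lambda>j. (s \<otimes> t) [^] Suc j \<otimes> s) (rev [0..<k]) @ [s]"
    using Suc.IH[of t s] Suc.prems conj by simp
  also have "\<dots> = map (\<lambda>j. (s \<otimes> t) [^] j \<otimes> s) (rev [0..<Suc k])"
    using Suc.prems by (simp add: rev_map map_Suc_upt[symmetric] upt_conv_Cons comp_def del: upt_Suc nat_pow_Suc)
  finally show ?case .
qed simp

lemma concat_replicate_pair: "concat (replicate k [s, t]) = alternating (2 * k) s t"
  by (induction k) auto

lemma wp_braid:
  assumes "s \<in> S" "t \<in> S" shows "wp (alternating (2 * k) s t) = (s \<otimes> t) [^] k"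
proof (induction k)
  case (Suc k)
  have "wp (alternating (2 * Suc k) s t) = (s \<otimes> t) \<otimes> (s \<otimes> t) [^] k"
    using Suc assms set_alternating[of "2 * k" s t] by (simp add: m_assoc)
  then show ?case using assms nat_pow_Suc2[of "s \<otimes> t" k] by simp
qed simp

lemma pow_m: "s \<in> S \<Longrightarrow> t \<in> S \<Longrightarrow> (s \<otimes> t) [^] m s t = \<one>"
  unfolding cox_m_def by (rule pow_ord_eq_1) auto

lemma m_sym: "s \<in> S \<Longrightarrow> t \<in> S \<Longrightarrow> m s t = m t s"
proof -
  assume st: "s \<in> S" "t \<in> S"
  have "inv (s \<otimes> t) = t \<otimes> s" using st by (simp add: inv_mult_group S_inv)
  then show ?thesis unfolding cox_m_def using ord_inv[of "s \<otimes> t"] st by simp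
qed

lemma par_braid:
  assumes st: "s \<in> S" "t \<in> S" and x: "x \<in> carrier W"
  shows "\<not> par (concat (replicate (m s t) [s, t])) x"
proof -
  let ?m = "m s t"
  let ?f = "\<lambda>j. (t \<otimes> s) [^] j \<otimes> t"
  \<comment> \<open>The powers of \<open>t s\<close> have period \<open>m\<close>, so the
    \<open>2 m\<close> reflections of the relator form two equal halves.\<close>
  have per: "?f (j + ?m) = ?f j" for j
    using st pow_m[of t s] m_sym[of s t] by (simp add: nat_pow_mult[symmetric])
  have "refls (concat (replicate ?m [s, t])) = map ?f (rev [0..<2 * ?m])"
    using refls_alternating[of t s "2 * ?m"] st rev_alternating[of "2 * ?m" t s]
    by (simp add: concat_replicate_pair)
  moreover have "[0..<2 * ?m] = [0..<?m] @ map (\<lambda>i. i + ?m) [0..<?m]"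
    using upt_add_eq_append[of 0 ?m ?m] map_add_upt[of ?m ?m] by (simp add: mult_2)
  ultimately have "refls (concat (replicate ?m [s, t])) = map ?f (rev [0..<?m]) @ map ?f (rev [0..<?m])"
    using per by (simp add: rev_map)
  then show ?thesis by simp
qed

lemma cox_step_par:
  assumes "cox_step W S ws vs" "x \<in> carrier W" shows "par ws x = par vs x"
  using assms
proof (induction rule: cox_step.induct)
  case (1 xs ys s t)
  let ?c = "concat (replicate (m s t) [s, t])"
  have xy: "set xs \<subseteq> S" "set ys \<subseteq> S" using 1 by auto
  have c: "set ?c \<subseteq> S" using 1 set_alternating[of "2 * m s t" s t] by (auto simp: concat_replicate_pair)
  have wc: "wp ?c = \<one>" using wp_braid[of s t "m s t"] 1 pow_m by (simp add: concat_replicate_pair)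
  have "count_list (refls (xs @ ?c @ ys)) x = count_list (refls xs) (wp ys \<otimes> x \<otimes> inv (wp ys)) +
      (count_list (refls ?c) (wp ys \<otimes> x \<otimes> inv (wp ys)) + count_list (refls ys) x)"
    using count_refls_append[of xs "?c @ ys"] count_refls_append[of ?c ys] c xy 1 wc by simp
  moreover have "\<not> par ?c (wp ys \<otimes> x \<otimes> inv (wp ys))"
    using par_braid[of s t] 1 xy by simp
  ultimately show ?case
    using count_refls_append[of xs ys x] 1 xy by simp
qed

lemma par_one:
  assumes "set ws \<subseteq> S" "wp ws = \<one>" "x \<in> carrier W" shows "\<not> par ws x"
proof -
  have "equivclp (cox_step W S) ws []" using presentation assms by blast
  then have "par ws x = par [] x"
    by (induction rule: equivclp_induct) (use cox_step_par assms(3) in blast)+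
  then show ?thesis by simp
qed

text \<open>The word \<open>ws @ rev vs @ vs\<close> is bracketed in two ways. Each bracketing
  splits off a word for the identity, whose contribution is even by \<open>par_one\<close>, and
  leaves \<open>vs\<close> or \<open>ws\<close>.\<close>

lemma par_cong:
  assumes "set ws \<subseteq> S" "set vs \<subseteq> S" "wp ws = wp vs" "x \<in> carrier W"
  shows "par ws x = par vs x"
proof -
  have r: "set (rev vs) \<subseteq> S" using assms by auto
  have 1: "wp (ws @ rev vs) = \<one>" "wp (rev vs @ vs) = \<one>"
    using assms r by (auto simp: wp_rev)
  have "count_list (refls ((ws @ rev vs) @ vs)) x
      = count_list (refls (ws @ rev vs)) (wp vs \<otimes> x \<otimes> inv (wp vs)) + count_list (refls vs) x"
    by (rule count_refls_append) (use assms r in auto)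
  moreover have "count_list (refls (ws @ (rev vs @ vs))) x
      = count_list (refls ws) x + count_list (refls (rev vs @ vs)) x"
    using count_refls_append[of ws "rev vs @ vs" x] assms r 1 by auto
  moreover have "\<not> par (ws @ rev vs) (wp vs \<otimes> x \<otimes> inv (wp vs))" "\<not> par (rev vs @ vs) x"
    using par_one 1 assms r by auto
  ultimately show ?thesis by (metis append.assoc even_add)
qed

text \<open>Multiplication by the reflection attached to a letter cancels precisely that
  letter.\<close>

lemma refl_deletion:
  assumes "set ws \<subseteq> S" "x \<in> set (refls ws)"
  shows "\<exists>xs a ys. ws = xs @ a # ys \<and> wp ws \<otimes> x = wp (xs @ ys)"
  using assms
proof (induction ws)
  case (Cons s ws)
  show ?case
  proof (cases "x \<in> set (refls ws)")
    case True
    then obtain xs a ys where "ws = xs @ a # ys" "wp ws \<otimes> x = wp (xs @ ys)" using Cons by auto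
    moreover have "x \<in> carrier W" using Cons.prems refls_carrier[of ws] True by auto
    ultimately have "s # ws = (s # xs) @ a # ys" "wp (s # ws) \<otimes> x = wp ((s # xs) @ ys)"
      using Cons.prems by (auto simp: m_assoc)
    then show ?thesis by blast
  next
    case False
    then have x: "x = inv (wp ws) \<otimes> s \<otimes> wp ws" using Cons.prems by auto
    have "wp (s # ws) \<otimes> x = s \<otimes> (wp ws \<otimes> inv (wp ws)) \<otimes> s \<otimes> wp ws"
      using Cons.prems unfolding x by (simp only: m_assoc m_closed inv_closed wp_closed wp_Cons S_carrier set_simps insert_subset)
    also have "\<dots> = wp ws" using Cons.prems by (simp add: S_sq)
    finally show ?thesis
      by (intro exI[of _ "[]"] exI[of _ s] exI[of _ ws]) auto
  qed
qed auto

lemma par_imp_len_less: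
  assumes "set ws \<subseteq> S" "s \<in> S" "par ws s" shows "len (wp ws \<otimes> s) < len (wp ws)"
proof -
  obtain vs where vs: "set vs \<subseteq> S" "wp vs = wp ws" "length vs = len (wp ws)"
    using reduced_exists[of "wp ws"] assms by auto
  then have "par vs s" using assms par_cong[of ws vs s] by auto
  then have "s \<in> set (refls vs)" using count_notin[of s "refls vs"] by fastforce
  then obtain xs a ys where "vs = xs @ a # ys" "wp vs \<otimes> s = wp (xs @ ys)"
    using refl_deletion vs by metis
  then show ?thesis using len_le[of "xs @ ys"] vs by auto
qed

lemma par_snoc:
  assumes "set ws \<subseteq> S" "s \<in> S" shows "par (ws @ [s]) s \<longleftrightarrow> \<not> par ws s"
  using assms count_refls_append[of ws "[s]" s] by (simp add: S_inv S_sq S_cancel)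

lemma len_less_iff_par:
  assumes "set ws \<subseteq> S" "s \<in> S" shows "len (wp ws \<otimes> s) < len (wp ws) \<longleftrightarrow> par ws s"
proof
  assume l: "len (wp ws \<otimes> s) < len (wp ws)"
  show "par ws s"
  proof (rule ccontr)
    assume "\<not> par ws s"
    \<comment> \<open>The appended letter adds the reflection \<open>s\<close> once and flips the
      parity. Hence multiplying \<open>ws @ [s]\<close> by \<open>s\<close> shortens it, which says
      that \<open>w\<close> is shorter than \<open>w s\<close>.\<close>
    then have "par (ws @ [s]) s" using par_snoc assms by blast
    then show False using par_imp_len_less[of "ws @ [s]" s] assms l by (auto simp: S_cancel)
  qed
qed (use par_imp_len_less assms in blast)

lemma exchange:
  assumes "set ws \<subseteq> S" "s \<in> S" "len (wp ws \<otimes> s) < len (wp ws)"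
  shows "\<exists>xs a ys. ws = xs @ a # ys \<and> wp ws \<otimes> s = wp (xs @ ys)"
proof -
  have "par ws s" using len_less_iff_par assms by blast
  then have "s \<in> set (refls ws)" using count_notin[of s "refls ws"] by fastforce
  then show ?thesis using refl_deletion assms by blast
qed

lemma len_mult_gen:
  assumes "w \<in> carrier W" "s \<in> S"
  shows "s \<in> R w \<Longrightarrow> len w = Suc (len (w \<otimes> s))" "s \<notin> R w \<Longrightarrow> len (w \<otimes> s) = Suc (len w)"
proof -
  have 1: "len (w \<otimes> s) \<le> len w + 1" "len w \<le> len (w \<otimes> s) + 1"
    using len_mult_le[of w s] len_mult_le[of "w \<otimes> s" s] assms len_gen[of s] by (auto simp: S_cancel)
  \<comment> \<open>Exactly one of \<open>ws\<close> and \<open>ws @ [s]\<close> has odd parity at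
    \<open>s\<close>, so exactly one of the two strict inequalities between the lengths
    holds.\<close>
  have "len (w \<otimes> s) \<noteq> len w"
  proof -
    obtain ws where ws: "set ws \<subseteq> S" "wp ws = w" using word_exists assms by auto
    then show ?thesis
      using len_less_iff_par[of ws s] len_less_iff_par[of "ws @ [s]" s] par_snoc[of ws s] assms
      by (auto simp: S_cancel)
  qed
  then show "s \<in> R w \<Longrightarrow> len w = Suc (len (w \<otimes> s))" "s \<notin> R w \<Longrightarrow> len (w \<otimes> s) = Suc (len w)"
    using 1 assms by (auto simp: right_descent_def)
qed

lemma descent_mult:
  assumes "w \<in> carrier W" "s \<in> S" shows "s \<in> R (w \<otimes> s) \<longleftrightarrow> s \<notin> R w"
proof -
  have "w \<otimes> s \<otimes> s = w" using assms by (rule S_cancel[rotated])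
  then show ?thesis using len_mult_gen(2)[OF assms] assms(2) by (auto simp: right_descent_def)
qed

lemma R_sub: "s \<in> R w \<Longrightarrow> s \<in> S"
  by (auto simp: right_descent_def)

section \<open>Thin elements and right upper star operations\<close>

definition reduced :: "'a list \<Rightarrow> bool" where
  "reduced ws \<longleftrightarrow> set ws \<subseteq> S \<and> len (wp ws) = length ws"

lemma reduced_S: "reduced ws \<Longrightarrow> set ws \<subseteq> S"
  by (simp add: reduced_def)

lemma reduced_word_exists: "w \<in> carrier W \<Longrightarrow> \<exists>ws. reduced ws \<and> wp ws = w"
  using reduced_exists[of w] by (auto simp: reduced_def)

lemma reduced_append: "reduced (xs @ ys) \<Longrightarrow> reduced xs \<and> reduced ys"
  using len_mult_le[of "wp xs" "wp ys"] len_le[of xs] len_le[of ys] by (auto simp: reduced_def)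

lemma reduced_rev: "reduced ws \<Longrightarrow> reduced (rev ws)"
  by (simp add: reduced_def wp_rev len_inv)

lemma descent_snoc: "reduced (ws @ [s]) \<Longrightarrow> s \<in> R (wp (ws @ [s])) \<and> wp (ws @ [s]) \<otimes> s = wp ws"
  using len_le[of ws] by (auto simp: reduced_def right_descent_def S_cancel)

lemma reduced_snoc: "reduced ws \<Longrightarrow> s \<in> S \<Longrightarrow> s \<notin> R (wp ws) \<Longrightarrow> reduced (ws @ [s])"
  using len_mult_gen(2)[of "wp ws" s] by (auto simp: reduced_def)

lemma reduced_deletion:
  assumes "reduced ws" "s \<in> R (wp ws)"
  shows "\<exists>xs a ys. ws = xs @ a # ys \<and> wp ws \<otimes> s = wp (xs @ ys) \<and> reduced (xs @ ys)"
proof -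
  have ws: "set ws \<subseteq> S" "s \<in> S" using assms R_sub reduced_S by auto
  then obtain xs a ys where d: "ws = xs @ a # ys" "wp ws \<otimes> s = wp (xs @ ys)"
    using exchange[of ws s] assms by (auto simp: right_descent_def)
  moreover have "reduced (xs @ ys)"
    using len_mult_gen(1)[of "wp ws" s] assms ws d by (auto simp: reduced_def)
  ultimately show ?thesis by blast
qed

text \<open>A reflection listed once has odd parity, hence appears in the list of every word for the
  same element; no such word can be shorter.\<close>

lemma distinct_refls_reduced:
  assumes "set ws \<subseteq> S" "distinct (refls ws)" shows "reduced ws"
proof -
  obtain vs where vs: "set vs \<subseteq> S" "wp vs = wp ws" "length vs = len (wp ws)"
    using reduced_exists[of "wp ws"] assms by auto
  have "set (refls ws) \<subseteq> set (refls vs)"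
  proof
    fix x assume x: "x \<in> set (refls ws)"
    then have "count_list (refls ws) x = 1"
      using count_list_distinct assms(2) by metis
    then have "par vs x" using par_cong[of ws vs x] assms vs x refls_carrier[of ws] by auto
    then show "x \<in> set (refls vs)" using count_notin[of x "refls vs"] by fastforce
  qed
  then have "card (set (refls ws)) \<le> length vs"
    by (metis card_length card_mono finite_set le_trans length_refls)
  then show ?thesis using vs assms len_le[of ws] distinct_card[of "refls ws"] by (simp add: reduced_def)
qed

section \<open>Parabolic subsets and pairs of right descents\<close>

lemma alternating_S: "s \<in> S \<Longrightarrow> t \<in> S \<Longrightarrow> set (alternating k s t) \<subseteq> S"
  using set_alternating[of k s t] by auto

lemma m_ne_1: "s \<in> S \<Longrightarrow> t \<in> S \<Longrightarrow> s \<noteq> t \<Longrightarrow> m s t \<noteq> 1"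
proof
  assume st: "s \<in> S" "t \<in> S" "s \<noteq> t" "m s t = 1"
  then have "s \<otimes> t = \<one>" using pow_m[of s t] by simp
  then show False using st S_inv[of t] inv_equality[of s t] by simp
qed

lemma m_self: "s \<in> S \<Longrightarrow> m s s = 1"
  unfolding cox_m_def by (simp add: S_sq)

lemma m_2_commute: "s \<in> S \<Longrightarrow> t \<in> S \<Longrightarrow> m s t = 2 \<Longrightarrow> s \<otimes> t = t \<otimes> s"
proof -
  assume st: "s \<in> S" "t \<in> S" "m s t = 2"
  then have "(s \<otimes> t) \<otimes> (s \<otimes> t) = \<one>" using pow_m[of s t] by (simp add: numeral_2_eq_2)
  then have "inv (s \<otimes> t) = s \<otimes> t" using st by (intro inv_equality) auto
  then show ?thesis using st by (simp add: inv_mult_group S_inv)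
qed

text \<open>The reflections \<open>(s t)^j s\<close> with \<open>j < k\<close> are distinct because
  \<open>s t\<close> has order \<open>m s t\<close>.\<close>

lemma alternating_reduced:
  assumes st: "s \<in> S" "t \<in> S" "s \<noteq> t" and k: "m s t = 0 \<or> k \<le> m s t"
  shows "reduced (rev (alternating k s t))"
proof (rule distinct_refls_reduced)
  show "set (rev (alternating k s t)) \<subseteq> S" using alternating_S st by simp
  have "inj_on (\<lambda>j. (s \<otimes> t) [^] j \<otimes> s) {..<k}"
  proof (rule linorder_inj_onI')
    fix i j assume ij: "i \<in> {..<k}" "j \<in> {..<k}" "i < j"
    show "(s \<otimes> t) [^] i \<otimes> s \<noteq> (s \<otimes> t) [^] j \<otimes> s"
    proof
      assume "(s \<otimes> t) [^] i \<otimes> s = (s \<otimes> t) [^] j \<otimes> s"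
      then have "(s \<otimes> t) [^] (j - i) = \<one>"
        using pow_eq_div2[of "s \<otimes> t" j i] st by simp
      then have "m s t dvd j - i" using pow_eq_id[of "s \<otimes> t" "j - i"] st by (simp add: cox_m_def)
      then show False using ij k by (auto dest: dvd_imp_le)
    qed
  qed
  then have "distinct (map (\<lambda>j. (s \<otimes> t) [^] j \<otimes> s) (rev [0..<k]))"
    by (simp add: distinct_map atLeast0LessThan)
  then show "distinct (refls (rev (alternating k s t)))" using refls_alternating[of s t k] st by simp
qed

text \<open>The deletion condition only removes letters, so a word over \<open>J\<close> is reduced
  without leaving \<open>J\<close>.\<close>

lemma reduced_word_in_subset:
  assumes "set ws \<subseteq> J" "J \<subseteq> S"
  shows "\<exists>vs. set vs \<subseteq> J \<and> reduced vs \<and> wp vs = wp ws"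
  using assms(1)
proof (induction ws rule: rev_induct)
  case Nil
  show ?case by (intro exI[of _ "[]"]) (simp add: reduced_def)
next
  case (snoc s ws)
  then obtain vs where vs: "set vs \<subseteq> J" "reduced vs" "wp vs = wp ws" by auto
  have s: "s \<in> J" "s \<in> S" and ws: "set ws \<subseteq> S" using snoc assms by auto
  show ?case
  proof (cases "s \<in> R (wp vs)")
    case True
    then obtain xs a ys where "vs = xs @ a # ys" "wp vs \<otimes> s = wp (xs @ ys)" "reduced (xs @ ys)"
      using reduced_deletion vs by metis
    then show ?thesis using vs s ws by (intro exI[of _ "xs @ ys"]) auto
  next
    case False
    then show ?thesis using vs s ws reduced_snoc[of vs s] reduced_S[of vs]
      by (intro exI[of _ "vs @ [s]"]) auto
  qed
qed

lemma generator_in_subset: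
  assumes "set ws \<subseteq> J" "J \<subseteq> S" "wp ws \<in> S" shows "wp ws \<in> J"
proof -
  obtain vs where vs: "set vs \<subseteq> J" "reduced vs" "wp vs = wp ws"
    using reduced_word_in_subset[OF assms(1,2)] by blast
  then have "length vs = 1" using len_gen assms(3) by (simp add: reduced_def)
  then obtain j where j: "vs = [j]" by (cases vs) auto
  then have "j \<in> J" "j \<in> S" using vs(1) assms(2) by auto
  then show ?thesis unfolding vs(3)[symmetric] j by simp
qed

text \<open>If \<open>s\<close> were a descent, exchange would write \<open>s\<close> as a product
  of letters of \<open>ws\<close>, and a generator in a parabolic subgroup belongs to its generating
  set.\<close>

lemma no_descent_outside_support:
  assumes "set ws \<subseteq> S" "s \<notin> set ws" shows "s \<notin> R (wp ws)"
proof
  assume s: "s \<in> R (wp ws)"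
  then have sS: "s \<in> S" by (rule R_sub)
  obtain xs a ys where d: "ws = xs @ a # ys" "wp ws \<otimes> s = wp (xs @ ys)"
    using exchange[of ws s] assms s sS by (auto simp: right_descent_def)
  have "s = inv (wp ws) \<otimes> (wp ws \<otimes> s)" using assms sS by (simp add: m_assoc[symmetric])
  also have "\<dots> = wp (rev ws) \<otimes> wp (xs @ ys)" using assms d(2) by (simp add: wp_rev)
  also have "\<dots> = wp (rev ws @ xs @ ys)" using assms d(1) by (subst wp_append[symmetric]) auto
  finally have "s \<in> set ws"
    using generator_in_subset[of "rev ws @ xs @ ys" "set ws"] assms sS d(1) by auto
  then show False using assms by blast
qed

text \<open>The alternating suffix grows one letter at a time: if it ends in one of the two
  descents, exchange with the other descent must delete a letter to the left of the suffix.\<close>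

lemma dihedral_factor:
  assumes "s \<in> R w" "t \<in> R w" "s \<noteq> t" "w \<in> carrier W" "m s t = 0 \<or> k \<le> m s t"
  shows "\<exists>us. reduced (us @ rev (alternating k s t)) \<and> w = wp (us @ rev (alternating k s t))"
  using assms
proof (induction k arbitrary: s t)
  case 0
  then show ?case using reduced_word_exists[of w] by auto
next
  case (Suc k)
  have st: "s \<in> S" "t \<in> S" using Suc.prems R_sub by auto
  let ?A = "rev (alternating k t s)"
  obtain us where us: "reduced (us @ ?A)" "w = wp (us @ ?A)"
    using Suc.IH[of t s] Suc.prems m_sym[of s t] st by auto
  have uS: "set us \<subseteq> S" using reduced_S[OF us(1)] by simp
  have AS: "set ?A \<subseteq> S" using alternating_S st by simp
  obtain xs a ys where d: "us @ ?A = xs @ a # ys" "w \<otimes> s = wp (xs @ ys)" "reduced (xs @ ys)"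
    using reduced_deletion[OF us(1)] Suc.prems us by metis
  from d(1) consider us' where "us = xs @ a # us'" "ys = us' @ ?A" | x' where "xs = us @ x'" "?A = x' @ a # ys"
    by (rule append_eq_append_Cons_cases)
  then show ?case
  proof cases
    case 1
    have "w = wp (xs @ ys) \<otimes> s" using d(2) Suc.prems st by (metis S_cancel)
    then have w: "w = wp ((xs @ us') @ rev (alternating (Suc k) s t))"
      using 1 uS AS st by (auto simp: m_assoc)
    moreover have "length ((xs @ us') @ rev (alternating (Suc k) s t)) = len w"
      using us 1 by (auto simp: reduced_def)
    ultimately show ?thesis using uS 1 AS st
      by (intro exI[of _ "xs @ us'"]) (auto simp: reduced_def)
  next
    case 2
    have x'S: "set x' \<subseteq> S" "set ys \<subseteq> S" using AS 2 by auto
    \<comment> \<open>Here the deleted letter lies inside the suffix. Cancelling \<open>us\<close>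
      would express an alternating word of length \<open>k + 1\<close>, reduced because
      \<open>k + 1\<close> does not exceed a finite \<open>m s t\<close>, by \<open>k - 1\<close>
      letters.\<close>
    have "wp us \<otimes> wp (?A @ [s]) = wp us \<otimes> wp (x' @ ys)"
      using d(2) us uS AS st 2(1) x'S by (auto simp: m_assoc)
    then have "wp (?A @ [s]) = wp (x' @ ys)"
      using uS AS st x'S by simp
    moreover have "reduced (?A @ [s])"
      using alternating_reduced[of s t "Suc k"] Suc.prems st by simp
    moreover have "Suc (length (x' @ ys)) = k" using arg_cong[OF 2(2), of length] by simp
    ultimately show ?thesis using len_le[of "x' @ ys"] x'S by (simp add: reduced_def)
  qed
qed

lemma descents_m_ne_0:
  assumes "s \<in> R w" "t \<in> R w" "s \<noteq> t" "w \<in> carrier W" shows "m s t \<noteq> 0"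
proof
  assume "m s t = 0"
  \<comment> \<open>With infinite order the alternating suffix may have any length; one more than
    the length of \<open>w\<close> is absurd.\<close>
  then obtain us where "reduced (us @ rev (alternating (Suc (len w)) s t))"
      "w = wp (us @ rev (alternating (Suc (len w)) s t))"
    using dihedral_factor[OF assms] by blast
  then have "len w = length (us @ rev (alternating (Suc (len w)) s t))" by (metis reduced_def)
  then show False by simp
qed

lemma commuting_descent:
  assumes "s \<in> R w" "t \<in> R w" "s \<noteq> t" "w \<in> carrier W" "m s t = 2" shows "s \<in> R (w \<otimes> t)"
proof -
  obtain us where us: "reduced (us @ rev (alternating 2 t s))" "w = wp (us @ rev (alternating 2 t s))"
    using dihedral_factor[of t w s 2] assms m_sym[of s t] R_sub by auto
  then have "reduced ((us @ [s]) @ [t])" "w = wp ((us @ [s]) @ [t])" by (simp_all add: numeral_2_eq_2)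
  then show ?thesis using descent_snoc[of "us @ [s]" t] descent_snoc[of us s] reduced_append by metis
qed

section \<open>Thin elements\<close>

definition braid_word :: "'a list \<Rightarrow> bool" where
  "braid_word c \<longleftrightarrow> (\<exists>p\<in>S. \<exists>q\<in>S. p \<noteq> q \<and> 3 \<le> m p q \<and> c = alternating (m p q) p q)"

text \<open>Since \<open>m p p = 1\<close>, the value 2 for all pairs makes the three generators
  distinct.\<close>

definition commuting_triple :: "'a list \<Rightarrow> bool" where
  "commuting_triple c \<longleftrightarrow> (\<exists>p\<in>S. \<exists>q\<in>S. \<exists>r\<in>S. m p q = 2 \<and> m p r = 2 \<and> m q r = 2 \<and> c = [p, q, r])"

definition thin :: "'a \<Rightarrow> bool" where
  "thin w \<longleftrightarrow> (\<forall>xs c ys. reduced (xs @ c @ ys) \<longrightarrow> wp (xs @ c @ ys) = w \<longrightarrow>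
     \<not> braid_word c \<and> \<not> commuting_triple c)"

lemma thinD: "thin w \<Longrightarrow> reduced (xs @ c @ ys) \<Longrightarrow> wp (xs @ c @ ys) = w \<Longrightarrow> braid_word c \<or> commuting_triple c \<Longrightarrow> False"
  by (auto simp: thin_def)

lemma braid_word_rev_alternating:
  assumes "p \<in> S" "q \<in> S" "p \<noteq> q" "3 \<le> m p q" shows "braid_word (rev (alternating (m p q) p q))"
proof (cases "odd (m p q)")
  case True
  then show ?thesis unfolding braid_word_def rev_alternating using assms by auto
next
  case False
  then have "rev (alternating (m p q) p q) = alternating (m q p) q p" "3 \<le> m q p"
    using assms m_sym[of p q] by (simp_all add: rev_alternating)
  then show ?thesis unfolding braid_word_def using assms by metis
qed

lemma braid_word_cases:
  assumes "braid_word c"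
  obtains p q where "p \<in> S" "q \<in> S" "p \<noteq> q" "3 \<le> m p q" "c = rev (alternating (m p q) p q)"
proof -
  obtain p q where pq: "p \<in> S" "q \<in> S" "p \<noteq> q" "3 \<le> m p q" "c = alternating (m p q) p q"
    using assms by (auto simp: braid_word_def)
  show thesis
  proof (cases "odd (m p q)")
    case True
    then show ?thesis using that[of p q] pq by (simp add: rev_alternating)
  next
    case False
    then show ?thesis using that[of q p] pq m_sym[of p q] by (simp add: rev_alternating)
  qed
qed

text \<open>The braid relation: the relator \<open>(p q)^m\<close> falls into two halves, one being
  the inverse of the other side.\<close>

lemma wp_longest:
  assumes "p \<in> S" "q \<in> S" shows "wp (rev (alternating (m p q) p q)) = wp (rev (alternating (m p q) q p))"
proof -
  let ?m = "m p q"
  have S: "set (alternating k p q) \<subseteq> S" "set (alternating k q p) \<subseteq> S" for k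
    using alternating_S assms by auto
  have "alternating (2 * ?m) p q = alternating ?m p q @ rev (alternating ?m q p)"
    using alternating_add[of ?m ?m p q] by (simp add: mult_2 rev_alternating)
  then have "wp (alternating ?m p q) \<otimes> wp (rev (alternating ?m q p)) = \<one>"
    using wp_braid[of p q ?m] pow_m[of p q] assms S by simp
  then have "inv (wp (rev (alternating ?m q p))) = wp (alternating ?m p q)"
    using S by (intro inv_equality) auto
  then have "wp (rev (alternating ?m q p)) = inv (wp (alternating ?m p q))"
    using S by (metis inv_inv set_rev wp_closed)
  then show ?thesis using S by (simp add: wp_rev)
qed

lemma braid_descents:
  assumes pq: "p \<in> S" "q \<in> S" "p \<noteq> q" "m p q \<noteq> 0" and r: "reduced (xs @ rev (alternating (m p q) p q))"
  shows "reduced (xs @ rev (alternating (m p q) q p))"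
    and "wp (xs @ rev (alternating (m p q) p q)) = wp (xs @ rev (alternating (m p q) q p))"
  using r wp_longest[OF pq(1,2)] alternating_S[of p q "m p q"] alternating_S[of q p "m p q"] pq
  by (auto simp: reduced_def)

text \<open>For a non-commuting pair of descents the full alternating suffix from
  \<open>dihedral_factor\<close> would be a long braid.\<close>

lemma commuting_if_thin:
  assumes "thin w" "s \<in> R w" "t \<in> R w" "s \<noteq> t" "w \<in> carrier W" shows "m s t = 2"
proof (rule ccontr)
  assume "m s t \<noteq> 2"
  then have m: "3 \<le> m s t" using descents_m_ne_0[of s w t] m_ne_1[of s t] R_sub assms by force
  obtain us where us: "reduced (us @ rev (alternating (m s t) s t) @ [])"
      "w = wp (us @ rev (alternating (m s t) s t) @ [])"
    using dihedral_factor[of s w t "m s t"] assms by auto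
  then show False using thinD[OF assms(1) us(1)] braid_word_rev_alternating[of s t] R_sub assms m by metis
qed

lemma thin_descent:
  assumes "thin w" "s \<in> R w" "w \<in> carrier W" shows "thin (w \<otimes> s)"
  unfolding thin_def
proof (intro allI impI)
  fix xs c ys assume r: "reduced (xs @ c @ ys)" "wp (xs @ c @ ys) = w \<otimes> s"
  have s: "s \<in> S" using assms R_sub by auto
  have w: "wp (xs @ c @ ys) \<otimes> s = w" using r assms s by (simp add: S_cancel)
  have "s \<notin> R (w \<otimes> s)" using descent_mult[of w s] assms s by simp
  then have 1: "reduced (xs @ c @ ys @ [s])" using reduced_snoc[OF r(1) s] r by simp
  moreover have "wp (xs @ c @ ys @ [s]) = w"
    using w reduced_S[OF r(1)] s by (auto simp: m_assoc)
  ultimately show "\<not> braid_word c \<and> \<not> commuting_triple c" using thinD[OF assms(1)] by blast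
qed

lemma rev_braid: "braid_word c \<Longrightarrow> braid_word (rev c)"
  using braid_word_cases[of c] by (metis braid_word_def rev_rev_ident)

lemma rev_commuting_triple: "commuting_triple c \<Longrightarrow> commuting_triple (rev c)"
  unfolding commuting_triple_def using m_sym by fastforce

lemma thin_inv: "thin w \<Longrightarrow> w \<in> carrier W \<Longrightarrow> thin (inv w)"
  unfolding thin_def
proof (intro allI impI, goal_cases)
  case (1 xs c ys)
  have S: "set xs \<subseteq> S" "set c \<subseteq> S" "set ys \<subseteq> S" using reduced_S[OF 1(3)] by auto
  have "wp (rev (xs @ c @ ys)) = w" using 1 S by (subst wp_rev) auto
  then show ?case using 1(1)[rule_format, of "rev ys" "rev c" "rev xs"] reduced_rev[OF 1(3)]
      rev_braid[of c] rev_commuting_triple[of c] by auto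
qed

text \<open>What is left of a right upper star operation \<open>w \<mapsto> w t\<close> once the coset decomposition is forgotten.\<close>

definition star :: "'a \<Rightarrow> 'a \<Rightarrow> 'a \<Rightarrow> bool" where
  "star w s t \<longleftrightarrow> w \<in> carrier W \<and> s \<noteq> t \<and> t \<in> S \<and> m s t \<noteq> 2 \<and> s \<in> R w \<and> t \<notin> R w \<and> s \<notin> R (w \<otimes> t)"

text \<open>Exchange with \<open>t\<close> turns \<open>xs @ c\<close> into a word for
  \<open>w\<close> by deleting one letter. A deletion in \<open>xs\<close> leaves \<open>c\<close>
  inside \<open>w\<close>; so the deletion hits \<open>c\<close>, and then \<open>t\<close> is a
  letter of \<open>c\<close>.\<close>

lemma star_thin_end:
  assumes st: "star w s t" and g: "thin w" and r: "reduced (xs @ c)" "wp (xs @ c) = w \<otimes> t"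
    and c: "braid_word c \<or> commuting_triple c"
  shows False
proof -
  have S: "s \<in> S" "t \<in> S" "w \<in> carrier W" "s \<noteq> t" "m s t \<noteq> 2" "s \<in> R w" "t \<notin> R w" "s \<notin> R (w \<otimes> t)"
    using st R_sub by (auto simp: star_def)
  have wt: "t \<in> R (w \<otimes> t)" "w \<otimes> t \<otimes> t = w" using descent_mult S S_cancel by auto
  have xc: "set xs \<subseteq> S" "set c \<subseteq> S" using reduced_S[OF r(1)] by auto
  obtain xs' a ys' where d: "xs @ c = xs' @ a # ys'" "w = wp (xs' @ ys')" "reduced (xs' @ ys')"
    using reduced_deletion[OF r(1)] r(2) wt by metis
  from d(1) consider z where "xs = xs' @ a # z" "ys' = z @ c" | z where "xs' = xs @ z" "c = z @ a # ys'"
    by (rule append_eq_append_Cons_cases)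
  then show False
  proof cases
    case 1
    then show False using thinD[OF g, of "xs' @ z" c "[]"] d c by auto
  next
    case 2
    have z: "set z \<subseteq> S" "set ys' \<subseteq> S" "a \<in> S" using xc 2 by auto
    have "wp (xs @ c) = wp (xs @ (z @ ys')) \<otimes> t" using r d 2 by simp
    then have "wp xs \<otimes> wp c = wp xs \<otimes> (wp (z @ ys') \<otimes> t)"
      using xc z S by (simp add: m_assoc)
    then have ct: "wp c = wp (z @ ys') \<otimes> t" using xc z S by simp
    \<comment> \<open>This writes \<open>t\<close> by letters of \<open>c\<close> alone, so
      \<open>t\<close> is itself one of them.\<close>
    have "t = inv (wp (z @ ys')) \<otimes> (wp (z @ ys') \<otimes> t)"
      using z S by (simp add: m_assoc[symmetric] del: wp_append)
    also have "\<dots> = wp (rev (z @ ys')) \<otimes> wp c" unfolding ct[symmetric] using z by (subst wp_rev) auto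
    also have "\<dots> = wp (rev (z @ ys') @ c)" using z xc by (subst wp_append) auto
    finally have tc: "t \<in> set c"
      using generator_in_subset[of "rev (z @ ys') @ c" "set c"] xc S 2 by auto
    show False using c
    proof
      assume "braid_word c"
      then obtain p q where pq: "p \<in> S" "q \<in> S" "p \<noteq> q" "3 \<le> m p q" "c = rev (alternating (m p q) p q)"
        by (rule braid_word_cases)
      \<comment> \<open>\<open>p'\<close> is the other letter of the braid. The longest element of
        its dihedral group may end in \<open>t\<close> or in \<open>p'\<close>, so both are descents
        of \<open>w t\<close>.\<close>
      define p' where "p' = (if t = p then q else p)"
      have tpq: "t = p \<or> t = q" using tc pq(5) set_alternating[of "m p q" p q] by auto
      have p': "p' \<in> S" "p' \<noteq> t" "m t p' \<ge> 3" "m t p' = m p q"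
        using tpq pq m_sym[of p q] by (auto simp: p'_def)
      have r': "reduced (xs @ rev (alternating (m t p') t p'))" "wp (xs @ rev (alternating (m t p') t p')) = w \<otimes> t"
        using tpq braid_descents[of p q xs] r pq m_sym[of p q] by (auto simp: p'_def)
      have r'': "reduced (xs @ rev (alternating (m t p') p' t))" "wp (xs @ rev (alternating (m t p') p' t)) = w \<otimes> t"
        using braid_descents[of t p' xs] r' p' S by auto
      obtain k where k: "m t p' = Suc (Suc (Suc k))" using that[of "m t p' - 3"] p'(3) by simp
      let ?v = "xs @ rev (alternating (Suc k) t p')"
      have "reduced ((?v @ [p']) @ [t])" "wp ((?v @ [p']) @ [t]) = w \<otimes> t"
        using r' k by auto
      note e = this
      have v: "reduced (?v @ [p'])" "wp (?v @ [p']) = w"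
        using reduced_append[OF e(1)] descent_snoc[OF e(1)] unfolding e(2) wt(2) by simp_all
      then have p'w: "p' \<in> R w" "w \<otimes> p' = wp ?v" using descent_snoc[of ?v p'] by auto
      \<comment> \<open>\<open>s\<close> is no descent of \<open>w t\<close>, hence differs from
        \<open>p'\<close>. Both are descents of the thin \<open>w\<close>, so they commute and
        \<open>s\<close> survives in \<open>w p'\<close>; as the braid has length at least 3,
        \<open>t\<close> is a descent of \<open>w p'\<close> too. Thus \<open>s\<close> and
        \<open>t\<close> would commute.\<close>
      have "p' \<in> R (w \<otimes> t)" using r'' k descent_snoc[of "xs @ rev (alternating (Suc (Suc k)) t p')" p'] by auto
      then have "p' \<noteq> s" using S by auto
      then have "s \<in> R (w \<otimes> p')"
        using commuting_if_thin[OF g, of s p'] p'w S commuting_descent[of s w p'] by auto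
      moreover have "t \<in> R (w \<otimes> p')"
        using p'w(2) v(1) reduced_append[of ?v "[p']"] descent_snoc[of "xs @ rev (alternating k p' t)" t] by auto
      ultimately show False
        using commuting_if_thin[of "w \<otimes> p'" s t] thin_descent[OF g p'w(1)] S p' by auto
    next
      assume "commuting_triple c"
      then obtain p q r where pqr: "p \<in> S" "q \<in> S" "r \<in> S" "m p q = 2" "m p r = 2" "m q r = 2" "c = [p, q, r]"
        by (auto simp: commuting_triple_def)
      \<comment> \<open>The triple is rearranged so that the new letter \<open>t\<close> comes last;
        then \<open>w\<close> ends in the other two.\<close>
      have "\<exists>p' q'. p' \<in> S \<and> q' \<in> S \<and> m p' q' = 2 \<and> m p' t = 2 \<and> m q' t = 2 \<and> wp c = wp [p', q', t]"
      proof -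
        consider "t = r" | "t = q" | "t = p" using tc pqr by auto
        then show ?thesis
        proof cases
          case 1 then show ?thesis using pqr by auto
        next
          case 2
          have "wp [p, q, r] = wp [p, r, q]" using pqr m_2_commute[of q r] by simp
          then show ?thesis using 2 pqr m_sym[of r q] by (intro exI[of _ p] exI[of _ r]) simp
        next
          case 3
          have "wp [p, q, r] = p \<otimes> (q \<otimes> r)" using pqr by simp
          also have "\<dots> = q \<otimes> (p \<otimes> r)" using pqr m_2_commute[of p q] by (simp add: m_assoc[symmetric])
          also have "\<dots> = wp [q, r, p]" using pqr m_2_commute[of p r] by simp
          finally show ?thesis using 3 pqr m_sym[of p q] m_sym[of p r] by (intro exI[of _ q] exI[of _ r]) simp
        qed
      qed
      then obtain p' q' where p': "p' \<in> S" "q' \<in> S" "m p' q' = 2" "m p' t = 2" "m q' t = 2" "wp c = wp [p', q', t]"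
        by blast
      have "reduced (((xs @ [p']) @ [q']) @ [t])" "wp (((xs @ [p']) @ [q']) @ [t]) = w \<otimes> t"
        using r p' xc pqr S by (auto simp: reduced_def)
      note e = this
      have v: "reduced ((xs @ [p']) @ [q'])" "wp ((xs @ [p']) @ [q']) = w"
        using reduced_append[OF e(1)] descent_snoc[OF e(1)] unfolding e(2) wt(2) by simp_all
      have v': "q' \<in> R w" "w \<otimes> q' = wp (xs @ [p'])" using descent_snoc[OF v(1)] v(2) by auto
      have v'': "p' \<in> R (w \<otimes> q')" "w \<otimes> q' \<otimes> p' = wp xs"
        using descent_snoc[of xs p'] reduced_append[OF v(1)] unfolding v'(2) by simp_all
      \<comment> \<open>\<open>s\<close> does not commute with \<open>t\<close>, but
        \<open>p'\<close> and \<open>q'\<close> do. Peeling off \<open>q'\<close> and then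
        \<open>p'\<close> keeps \<open>s\<close> as a descent, so \<open>s\<close> can be pulled out
        of \<open>xs\<close>, and \<open>w\<close> ends in the commuting triple
        \<open>s p' q'\<close>.\<close>
      have ne: "s \<noteq> p'" "s \<noteq> q'" using p' S by auto
      have sq: "m s q' = 2" using commuting_if_thin[OF g, of s q'] v' S ne by auto
      then have 1: "s \<in> R (w \<otimes> q')" using commuting_descent[of s w q'] v' S ne by auto
      have g2: "thin (w \<otimes> q')" using thin_descent[OF g v'(1)] S by auto
      have sp: "m s p' = 2" using commuting_if_thin[OF g2, of s p'] v'' 1 S p' ne by auto
      then have "s \<in> R (wp xs)" using commuting_descent[of s "w \<otimes> q'" p'] v'' 1 S p' ne by auto
      then obtain us where us: "reduced us" "wp xs \<otimes> s = wp us"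
        using reduced_deletion[of xs s] reduced_append[of xs "[p'] @ [q']"] v(1) by auto
      have usS: "set us \<subseteq> S" using reduced_S us by auto
      have "wp us \<otimes> s = wp xs" using us(2) xc S by (metis S_cancel wp_closed)
      then have "wp (us @ [s]) = wp xs" using usS S by simp
      then have e: "wp (us @ [s, p', q'] @ []) = w"
        using v(2) usS xc p' S by (simp add: m_assoc[symmetric])
      have "len (wp xs) = Suc (len (wp us))"
        using len_mult_gen(1)[of "wp xs" s] \<open>s \<in> R (wp xs)\<close> wp_closed[OF xc(1)] S unfolding us(2) by blast
      moreover have "len (wp us) = length us" "len (wp xs) = length xs" "len w = length xs + 2"
        using us(1) v reduced_append[of xs "[p'] @ [q']"] by (auto simp: reduced_def)
      ultimately have "len w = length (us @ [s, p', q'] @ [])" by simp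
      moreover have "set (us @ [s, p', q'] @ []) \<subseteq> S" using usS p' S by simp
      ultimately have "reduced (us @ [s, p', q'] @ [])" unfolding reduced_def e by blast
      then show False using thinD[OF g _ e] p' S sp sq unfolding commuting_triple_def by blast
    qed
  qed
qed

text \<open>A descent of \<open>w t\<close> that commutes with \<open>t\<close> can be peeled off
  before the star operation; this is what drives the induction in \<open>star_thin\<close>.\<close>

lemma star_descent:
  assumes st: "star w s t" and g: "thin w" and r: "r \<in> R (w \<otimes> t)" "m r t = 2"
  shows "star (w \<otimes> r) s t" "r \<in> R w" "w \<otimes> t \<otimes> r = w \<otimes> r \<otimes> t"
proof -
  have S: "s \<in> S" "t \<in> S" "w \<in> carrier W" "s \<noteq> t" "m s t \<noteq> 2" "s \<in> R w" "t \<notin> R w" "s \<notin> R (w \<otimes> t)" "r \<in> S"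
    using st R_sub r by (auto simp: star_def)
  have wt: "t \<in> R (w \<otimes> t)" "w \<otimes> t \<otimes> t = w" using descent_mult S S_cancel by auto
  have rt: "r \<noteq> t" "r \<noteq> s" using r S m_self[of t] by auto
  show rw: "r \<in> R w" using commuting_descent[of r "w \<otimes> t" t] wt r rt S by auto
  show c: "w \<otimes> t \<otimes> r = w \<otimes> r \<otimes> t" using m_2_commute[of r t] r S by (simp add: m_assoc)
  have "s \<in> R (w \<otimes> r)" using commuting_if_thin[OF g, of s r] commuting_descent[of s w r] rw rt S by auto
  moreover have "t \<notin> R (w \<otimes> r)"
  proof -
    have "len (w \<otimes> t \<otimes> r) < len (w \<otimes> t)" using r by (simp add: right_descent_def)
    moreover have "len (w \<otimes> t) = Suc (len w)" "len w = Suc (len (w \<otimes> r))"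
      "len (w \<otimes> t) = Suc (len (w \<otimes> t \<otimes> r))"
      using len_mult_gen(2)[of w t] len_mult_gen(1)[of w r] len_mult_gen(1)[of "w \<otimes> t" r] S rw r by simp_all
    ultimately show ?thesis unfolding right_descent_def c by simp
  qed
  moreover have "s \<notin> R (w \<otimes> r \<otimes> t)"
  proof
    assume s: "s \<in> R (w \<otimes> r \<otimes> t)"
    have sr: "m s r = 2" using commuting_if_thin[OF g, of s r] rw rt S by auto
    have "w \<otimes> t \<otimes> r \<otimes> s \<otimes> r = w \<otimes> t \<otimes> s"
    proof -
      have "w \<otimes> t \<otimes> r \<otimes> s \<otimes> r = w \<otimes> t \<otimes> (r \<otimes> s) \<otimes> r" using S by (simp add: m_assoc)
      also have "r \<otimes> s = s \<otimes> r" using m_2_commute[of s r] sr S by simp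
      also have "w \<otimes> t \<otimes> (s \<otimes> r) \<otimes> r = w \<otimes> t \<otimes> s" using S by (simp add: m_assoc S_sq)
      finally show ?thesis .
    qed
    then have "len (w \<otimes> t \<otimes> s) \<le> len (w \<otimes> t \<otimes> r \<otimes> s) + 1"
      using len_mult_le[of "w \<otimes> t \<otimes> r \<otimes> s" r] S len_gen by auto
    moreover have "len (w \<otimes> t \<otimes> r) = Suc (len (w \<otimes> t \<otimes> r \<otimes> s))"
      using len_mult_gen(1)[of "w \<otimes> t \<otimes> r" s] s S by (simp add: c)
    moreover have "len (w \<otimes> t) = Suc (len (w \<otimes> t \<otimes> r))"
      using len_mult_gen(1)[of "w \<otimes> t" r] r S by simp
    ultimately have "s \<in> R (w \<otimes> t)" using S by (simp add: right_descent_def)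
    then show False using S by simp
  qed
  ultimately show "star (w \<otimes> r) s t" using S by (simp add: star_def)
qed

lemma star_thin:
  assumes "star w s t" "thin w" shows "thin (w \<otimes> t)"
proof -
  have False if "star w s t" "thin w" "reduced (xs @ c @ ys)" "wp (xs @ c @ ys) = w \<otimes> t"
    "braid_word c \<or> commuting_triple c" for w xs c ys
    using that
  proof (induction ys arbitrary: w rule: rev_induct)
    case Nil
    then show ?case using star_thin_end[of w s t xs c] by simp
  next
    case (snoc r ys)
    have S: "t \<in> S" "w \<in> carrier W" "t \<notin> R w" using snoc.prems R_sub by (auto simp: star_def)
    have wt: "t \<in> R (w \<otimes> t)" "w \<otimes> t \<otimes> t = w" using descent_mult S S_cancel by auto
    have r: "r \<in> R (w \<otimes> t)" "w \<otimes> t \<otimes> r = wp (xs @ c @ ys)" and rS: "r \<in> S" and red: "reduced (xs @ c @ ys)"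
      using descent_snoc[of "xs @ c @ ys" r] snoc.prems reduced_append[of "xs @ c @ ys" "[r]"]
        reduced_S[OF snoc.prems(3)] by auto
    show False
    proof (cases "r = t")
      case True
      then show False using thinD[OF snoc.prems(2) red] r wt snoc.prems(5) by simp
    next
      case False
      show False
      proof (cases "m r t = 2")
        case True
        note d = star_descent[OF snoc.prems(1,2) r(1) True]
        show False using snoc.IH[OF d(1)] thin_descent[OF snoc.prems(2) d(2)] S red r(2) d(3) snoc.prems(5) by simp
      next
        \<comment> \<open>Two non-commuting descents \<open>r\<close> and \<open>t\<close> put a
          long braid at the very end of another reduced word, so \<open>star_thin_end\<close>
          applies there.\<close>
        case m: False
        have m3: "3 \<le> m r t" using m descents_m_ne_0[of r "w \<otimes> t" t] m_ne_1[of r t] r wt False S rS by force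
        obtain us where "reduced (us @ rev (alternating (m r t) r t))" "w \<otimes> t = wp (us @ rev (alternating (m r t) r t))"
          using dihedral_factor[of r "w \<otimes> t" t "m r t"] r wt False S rS by auto
        then show False
          using star_thin_end[OF snoc.prems(1,2), of us] braid_word_rev_alternating[of r t] False m3 S rS by auto
      qed
    qed
  qed
  then show ?thesis using assms unfolding thin_def by blast
qed

text \<open>A left descent \<open>l\<close> can newly appear in \<open>w t\<close> only if
  \<open>l w = w t\<close>. Then multiplying by \<open>s\<close> would shorten \<open>l w\<close> as
  it shortens \<open>w\<close>, against \<open>s\<close> not being a descent of
  \<open>w t\<close>.\<close>

lemma star_left_descents:
  assumes "star w s t" shows "R (inv (w \<otimes> t)) = R (inv w)"
proof -
  have S: "s \<in> S" "t \<in> S" "w \<in> carrier W" "s \<in> R w" "t \<notin> R w" "s \<notin> R (w \<otimes> t)"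
    using assms R_sub by (auto simp: star_def)
  have L: "l \<in> R (inv x) \<longleftrightarrow> l \<in> S \<and> len (l \<otimes> x) < len x" if "x \<in> carrier W" for l x
  proof (cases "l \<in> S")
    case True
    then have "len (inv x \<otimes> l) = len (l \<otimes> x)"
      using len_inv[of "l \<otimes> x"] that by (simp add: inv_mult_group S_inv)
    then show ?thesis using that by (auto simp: right_descent_def len_inv)
  qed (auto simp: right_descent_def)
  have up: "len (w \<otimes> t) = Suc (len w)" using len_mult_gen S by auto
  have "l \<in> R (inv (w \<otimes> t)) \<longleftrightarrow> l \<in> R (inv w)" for l
  proof (cases "l \<in> S")
    case l: True
    show ?thesis
    proof
      assume "l \<in> R (inv w)"
      then have "len (l \<otimes> w) < len w" using L S by auto
      moreover have "len (l \<otimes> (w \<otimes> t)) \<le> len (l \<otimes> w) + 1"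
        using len_mult_le[of "l \<otimes> w" t] len_gen S l by (simp add: m_assoc)
      ultimately show "l \<in> R (inv (w \<otimes> t))" using L[of "w \<otimes> t" l] S l up by auto
    next
      assume "l \<in> R (inv (w \<otimes> t))"
      then have 1: "len (l \<otimes> w \<otimes> t) \<le> len w" using L[of "w \<otimes> t" l] S l up by (simp add: m_assoc)
      show "l \<in> R (inv w)"
      proof (rule ccontr)
        assume "l \<notin> R (inv w)"
        then have "l \<notin> R (inv w)" "inv w \<in> carrier W" using S by auto
        then have "len (inv w \<otimes> l) = Suc (len (inv w))" using len_mult_gen(2) l by blast
        then have lw: "len (l \<otimes> w) = Suc (len w)"
          using len_inv[of "l \<otimes> w"] len_inv[of w] S l by (simp add: inv_mult_group S_inv)
        then have t: "t \<in> R (l \<otimes> w)" using 1 S by (simp add: right_descent_def)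
        obtain ws where ws: "reduced ws" "wp ws = w" using reduced_word_exists S by blast
        have wsS: "set ws \<subseteq> S" using reduced_S ws by auto
        have "reduced (l # ws)" using ws lw l by (auto simp: reduced_def)
        then obtain xs a ys where d: "l # ws = xs @ a # ys" "l \<otimes> w \<otimes> t = wp (xs @ ys)"
          using reduced_deletion[of "l # ws" t] t ws(2) by auto
        show False
        proof (cases xs)
          \<comment> \<open>Exchange deletes the leading \<open>l\<close>, which gives
            \<open>l w = w t\<close>. In the other case a deletion within \<open>ws\<close> would
            make \<open>w t\<close> too short.\<close>
          case Nil
          then have "l \<otimes> w \<otimes> t = w" using d ws by simp
          then have e: "l \<otimes> w = w \<otimes> t" using S l by (metis S_cancel S_carrier m_closed)
          have "len (l \<otimes> w \<otimes> s) \<le> 1 + len (w \<otimes> s)"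
            using len_mult_le[of l "w \<otimes> s"] len_gen S l by (simp add: m_assoc)
          moreover have "len (w \<otimes> s) < len w" using S by (simp add: right_descent_def)
          ultimately have "s \<in> R (l \<otimes> w)" using lw S by (simp add: right_descent_def)
          then show False using e S by simp
        next
          case (Cons x xs')
          then have x: "x = l" "ws = xs' @ a # ys" using d by auto
          have xS: "set (xs' @ ys) \<subseteq> S" using wsS x by auto
          have "l \<otimes> (w \<otimes> t) = l \<otimes> wp (xs' @ ys)" using d Cons x S l by (simp add: m_assoc)
          then have "w \<otimes> t = wp (xs' @ ys)" using S l xS by (simp del: wp_append)
          then have "len (w \<otimes> t) \<le> length (xs' @ ys)" using len_le[OF xS] by simp
          then show False using up ws x by (auto simp: reduced_def)
        qed
      qed
    qed
  qed (auto simp: right_descent_def)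
  then show ?thesis by blast
qed

text \<open>Two descents would give a dihedral suffix of full length \<open>m\<close>. Cancelling
  the \<open>k < m\<close> known letters leaves at least one of \<open>s\<close>, \<open>t\<close>
  at the end of \<open>u\<close>.\<close>

lemma not_both_descents:
  assumes st: "s \<in> S" "t \<in> S" "s \<noteq> t" and u: "u \<in> carrier W" "s \<notin> R u" "t \<notin> R u"
    and k: "m s t = 0 \<or> k < m s t"
  shows "\<not> (s \<in> R (u \<otimes> wp (rev (alternating k s t))) \<and> t \<in> R (u \<otimes> wp (rev (alternating k s t))))"
proof
  let ?A = "rev (alternating k s t)"
  assume a: "s \<in> R (u \<otimes> wp ?A) \<and> t \<in> R (u \<otimes> wp ?A)"
  have A: "set ?A \<subseteq> S" using alternating_S st by simp
  have m0: "m s t \<noteq> 0" using descents_m_ne_0[of s "u \<otimes> wp ?A" t] a st u A by simp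
  then obtain us where us: "reduced (us @ rev (alternating (m s t) s t))"
      "u \<otimes> wp ?A = wp (us @ rev (alternating (m s t) s t))"
    using dihedral_factor[of s "u \<otimes> wp ?A" t "m s t"] a st u A by auto
  obtain l where l: "m s t = k + Suc l" using k m0 by (metis less_natE add_Suc_right)
  define B where "B = (if even k then alternating (Suc l) s t else alternating (Suc l) t s)"
  have "rev (alternating (m s t) s t) = rev B @ ?A"
    unfolding l B_def by (subst alternating_add) (simp only: rev_append)
  then have 1: "reduced (us @ rev B)" "u \<otimes> wp ?A = wp (us @ rev B) \<otimes> wp ?A"
    using us reduced_append[of "us @ rev B" ?A] A reduced_S[OF us(1)] by (auto simp: m_assoc)
  then have "u = wp (us @ rev B)" using u A reduced_S[OF 1(1)] by (simp del: wp_append)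
  moreover obtain b B' where "B = b # B'" "b = s \<or> b = t" unfolding B_def by (cases "even k") auto
  ultimately have "b \<in> R u" using descent_snoc[of "us @ rev B'" b] 1(1) by simp
  then show False using u \<open>b = s \<or> b = t\<close> by auto
qed

lemma right_upper_star_star:
  assumes "right_upper_star W S w w'" shows "\<exists>s t. star w s t \<and> w' = w \<otimes> t"
proof -
  obtain s t u i where st: "s \<in> S" "t \<in> S" "s \<noteq> t" and m: "m s t = 0 \<or> 3 \<le> m s t"
    and i: "1 \<le> i" "m s t = 0 \<or> i \<le> m s t - 2"
    and d: "right_coset_decomp W S {s, t} w u (wp (alternating i s t))"
    and w': "w' = u \<otimes> wp (alternating (i + 1) s t)"
    using assms unfolding right_upper_star_def by auto
  \<comment> \<open>\<open>a\<close> is the last letter of the alternating word of length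
    \<open>i\<close>, and \<open>b\<close> the letter that the star operation appends.\<close>
  define a where "a = (if odd i then s else t)"
  define b where "b = (if odd i then t else s)"
  have ab: "a \<in> S" "b \<in> S" "a \<noteq> b" "m a b = m s t" "{a, b} = {s, t}"
    using st m_sym[of s t] by (auto simp: a_def b_def)
  have alt: "alternating i s t = rev (alternating i a b)" "alternating (i + 1) s t = rev (alternating (i + 1) b a)"
    by (auto simp: a_def b_def rev_alternating simp del: alternating.simps)
  have mab: "m b a = m s t" using m_sym[of b a] ab by simp
  have u: "u \<in> carrier W" "s \<notin> R u" "t \<notin> R u" and w: "w = u \<otimes> wp (rev (alternating i a b))"
    and lw: "len w = len u + len (wp (rev (alternating i a b)))"
    using d alt by (auto simp: right_coset_decomp_def)
  have uab: "a \<notin> R u" "b \<notin> R u" using u ab by auto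
  have S: "set (alternating k x y) \<subseteq> S" if "x \<in> S" "y \<in> S" for k x y using alternating_S that by auto
  have wc: "w \<in> carrier W" using w u S ab by simp
  have red: "len w = len u + i" using alternating_reduced[of a b i] lw i ab by (fastforce simp: reduced_def)
  have aw: "a \<in> R w"
  proof -
    obtain j where j: "i = Suc j" using i by (cases i) auto
    have "w \<otimes> a = u \<otimes> wp (rev (alternating j b a)) \<otimes> a \<otimes> a"
      using w j u S ab by (simp add: m_assoc)
    also have "\<dots> = u \<otimes> wp (rev (alternating j b a))" using u S ab by (simp add: S_cancel)
    finally have "len (w \<otimes> a) \<le> len u + j"
      using len_mult_le[of u "wp (rev (alternating j b a))"] len_le[of "rev (alternating j b a)"] u S ab by simp
    then show ?thesis using red j ab by (simp add: right_descent_def)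
  qed
  have im: "m s t = 0 \<or> i < m s t" "m s t = 0 \<or> i + 1 < m s t" using i m by linarith+
  have bw: "b \<notin> R w" using not_both_descents[of a b u i] ab uab u(1) im aw w by auto
  have w'b: "w' = w \<otimes> b" unfolding w w' alt using u S ab by (simp add: m_assoc)
  have "b \<in> R (w \<otimes> b)" using descent_mult wc ab bw by simp
  moreover have "\<not> (b \<in> R w' \<and> a \<in> R w')"
    unfolding w' alt using not_both_descents[of b a u "i + 1"] ab uab u(1) im mab by auto
  ultimately have "a \<notin> R (w \<otimes> b)" using w'b by auto
  moreover have "m a b \<noteq> 2" using m ab by auto
  ultimately show ?thesis using wc ab aw bw w'b unfolding star_def by blast
qed

lemma right_upper_closure_invariants:
  assumes "w \<in> right_upper_closure W S x" "thin x" "x \<in> carrier W"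
  shows "w \<in> carrier W \<and> thin w \<and> R (inv w) = R (inv x)"
proof -
  have "(right_upper_star W S)\<^sup>*\<^sup>* x w" using assms(1) by (simp add: right_upper_closure_def)
  then show ?thesis
  proof (induction rule: rtranclp_induct)
    case base
    then show ?case using assms by simp
  next
    case (step y z)
    then obtain s t where "star y s t" "z = y \<otimes> t" using right_upper_star_star by blast
    then show ?case using step star_thin star_left_descents by (auto simp: star_def)
  qed
qed

text \<open>Letters peeled off the right are descents too, so by thinness they commute with
  \<open>s\<close> until \<open>s\<close> itself is reached.\<close>

lemma thin_descent_word:
  assumes "reduced ws" "thin (wp ws)" "s \<in> R (wp ws)"
  shows "\<exists>xs ys. ws = xs @ s # ys \<and> (\<forall>y\<in>set ys. m s y = 2)"
  using assms
proof (induction ws rule: rev_induct)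
  case Nil
  then show ?case using no_descent_outside_support[of "[]" s] by simp
next
  case (snoc r ws)
  show ?case
  proof (cases "r = s")
    case False
    have d: "r \<in> R (wp (ws @ [r]))" "wp (ws @ [r]) \<otimes> r = wp ws" using descent_snoc snoc.prems by auto
    have c: "wp (ws @ [r]) \<in> carrier W" using reduced_S snoc.prems wp_closed by blast
    have m: "m s r = 2" using commuting_if_thin[OF snoc.prems(2,3) d(1)] False c by simp
    then have "s \<in> R (wp ws)"
      using commuting_descent[OF snoc.prems(3) d(1)] False c d(2) by simp
    moreover have "thin (wp ws)" using thin_descent[OF snoc.prems(2) d(1) c] d(2) by simp
    ultimately obtain xs ys where "ws = xs @ s # ys" "\<forall>y\<in>set ys. m s y = 2"
      using snoc.IH snoc.prems(1) reduced_append by blast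
    then show ?thesis using m by (intro exI[of _ xs] exI[of _ "ys @ [r]"]) auto
  qed (intro exI[of _ ws] exI[of _ "[]"], simp)
qed

end

section \<open>Words up to commutation\<close>

text \<open>\<open>ok\<close> will be instantiated by label words that are reduced and represent
  thin elements. \<open>square\<close> is all that is kept of reducedness; \<open>braid\<close> and
  \<open>triple\<close> express thinness.\<close>

locale thin_words =
  fixes M :: "'l \<Rightarrow> 'l \<Rightarrow> nat" and ok :: "'l list \<Rightarrow> bool"
  assumes M_self: "M a a = 1"
    and M_sym: "M a b = M b a"
    and factor: "ok (xs @ ys @ zs) \<Longrightarrow> ok ys"
    and swap: "ok (xs @ [a, b] @ ys) \<Longrightarrow> M a b = 2 \<Longrightarrow> ok (xs @ [b, a] @ ys)"
    and square: "\<not> ok [a, a]"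
    and braid: "a \<noteq> b \<Longrightarrow> 3 \<le> M a b \<Longrightarrow> \<not> ok (alternating (M a b) a b)"
    and triple: "M a b = 2 \<Longrightarrow> M a c = 2 \<Longrightarrow> M b c = 2 \<Longrightarrow> \<not> ok [a, b, c]"
begin

definition com :: "'l set \<Rightarrow> 'l set \<Rightarrow> bool" where
  "com A B \<longleftrightarrow> (\<forall>a\<in>A. \<forall>b\<in>B. M a b = 2 \<and> M b a = 2)"

lemma com_empty [simp]: "com {} A" "com A {}"
  by (auto simp: com_def)

lemma com_single [simp]: "com {a} {b} \<longleftrightarrow> M a b = 2"
  using M_sym[of a b] by (simp add: com_def)

text \<open>Only the second word is rewritten, so \<open>ok\<close>, the set of letters and the
  descents are transported by plain rule induction.\<close>

inductive ceq :: "'l list \<Rightarrow> 'l list \<Rightarrow> bool" where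
  ceq_refl: "ceq xs xs"
| ceq_swap: "ceq zs (xs @ [a, b] @ ys) \<Longrightarrow> M a b = 2 \<Longrightarrow> ceq zs (xs @ [b, a] @ ys)"

lemma ceq_trans: "ceq ys zs \<Longrightarrow> ceq xs ys \<Longrightarrow> ceq xs zs"
  by (induction rule: ceq.induct) (assumption, blast intro: ceq_swap)

lemma ceq_context: "ceq xs ys \<Longrightarrow> ceq (us @ xs @ vs) (us @ ys @ vs)"
proof (induction rule: ceq.induct)
  case (ceq_swap zs xs a b ys)
  then show ?case using ceq.ceq_swap[of "us @ zs @ vs" "us @ xs" a b "ys @ vs"] by simp
qed (rule ceq_refl)

lemma ceq_ok: "ceq xs ys \<Longrightarrow> ok xs \<Longrightarrow> ok ys"
  by (induction rule: ceq.induct) (assumption, blast intro: swap)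

lemma ceq_set: "ceq xs ys \<Longrightarrow> set xs = set ys"
  by (induction rule: ceq.induct) auto

lemma ceq_move_one: "com {a} (set ys) \<Longrightarrow> ceq (xs @ [a] @ ys @ zs) (xs @ ys @ [a] @ zs)"
proof (induction ys arbitrary: xs)
  case (Cons y ys)
  then have "ceq (xs @ [a] @ (y # ys) @ zs) (xs @ [y, a] @ ys @ zs)"
    using ceq_swap[OF ceq_refl, of a y xs "ys @ zs"] by (simp add: com_def)
  moreover have "ceq ((xs @ [y]) @ [a] @ ys @ zs) ((xs @ [y]) @ ys @ [a] @ zs)"
    using Cons by (intro Cons.IH) (simp add: com_def)
  ultimately show ?case using ceq_trans by fastforce
qed (simp add: ceq_refl)

lemma ceq_move: "com (set xs) (set ys) \<Longrightarrow> ceq (us @ xs @ ys @ vs) (us @ ys @ xs @ vs)"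
proof (induction xs arbitrary: vs rule: rev_induct)
  case (snoc x xs)
  have "ceq ((us @ xs) @ [x] @ ys @ vs) ((us @ xs) @ ys @ [x] @ vs)"
    using snoc.prems by (intro ceq_move_one) (simp add: com_def)
  moreover have "ceq (us @ xs @ ys @ ([x] @ vs)) (us @ ys @ xs @ ([x] @ vs))"
    using snoc.prems by (intro snoc.IH) (simp add: com_def)
  ultimately show ?case using ceq_trans by fastforce
qed (simp add: ceq_refl)

lemma ok_move:
  "ok ws \<Longrightarrow> ws = us @ xs @ ys @ vs \<Longrightarrow> com (set xs) (set ys) \<Longrightarrow> us @ ys @ xs @ vs = ws' \<Longrightarrow> ok ws'"
  using ceq_ok ceq_move by blast

lemma ok_factor: "ok ws \<Longrightarrow> ws = us @ xs @ vs \<Longrightarrow> ok xs"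
  using factor by blast

text \<open>\<open>xs\<close> is commuted past \<open>ys\<close> and cut off together with
  \<open>vs\<close>; in \<open>drop_left\<close>, \<open>ys\<close> is commuted to the left and cut
  off with \<open>us\<close>.\<close>

lemma drop_right:
  assumes "ok ws" "ws = us @ xs @ ys @ vs" "com (set xs) (set ys)" "us @ ys = ws'" shows "ok ws'"
  by (rule ok_factor[OF ok_move[OF assms(1-3) refl], of "[]" _ "xs @ vs"]) (use assms(4) in simp)

lemma drop_left:
  assumes "ok ws" "ws = us @ xs @ ys @ vs" "com (set xs) (set ys)" "xs @ vs = ws'" shows "ok ws'"
  by (rule ok_factor[OF ok_move[OF assms(1-3) refl], of "us @ ys" _ "[]"]) (use assms(4) in simp)

lemma no_return:
  assumes "ok ws" "ws = us @ c # xs @ c # vs" "com {c} (set xs)" shows False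
proof -
  have "ok ([c] @ [c] @ vs)" by (rule drop_left[OF assms(1), of us "[c]" xs "c # vs"]) (use assms in auto)
  then show False using ok_factor[of _ "[]" "[c, c]" vs] square by auto
qed

text \<open>Both occurrences of \<open>c\<close> are pulled against \<open>a\<close>, which produces
  the long braid \<open>c a c\<close>.\<close>

lemma no_cac:
  assumes p: "ok ws" "ws = us @ c # xs @ a # ys @ c # vs" and c: "com {c} (set xs)" "com {c} (set ys)" and m: "M c a = 3"
  shows False
proof -
  have "ok (c # a # ys @ [c] @ vs)"
    by (rule drop_left[OF p(1), of us "[c]" xs "a # ys @ c # vs"]) (use p c in auto)
  then have "ok [c, a, c]"
    by (rule drop_right[of _ "[c, a]" ys "[c]" vs]) (use c in \<open>auto simp: com_def\<close>)
  moreover have "c \<noteq> a" using m M_self[of c] by auto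
  ultimately show False using braid[of c a] m by (simp add: numeral_3_eq_3)
qed

text \<open>Since the three blocks commute with each other, all letters but the chosen ones can be
  moved to an end and cut off.\<close>

lemma pick_triple:
  assumes p: "ok ws" "ws = us @ xs @ ys @ zs @ vs"
    and x: "x \<in> set xs" "y \<in> set ys" "z \<in> set zs"
    and c: "com (set xs) (set ys)" "com (set xs) (set zs)" "com (set ys) (set zs)"
  shows False
proof -
  obtain U U' where xs: "xs = U @ x # U'" using x by (auto simp: in_set_conv_decomp)
  obtain V V' where ys: "ys = V @ y # V'" using x by (auto simp: in_set_conv_decomp)
  obtain Z Z' where zs: "zs = Z @ z # Z'" using x by (auto simp: in_set_conv_decomp)
  have "ok (us @ U @ x # ys @ zs)"
    by (rule drop_right[OF p(1), of "us @ U @ [x]" U' "ys @ zs" vs]) (use p c xs in \<open>auto simp: com_def\<close>)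
  then have "ok (x # y # V' @ zs)"
    by (rule drop_left[of _ "us @ U" "[x]" V "y # V' @ zs"]) (use c xs ys in \<open>auto simp: com_def\<close>)
  then have "ok (x # y # zs)"
    by (rule drop_right[of _ "[x, y]" V' zs "[]"]) (use c xs ys in \<open>auto simp: com_def\<close>)
  then have "ok (x # y # z # Z')"
    by (rule drop_left[of _ "[]" "[x, y]" Z "z # Z'"]) (use c xs ys zs in \<open>auto simp: com_def\<close>)
  then have "ok [x, y, z]" by (rule ok_factor[of _ "[]" _ Z']) simp
  then show False using triple[of x y z] c x by (auto simp: com_def)
qed

text \<open>A gap around \<open>c\<close> consists of a piece before it and a piece after it. As its
  letters commute with \<open>c\<close>, the pieces can be merged, and it does not matter on which
  side \<open>b\<close> and \<open>b'\<close> occur.\<close>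

lemma no_triple:
  assumes p: "ok ws" "ws = us @ U @ U' @ c # V @ V' @ vs"
    and b: "b \<in> set U \<union> set V" "b' \<in> set U' \<union> set V'"
    and c: "com (set U \<union> set V) {c}" "com (set U' \<union> set V') {c}" "com (set U \<union> set V) (set U' \<union> set V')"
  shows False
proof -
  have "ok (us @ U @ V @ U' @ c # V' @ vs)"
    by (rule ok_move[OF p(1), of "us @ U" "U' @ [c]" V "V' @ vs"]) (use p c in \<open>auto simp: com_def\<close>)
  then have "ok (us @ (U @ V) @ (U' @ V') @ [c] @ vs)"
    by (rule ok_move[of _ "us @ U @ V @ U'" "[c]" V' vs]) (use c in \<open>auto simp: com_def\<close>)
  then show False
    by (rule pick_triple[of _ us "U @ V" "U' @ V'" "[c]" vs b b' c]) (use b c in \<open>auto simp: com_def\<close>)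
qed

text \<open>The descents of the trace of a word: letters that commute to the front, or for
  \<open>rdesc\<close> to the end. For thin words they turn out to be the descents of the group
  element.\<close>

definition ldesc :: "'l list \<Rightarrow> 'l \<Rightarrow> bool" where
  "ldesc ws a \<longleftrightarrow> (\<exists>xs ys. ws = xs @ a # ys \<and> com {a} (set xs))"

definition rdesc :: "'l list \<Rightarrow> 'l \<Rightarrow> bool" where
  "rdesc ws a \<longleftrightarrow> (\<exists>xs ys. ws = xs @ a # ys \<and> com {a} (set ys))"

lemma ldesc_append: "ldesc (xs @ ys) a \<longleftrightarrow> ldesc xs a \<or> com {a} (set xs) \<and> ldesc ys a"
proof
  assume "ldesc (xs @ ys) a"
  then obtain us vs where d: "xs @ ys = us @ a # vs" "com {a} (set us)" by (auto simp: ldesc_def)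
  from d(1) show "ldesc xs a \<or> com {a} (set xs) \<and> ldesc ys a"
    by (rule append_eq_append_Cons_cases) (use d in \<open>auto simp: ldesc_def com_def\<close>)
next
  assume "ldesc xs a \<or> com {a} (set xs) \<and> ldesc ys a"
  then show "ldesc (xs @ ys) a"
  proof
    assume "com {a} (set xs) \<and> ldesc ys a"
    then obtain us vs where "ys = us @ a # vs" "com {a} (set us)" "com {a} (set xs)" by (auto simp: ldesc_def)
    then show ?thesis unfolding ldesc_def by (intro exI[of _ "xs @ us"] exI[of _ vs]) (auto simp: com_def)
  next
    assume "ldesc xs a"
    then obtain us vs where "xs = us @ a # vs" "com {a} (set us)" by (auto simp: ldesc_def)
    then show ?thesis unfolding ldesc_def by (intro exI[of _ us] exI[of _ "vs @ ys"]) auto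
  qed
qed

lemma rdesc_rev: "rdesc ws a \<longleftrightarrow> ldesc (rev ws) a"
proof
  assume "rdesc ws a"
  then obtain us vs where "ws = us @ a # vs" "com {a} (set vs)" by (auto simp: rdesc_def)
  then show "ldesc (rev ws) a" unfolding ldesc_def by (intro exI[of _ "rev vs"] exI[of _ "rev us"]) auto
next
  assume "ldesc (rev ws) a"
  then obtain us vs where d: "rev ws = us @ a # vs" "com {a} (set us)" by (auto simp: ldesc_def)
  then have "ws = rev vs @ a # rev us" by (metis append.assoc append_Cons append_Nil rev.simps(2) rev_append rev_rev_ident)
  then show "rdesc ws a" using d unfolding rdesc_def by (intro exI[of _ "rev vs"] exI[of _ "rev us"]) auto
qed

lemma ldesc_Cons [simp]: "ldesc (x # xs) a \<longleftrightarrow> x = a \<or> M a x = 2 \<and> ldesc xs a"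
proof -
  have "ldesc [x] a \<longleftrightarrow> x = a" by (auto simp: ldesc_def com_def Cons_eq_append_conv)
  then show ?thesis using ldesc_append[of "[x]" xs a] by simp
qed

lemma ldesc_Nil [simp]: "\<not> ldesc [] a" and rdesc_Nil [simp]: "\<not> rdesc [] a"
  by (auto simp: ldesc_def rdesc_def)

lemma rdesc_append: "rdesc (xs @ ys) a \<longleftrightarrow> rdesc ys a \<or> com {a} (set ys) \<and> rdesc xs a"
  by (auto simp: rdesc_rev ldesc_append)

lemma rdesc_single [simp]: "rdesc [x] a \<longleftrightarrow> x = a"
  by (simp add: rdesc_rev)

lemma rdesc_Cons: "rdesc (x # xs) a \<longleftrightarrow> rdesc xs a \<or> com {a} (set xs) \<and> x = a"
  using rdesc_append[of "[x]" xs a] by simp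

lemma ldesc_set: "ldesc xs a \<Longrightarrow> a \<in> set xs" and rdesc_set: "rdesc xs a \<Longrightarrow> a \<in> set xs"
  by (auto simp: ldesc_def rdesc_def)

lemma ceq_ldesc: "ceq xs ys \<Longrightarrow> ldesc xs a = ldesc ys a"
proof (induction rule: ceq.induct)
  case (ceq_swap zs xs a' b ys)
  then show ?case using M_self[of a] M_sym[of a' b] by (auto simp: ldesc_append)
qed simp

lemma ceq_rdesc: "ceq xs ys \<Longrightarrow> rdesc xs a = rdesc ys a"
proof (induction rule: ceq.induct)
  case (ceq_swap zs xs a' b ys)
  then show ?case using M_self[of a] M_sym[of a' b] by (auto simp: rdesc_append rdesc_Cons com_def)
qed simp

lemma ceq_filter:
  assumes "com {x \<in> set ws. Q x} {x \<in> set ws. \<not> Q x}"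
  shows "ceq ws (filter Q ws @ filter (\<lambda>x. \<not> Q x) ws)"
  using assms
proof (induction ws)
  case (Cons x ws)
  have "ceq ws (filter Q ws @ filter (\<lambda>x. \<not> Q x) ws)"
    using Cons by (auto simp: com_def)
  then have 1: "ceq (x # ws) (x # filter Q ws @ filter (\<lambda>x. \<not> Q x) ws)"
    using ceq_context[of ws _ "[x]" "[]"] by simp
  show ?case
  proof (cases "Q x")
    case False
    have "ceq ([x] @ filter Q ws @ filter (\<lambda>x. \<not> Q x) ws) (filter Q ws @ [x] @ filter (\<lambda>x. \<not> Q x) ws)"
      using ceq_move[of "[x]" "filter Q ws" "[]"] Cons.prems False by (auto simp: com_def)
    then show ?thesis using 1 ceq_trans False by simp
  qed (use 1 in simp)
qed (simp add: ceq_refl)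

text \<open>One cut at the first \<open>c\<close>: the letters before it are sorted into two
  commuting sides. Applying this again to the rest yields the segments.\<close>

lemma segment:
  assumes "set ws \<subseteq> insert c (A \<union> B)" "com A B" "A \<inter> B = {}" "c \<notin> A"
  obtains D E r where "ceq ws (D @ E @ r)" "set D \<subseteq> A" "set E \<subseteq> B" "r = [] \<or> (\<exists>r'. r = c # r' \<and> set r' \<subseteq> set ws)"
proof -
  define x where "x = takeWhile (\<lambda>y. y \<noteq> c) ws"
  define r where "r = dropWhile (\<lambda>y. y \<noteq> c) ws"
  have ws: "ws = x @ r" by (simp add: x_def r_def)
  have x: "set x \<subseteq> A \<union> B" using assms(1) set_takeWhileD[of _ "\<lambda>y. y \<noteq> c" ws] unfolding x_def by auto
  have "ceq x (filter (\<lambda>y. y \<in> A) x @ filter (\<lambda>y. y \<notin> A) x)"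
    using x assms by (intro ceq_filter) (auto simp: com_def)
  from ceq_context[OF this, of "[]" r]
  have "ceq ws (filter (\<lambda>y. y \<in> A) x @ filter (\<lambda>y. y \<notin> A) x @ r)"
    using ws by simp
  moreover have "r = [] \<or> (\<exists>r'. r = c # r' \<and> set r' \<subseteq> set ws)"
  proof (cases r)
    case (Cons y r')
    then have "y = c" using hd_dropWhile[of "\<lambda>y. y \<noteq> c" ws] unfolding r_def by auto
    then show ?thesis using Cons ws by auto
  qed simp
  ultimately show thesis using that x by fastforce
qed

section \<open>Arms with all weights 3, listed outwards\<close>

fun simple_tail :: "'l list \<Rightarrow> bool" where
  "simple_tail [] = True"
| "simple_tail [a] = True"
| "simple_tail (a # b # t) = (M a b = 3 \<and> com {a} (set t) \<and> simple_tail (b # t))"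

lemma once_if_no_return:
  assumes n: "\<And>U. set U \<subseteq> B \<Longrightarrow> \<not> ok (a # U @ [a])"
    and ws: "ok ws" "set ws \<subseteq> insert a B" "a \<in> set ws"
  obtains U V where "ws = U @ a # V" "a \<notin> set U" "a \<notin> set V"
proof -
  obtain U V where d: "ws = U @ a # V" "a \<notin> set U" using split_list_first ws(3) by fastforce
  have "a \<notin> set V"
  proof
    assume "a \<in> set V"
    then obtain L Y where L: "V = L @ a # Y" "a \<notin> set L" using split_list_first by fastforce
    then have "ok (a # L @ [a])" using ok_factor[OF ws(1), of U "a # L @ [a]" Y] d by simp
    moreover have "set L \<subseteq> B" using ws(2) d L by auto
    ultimately show False using n by blast
  qed
  then show thesis using that d by blast
qed

text \<open>Between two \<open>a\<close> the neighbour \<open>b\<close> must occur, and by induction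
  it occurs only once there, which gives \<open>a b a\<close>. So the inner end of an arm of weight
  3 is used at most once.\<close>

lemma tail_no_return: "simple_tail (a # t) \<Longrightarrow> set U \<subseteq> set t \<Longrightarrow> \<not> ok (a # U @ [a])"
proof (induction t arbitrary: a U)
  case Nil
  then show ?case using square by auto
next
  case (Cons b t)
  show ?case
  proof
    assume p: "ok (a # U @ [a])"
    have U: "ok U" using ok_factor[OF p, of "[a]" U "[a]"] by simp
    show False
    proof (cases "b \<in> set U")
      case False
      then show False using no_return[OF p, of "[]" a U "[]"] Cons.prems by (auto simp: com_def)
    next
      case True
      obtain L Y where "U = L @ b # Y" "b \<notin> set L" "b \<notin> set Y"
        by (rule once_if_no_return[of "set t" b U]) (use Cons True U in auto)
      then show False using no_cac[OF p, of "[]" a L b Y "[]"] Cons.prems by (auto simp: com_def)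
    qed
  qed
qed

lemma tail_once:
  assumes "simple_tail (a # t)" "ok E" "set E \<subseteq> set (a # t)" "a \<in> set E"
  obtains U V where "E = U @ a # V" "set U \<subseteq> set t" "set V \<subseteq> set t"
proof -
  obtain U V where "E = U @ a # V" "a \<notin> set U" "a \<notin> set V"
    by (rule once_if_no_return[of "set t" a E]) (use assms tail_no_return in auto)
  then show thesis using that assms(3) by auto
qed

text \<open>The first letter of \<open>E\<close> is a left descent and the last a right descent, so
  both are \<open>a\<close>, but \<open>a\<close> occurs only once.\<close>

lemma tail_single:
  assumes "simple_tail (a # t)" "ok E" "set E \<subseteq> set (a # t)" "E \<noteq> []"
    and "\<And>x. ldesc E x \<Longrightarrow> x = a" "\<And>x. rdesc E x \<Longrightarrow> x = a"
  shows "E = [a]"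
proof -
  obtain x E' where x: "E = x # E'" using assms(4) by (cases E) auto
  then have "x = a" using assms(5)[of x] by simp
  then have "a \<in> set E" using x by simp
  then obtain U V where UV: "E = U @ a # V" "set U \<subseteq> set t" "set V \<subseteq> set t"
    using tail_once assms by metis
  have at: "a \<notin> set t" using assms(1) M_self[of a] by (cases t) (auto simp: com_def)
  have "U = []" using UV x \<open>x = a\<close> at by (cases U) auto
  moreover have "V = []"
  proof (rule ccontr)
    assume "V \<noteq> []"
    then obtain V' y where "V = V' @ [y]" by (meson rev_exhaust)
    then have "rdesc E y" "y \<noteq> a" using UV at by (auto simp: rdesc_append rdesc_Cons com_def)
    then show False using assms(6) by blast
  qed
  ultimately show ?thesis using UV by simp
qed

text \<open>A tail word contains \<open>a\<close> at most once, so enclosing it by \<open>c\<close>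
  gives \<open>c c\<close> or \<open>c a c\<close>.\<close>

lemma tail_not_between:
  assumes t: "simple_tail (a # t)" and c: "com {c} (set t)" "M c a = 3" and E: "set E \<subseteq> set (a # t)"
    and p: "ok ws" "ws = us @ c # E @ c # vs"
  shows False
proof (cases "a \<in> set E")
  case True
  have "ok E" using ok_factor[OF p(1), of "us @ [c]" E "c # vs"] p(2) by simp
  then obtain U V where "E = U @ a # V" "set U \<subseteq> set t" "set V \<subseteq> set t" using tail_once t E True by metis
  then show False using no_cac[OF p(1), of us c U a V vs] p(2) c by (auto simp: com_def)
next
  case False
  then show False using no_return[OF p(1), of us c E vs] p(2) c E by (auto simp: com_def)
qed

text \<open>Without the successor \<open>b\<close> in the gap, only \<open>c\<close> separates the
  two \<open>a\<close>, and \<open>a c a\<close> arises.\<close>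

lemma tail_sandwich:
  assumes t: "simple_tail (a # t)" and c: "com {c} (set t)" "M a c = 3" and G: "com (set G) (set (a # t))"
    and L: "set L \<subseteq> set t" "set Y \<subseteq> set t" and p: "ok ws" "ws = us @ a # L @ c # G @ Y @ a # vs"
  shows "\<exists>b t'. t = b # t' \<and> b \<in> set L \<union> set Y"
proof (rule ccontr)
  assume n: "\<not> ?thesis"
  have "com {a} (set L \<union> set Y)" using n t L by (cases t) (auto simp: com_def)
  then show False using no_cac[OF p(1), of us a L c "G @ Y" vs] p(2) c G by (auto simp: com_def)
qed

text \<open>If \<open>a\<close> occurs in three consecutive segments, then its successor \<open>b\<close> occurs in both gaps, hence
  the successor of \<open>b\<close> occurs between these, parallel to \<open>a\<close> and \<open>e\<close>.\<close>

lemma tail_thrice: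
  assumes t: "simple_tail (a # t)" and c: "com {c} (set t)" "M a c = 3"
    and G: "com (set G \<union> set H) (set (a # t))" "e \<in> set G"
    and E: "set E0 \<subseteq> set (a # t)" "set E1 \<subseteq> set (a # t)" "set E2 \<subseteq> set (a # t)"
      "a \<in> set E0" "a \<in> set E1" "a \<in> set E2"
    and p: "ok ws" "ws = us @ E0 @ c # G @ E1 @ c # H @ E2 @ vs"
  shows False
proof -
  have PE: "ok E0" "ok E1" "ok E2"
    using ok_factor[OF p(1), of us E0 "c # G @ E1 @ c # H @ E2 @ vs"]
      ok_factor[OF p(1), of "us @ E0 @ c # G" E1 "c # H @ E2 @ vs"]
      ok_factor[OF p(1), of "us @ E0 @ c # G @ E1 @ c # H" E2 vs] p(2) by simp_all
  obtain Z0 X0 where 0: "E0 = Z0 @ a # X0" "set X0 \<subseteq> set t" using tail_once[OF t PE(1) E(1,4)] by metis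
  obtain Y0 X1 where 1: "E1 = Y0 @ a # X1" "set Y0 \<subseteq> set t" "set X1 \<subseteq> set t" using tail_once[OF t PE(2) E(2,5)] by metis
  obtain Y1 Z1 where 2: "E2 = Y1 @ a # Z1" "set Y1 \<subseteq> set t" using tail_once[OF t PE(3) E(3,6)] by metis
  have GH: "com (set G) (set (a # t))" "com (set H) (set (a # t))" using G by (auto simp: com_def)
  have "\<exists>b t'. t = b # t' \<and> b \<in> set X0 \<union> set Y0"
    by (rule tail_sandwich[OF t c GH(1) 0(2) 1(2) p(1), of "us @ Z0" "X1 @ c # H @ E2 @ vs"])
      (simp add: p(2) 0(1) 1(1))
  then obtain b t' where b: "t = b # t'" "b \<in> set (X0 @ Y0)" by auto
  have "\<exists>b t'. t = b # t' \<and> b \<in> set X1 \<union> set Y1"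
    by (rule tail_sandwich[OF t c GH(2) 1(3) 2(2) p(1), of "us @ E0 @ c # G @ Y0" "Z1 @ vs"])
      (simp add: p(2) 1(1) 2(1))
  then have b2: "b \<in> set (X1 @ Y1)" using b(1) by auto
  \<comment> \<open>The last \<open>b\<close> before the middle \<open>a\<close> and the first one
    after it are chosen, so that \<open>D\<close> and \<open>C'\<close> use only letters beyond
    \<open>b\<close>.\<close>
  obtain C D where CD: "X0 @ Y0 = C @ b # D" "b \<notin> set D" using split_list_last[OF b(2)] by blast
  obtain C' D' where CD': "X1 @ Y1 = C' @ b # D'" "b \<notin> set C'" using split_list_first[OF b2] by blast
  have D: "set D \<subseteq> set t'" "set C' \<subseteq> set t'" and Cs: "set C \<subseteq> set t"
    using arg_cong[OF CD(1), of set] arg_cong[OF CD'(1), of set] CD(2) CD'(2) 0 1 2 b(1) by auto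
  obtain Q Q' where Q: "G = Q @ e # Q'" using G(2) by (auto simp: in_set_conv_decomp)
  have cX: "com (set X0) (set (c # G))" "com (set (c # H)) (set Y1)"
    using 0(2) 2(2) c G(1) by (auto simp: com_def)
  have "ok (us @ Z0 @ a # c # G @ X0 @ Y0 @ a # X1 @ c # H @ Y1 @ a # Z1 @ vs)"
    by (rule ok_move[OF p(1) _ cX(1), of "us @ Z0 @ [a]" "Y0 @ a # X1 @ c # H @ Y1 @ a # Z1 @ vs"])
      (simp_all add: p(2) 0(1) 1(1) 2(1))
  then have "ok (us @ Z0 @ a # c # G @ (X0 @ Y0) @ a # (X1 @ Y1) @ c # H @ a # Z1 @ vs)"
    by (rule ok_move[OF _ _ cX(2), of _ "us @ Z0 @ a # c # G @ X0 @ Y0 @ a # X1" "a # Z1 @ vs"]) simp_all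
  then have "ok (us @ Z0 @ a # c # Q @ e # Q' @ C @ b # D @ a # C' @ b # D' @ c # H @ a # Z1 @ vs)"
    unfolding CD(1) CD'(1) Q by simp
  \<comment> \<open>\<open>e\<close> lies in another arm and is carried to the right until it stands
    directly behind the middle \<open>a\<close>.\<close>
  then have "ok (us @ Z0 @ a # c # Q @ C @ b # D @ a # e # Q' @ C' @ b # D' @ c # H @ a # Z1 @ vs)"
    by (rule ok_move[of _ "us @ Z0 @ a # c # Q" "e # Q'" "C @ b # D @ [a]" "C' @ b # D' @ c # H @ a # Z1 @ vs"])
      (use G(1) Q b(1) D Cs in \<open>auto simp: com_def\<close>)
  then have "ok (us @ Z0 @ a # c # Q @ C @ b # D @ a # e # C' @ [b])"
    by (rule drop_right[of _ "us @ Z0 @ a # c # Q @ C @ b # D @ a # [e]" Q' "C' @ [b]" "D' @ c # H @ a # Z1 @ vs"])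
      (use G(1) Q b(1) D in \<open>auto simp: com_def\<close>)
  then have q: "ok (b # D @ a # e # C' @ [b])"
    by (rule ok_factor[of _ "us @ Z0 @ a # c # Q @ C" _ "[]"]) simp
  have e: "M e a = 2" "M e b = 2" "com {e} (set t')" and a: "com {a} (set t')" "M a b = 3"
    using G(1) b(1) t Q by (auto simp: com_def)
  have sym: "M b a = 3" "M a e = 2" "M b e = 2" using a e M_sym by metis+
  show False
  \<comment> \<open>Either nothing between the two \<open>b\<close> except \<open>a\<close>
    obstructs them, giving \<open>b a b\<close>, or some \<open>d\<close> beyond \<open>b\<close>
    lies between them and commutes with both \<open>a\<close> and \<open>e\<close>.\<close>
  proof (cases "com {b} (set D \<union> set C')")
    case True
    show False
      by (rule no_cac[OF q, of "[]" b D a "e # C'" "[]"]) (use True e sym in \<open>auto simp: com_def\<close>)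
  next
    case False
    then obtain d where d: "d \<in> set D \<union> set C'" using M_sym[of b] by (auto simp: com_def)
    have "ok (b # D @ C' @ a # e # [b])"
      by (rule ok_move[OF q, of "b # D" "[a, e]" C' "[b]"]) (use D a e in \<open>auto simp: com_def\<close>)
    then show False
      by (rule pick_triple[of _ "[b]" "D @ C'" "[a]" "[e]" "[b]" d a e])
        (use D a e d sym in \<open>auto simp: com_def\<close>)
  qed
qed

section \<open>Descents in segments and words in two letters\<close>

lemma com_mono: "com A B \<Longrightarrow> A' \<subseteq> A \<Longrightarrow> B' \<subseteq> B \<Longrightarrow> com A' B'"
  unfolding com_def by blast

lemma com_sym: "com A B \<Longrightarrow> com B A"
  unfolding com_def by blast

lemma com_not_mem: "com A B \<Longrightarrow> a \<in> A \<Longrightarrow> a \<notin> B"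
  using M_self[of a] by (auto simp: com_def)

lemma ceq_extend: "ceq ws (xs @ r) \<Longrightarrow> ceq r r' \<Longrightarrow> ceq ws (xs @ r')"
  using ceq_trans[of "xs @ r" "xs @ r'" ws] ceq_context[of r r' xs "[]"] by simp

text \<open>A descent that does not commute with \<open>c\<close> cannot have come from behind the
  first \<open>c\<close>.\<close>

lemma ldesc_segment:
  assumes "ldesc ws x" "ceq ws (xs @ r)" "r = [] \<or> (\<exists>r'. r = c # r')" "M x c \<noteq> 2" "x \<noteq> c"
  shows "x \<in> set xs"
  using assms ceq_ldesc[of ws "xs @ r" x] ldesc_set[of xs x] by (auto simp: ldesc_append)

lemma rdesc_segment:
  assumes "rdesc ws x" "ceq ws (us @ c # xs)" "M x c \<noteq> 2" "x \<noteq> c"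
  shows "x \<in> set xs"
  using assms ceq_rdesc[of ws "us @ c # xs" x] rdesc_set[of xs x] rdesc_set[of us x]
  by (auto simp: rdesc_append rdesc_Cons com_def)

lemma ldesc_middle: "ldesc ys x \<Longrightarrow> com {x} (set xs) \<Longrightarrow> ldesc (xs @ ys @ zs) x"
  by (simp add: ldesc_append)

lemma rdesc_middle: "rdesc ys x \<Longrightarrow> com {x} (set zs) \<Longrightarrow> rdesc (xs @ ys @ zs) x"
  by (simp add: rdesc_append)

lemma one_letter: "ok D \<Longrightarrow> set D \<subseteq> {p} \<Longrightarrow> D = [] \<or> D = [p]"
proof -
  assume D: "ok D" "set D \<subseteq> {p}"
  have "\<not> (\<exists>D'. D = p # p # D')" using ok_factor[OF D(1), of "[]" "[p, p]"] square[of p] by auto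
  then show ?thesis using D(2) by (cases D; cases "tl D") auto
qed

lemma dihedral_alternating:
  "ok D \<Longrightarrow> set D \<subseteq> {p, q} \<Longrightarrow> D = alternating (length D) p q \<or> D = alternating (length D) q p"
proof (induction D)
  case (Cons x D)
  have D: "ok D" using ok_factor[OF Cons.prems(1), of "[x]" D "[]"] by simp
  show ?case
  proof (cases D)
    case Nil
    then show ?thesis using Cons.prems by auto
  next
    case (Cons y D')
    have "x \<noteq> y" using ok_factor[OF \<open>ok (x # D)\<close>, of "[]" "[x, y]" D'] square[of x] Cons by auto
    then show ?thesis using Cons.IH[OF D] \<open>set (x # D) \<subseteq> {p, q}\<close> Cons by auto
  qed
qed simp

lemma dihedral_words:
  assumes "ok D" "set D \<subseteq> {p, q}" "p \<noteq> q" "3 \<le> M p q"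
  obtains k where "k < M p q" "D = alternating k p q \<or> D = alternating k q p"
proof -
  have "length D < M p q"
  proof (rule ccontr)
    assume "\<not> length D < M p q"
    then obtain l where l: "length D = M p q + l" using le_Suc_ex by fastforce
    have "D = alternating (M p q + l) p q \<or> D = alternating (M p q + l) q p"
      using dihedral_alternating[OF assms(1,2)] l by simp
    then have "ok (alternating (M p q) p q) \<or> ok (alternating (M p q) q p)"
      unfolding alternating_add using ok_factor[OF assms(1), of "[]"] by auto
    then show False using braid[of p q] braid[of q p] assms M_sym[of p q] by auto
  qed
  then show thesis using that dihedral_alternating[OF assms(1,2)] by blast
qed

text \<open>One list, of the alternating words of length at most four, serves both weights.\<close>

lemma dihedral_words_5:
  assumes "ok D" "set D \<subseteq> {p, q}" "p \<noteq> q" "M p q = 4 \<or> M p q = 5"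
  shows "D \<in> {[], [p], [q], [p, q], [q, p], [p, q, p], [q, p, q], [p, q, p, q], [q, p, q, p]}"
proof -
  obtain k where k: "k < M p q" "D = alternating k p q \<or> D = alternating k q p"
    by (rule dihedral_words[OF assms(1-3)]) (use assms(4) in auto)
  then have "k = 0 \<or> k = 1 \<or> k = 2 \<or> k = 3 \<or> k = 4" using assms(4) by linarith
  then show ?thesis using k(2) by (elim disjE) (simp_all add: numeral_eq_Suc)
qed

lemma no_braid_4: "M p q = 4 \<Longrightarrow> p \<noteq> q \<Longrightarrow> ok ws \<Longrightarrow> ws = us @ p # q # p # q # vs \<Longrightarrow> False"
  using braid[of p q] ok_factor[of ws us "[p, q, p, q]" vs] by (simp add: numeral_eq_Suc)

lemma no_braid_5: "M p q = 5 \<Longrightarrow> p \<noteq> q \<Longrightarrow> ok ws \<Longrightarrow> ws = us @ p # q # p # q # p # vs \<Longrightarrow> False"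
  using braid[of p q] ok_factor[of ws us "[p, q, p, q, p]" vs] by (simp add: numeral_eq_Suc)

text \<open>To avoid \<open>q c q\<close>, the gap between the two nearest \<open>q\<close> must
  contain another letter, from \<open>A\<close>; likewise the gap of \<open>a\<close> contains one
  from \<open>B\<close>. These two letters and \<open>c\<close> commute pairwise.\<close>

lemma no_double_overlap:
  assumes p: "ok ws" "ws = us @ D0 @ E0 @ F @ c # D1 @ E1 @ vs"
    and q: "q \<in> set D0" "q \<in> set D1" and a: "a \<in> set E0" "a \<in> set E1"
    and D: "set D0 \<subseteq> insert q A" "set D1 \<subseteq> insert q A" and E: "set E0 \<subseteq> insert a B" "set E1 \<subseteq> insert a B"
    and com: "com A {c}" "com B {c}" "com (insert q A) (insert a B)" "com (set F) (insert q A \<union> insert a B)"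
    and m: "M q c = 3" "M a c = 3"
  shows False
proof -
  obtain Z L where 1: "D0 = Z @ q # L" "q \<notin> set L" using split_list_last[OF q(1)] by blast
  obtain Y Y' where 2: "D1 = Y @ q # Y'" "q \<notin> set Y" using split_list_first[OF q(2)] by blast
  obtain N K where 3: "E0 = N @ a # K" "a \<notin> set K" using split_list_last[OF a(1)] by blast
  obtain V V' where 4: "E1 = V @ a # V'" "a \<notin> set V" using split_list_first[OF a(2)] by blast
  have sub: "set L \<subseteq> A" "set Y \<subseteq> A" "set K \<subseteq> B" "set V \<subseteq> B" using D E 1 2 3 4 by auto
  have sub': "set Z \<subseteq> insert q A" "set Y' \<subseteq> insert q A" "set N \<subseteq> insert a B" "set V' \<subseteq> insert a B"
    using D E 1 2 3 4 by auto
  have "L @ Y \<noteq> []"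
  proof
    assume "L @ Y = []"
    then show False
      by (intro no_cac[OF p(1), of "us @ Z" q "E0 @ F" c "[]" "Y' @ E1 @ vs"])
        (use p(2) 1 2 m com E in \<open>auto simp: com_def\<close>)
  qed
  moreover have "K @ V \<noteq> []"
  proof
    assume "K @ V = []"
    then show False
      by (intro no_cac[OF p(1), of "us @ D0 @ N" a F c D1 "V' @ vs"])
        (use p(2) 3 4 m com D in \<open>auto simp: com_def\<close>)
  qed
  ultimately have "set (L @ Y) \<noteq> {}" "set (K @ V) \<noteq> {}" by (simp_all only: set_empty not_False_eq_True)
  then obtain b b' where "b \<in> set (L @ Y)" "b' \<in> set (K @ V)" using ex_in_conv by metis
  then have b: "b \<in> set L \<union> set Y" "b' \<in> set K \<union> set V" by simp_all
  have sub'': "set (N @ [a]) \<subseteq> insert a B" "set (L @ K) \<subseteq> insert q A \<union> insert a B" "set (q # Y') \<subseteq> insert q A"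
    using sub sub' by auto
  have c1: "com (set L) (set (N @ [a]))" by (rule com_mono[OF com(3)]) (use sub sub'' in auto)
  have c2: "com (set (L @ K)) (set F)" by (rule com_mono[OF com_sym[OF com(4)]]) (use sub'' in auto)
  have c3: "com (set (q # Y')) (set V)" by (rule com_mono[OF com(3)]) (use sub sub'' in auto)
  have "ok (us @ Z @ q # N @ a # L @ K @ F @ c # Y @ q # Y' @ V @ a # V' @ vs)"
    by (rule ok_move[OF p(1) _ c1, of "us @ Z @ [q]" "K @ F @ c # Y @ q # Y' @ V @ a # V' @ vs"])
      (simp_all add: p(2) 1 2 3 4)
  then have "ok (us @ Z @ q # N @ a # F @ L @ K @ c # Y @ q # Y' @ V @ a # V' @ vs)"
    by (rule ok_move[OF _ _ c2, of _ "us @ Z @ q # N @ [a]" "c # Y @ q # Y' @ V @ a # V' @ vs"]) simp_all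
  then have ok': "ok (us @ Z @ q # N @ a # F @ L @ K @ c # Y @ V @ q # Y' @ a # V' @ vs)"
    by (rule ok_move[OF _ _ c3, of _ "us @ Z @ q # N @ a # F @ L @ K @ c # Y" "a # V' @ vs"]) simp_all
  have c4: "com (set L \<union> set Y) {c}" "com (set K \<union> set V) {c}" using com(1,2) sub by (auto simp: com_def)
  have c5: "com (set L \<union> set Y) (set K \<union> set V)" by (rule com_mono[OF com(3)]) (use sub in auto)
  show False
    by (rule no_triple[OF ok' _ b c4 c5, of "us @ Z @ q # N @ a # F" "q # Y' @ a # V' @ vs"]) simp
qed

text \<open>The diagram is the path \<open>p\<close>, \<open>c\<close>, \<open>a\<close>,
  \<open>t\<close>, with \<open>p\<close> the whole left arm. \<open>short\<close> collects the
  cases needed: either the left edge has weight 3, or the right arm is the single vertex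
  \<open>a\<close>. A second segment is shown to be neither last nor inner.\<close>

lemma short_left_arm:
  assumes ws: "ok ws" "set ws \<subseteq> {p, c} \<union> set (a # t)"
    and t: "simple_tail (a # t)" and com: "com {c} (set t)" "com {p} (set (a # t))" and m: "M c a = 3" "3 \<le> M p c" "M p c \<le> 5"
    and short: "M p c = 3 \<or> t = []"
    and desc: "\<And>x. ldesc ws x \<longleftrightarrow> x \<in> {p, a}" "\<And>x. rdesc ws x \<longleftrightarrow> x \<in> {p, a}"
  shows "ceq ws [p, a]"
proof -
  have m': "M a c = 3" "M c p = M p c" using m M_sym by metis+
  have ne: "c \<noteq> p" "c \<noteq> a" "c \<notin> set t" "p \<notin> set (a # t)"
    using m m' M_self[of c] com_not_mem[OF com(1), of c] com_not_mem[OF com(2), of p] by auto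
  have seg: "\<exists>D E r. ceq xs (D @ E @ r) \<and> set D \<subseteq> {p} \<and> set E \<subseteq> set (a # t) \<and>
      (r = [] \<or> (\<exists>r'. r = c # r' \<and> set r' \<subseteq> {p, c} \<union> set (a # t)))" if xs: "set xs \<subseteq> {p, c} \<union> set (a # t)" for xs
  proof -
    obtain D E r where "ceq xs (D @ E @ r)" "set D \<subseteq> {p}" "set E \<subseteq> set (a # t)" "r = [] \<or> (\<exists>r'. r = c # r' \<and> set r' \<subseteq> set xs)"
      by (rule segment[of xs c "{p}" "set (a # t)"]) (use xs com ne in auto)
    then show ?thesis using xs by blast
  qed
  have pa: "M p c \<noteq> 2" "p \<noteq> c" "M a c \<noteq> 2" "a \<noteq> c" using m m' ne by auto
  obtain D0 E0 r0 where 0: "ceq ws (D0 @ E0 @ r0)" "set D0 \<subseteq> {p}" "set E0 \<subseteq> set (a # t)"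
    "r0 = [] \<or> (\<exists>r'. r0 = c # r' \<and> set r' \<subseteq> {p, c} \<union> set (a # t))" using seg[OF ws(2)] by blast
  have "x \<in> set (D0 @ E0)" if "x \<in> {p, a}" for x
    by (rule ldesc_segment[of ws x "D0 @ E0" r0 c]) (use that desc 0 pa in auto)
  then have pa0: "p \<in> set D0" "a \<in> set E0" using 0 ne by auto
  have ok0: "ok (D0 @ E0 @ r0)" using ceq_ok[OF 0(1) ws(1)] .
  have D0: "D0 = [p]" using one_letter[of D0 p] ok_factor[OF ok0, of "[]" D0 "E0 @ r0"] 0(2) pa0(1) by auto
  from 0(4) consider "r0 = []" | r0' where "r0 = c # r0'" "set r0' \<subseteq> {p, c} \<union> set (a # t)" by blast
  then show ?thesis
  proof cases
    case 1
    have "E0 = [a]"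
    proof (rule tail_single[OF t])
      show "ok E0" using ok_factor[OF ok0, of D0 E0 r0] by simp
      show "x = a" if "ldesc E0 x" for x
      proof -
        have "x \<in> set (a # t)" using ldesc_set[OF that] 0(3) by auto
        then have "ldesc (D0 @ E0 @ r0) x"
          by (intro ldesc_middle that) (use D0 com in \<open>auto simp: com_def\<close>)
        then show ?thesis using desc(1)[of x] ceq_ldesc[OF 0(1), of x] \<open>x \<in> set (a # t)\<close> ne by auto
      qed
      show "x = a" if "rdesc E0 x" for x
      proof -
        have "rdesc (D0 @ E0 @ r0) x" using rdesc_middle[OF that, of r0 D0] 1 by (simp add: com_def)
        then show ?thesis using desc(2)[of x] ceq_rdesc[OF 0(1), of x] rdesc_set[OF that] 0(3) ne by auto
      qed
    qed (use 0 pa0 in auto)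
    then show ?thesis using 0(1) D0 1 by simp
  next
    case 2
    obtain D1 E1 r1 where 1: "ceq r0' (D1 @ E1 @ r1)" "set D1 \<subseteq> {p}" "set E1 \<subseteq> set (a # t)"
      "r1 = [] \<or> (\<exists>r'. r1 = c # r' \<and> set r' \<subseteq> {p, c} \<union> set (a # t))" using seg[OF 2(2)] by blast
    have w1: "ceq ws ((p # E0 @ [c]) @ D1 @ E1 @ r1)"
      using ceq_extend[of ws "p # E0 @ [c]" r0'] 0(1) 1(1) 2(1) D0 by simp
    have ok1: "ok (p # E0 @ c # D1 @ E1 @ r1)" using ceq_ok[OF w1 ws(1)] by simp
    have D1: "D1 = [] \<or> D1 = [p]" using one_letter[of D1 p] ok_factor[OF ok1, of "p # E0 @ [c]" D1] 1(2) by auto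
    have last1: "p \<in> set D1" "a \<in> set E1" if "r1 = []"
    proof -
      have "x \<in> set (D1 @ E1)" if "x \<in> {p, a}" for x
        by (rule rdesc_segment[of ws x "p # E0" c]) (use that desc w1 pa \<open>r1 = []\<close> in auto)
      then show "p \<in> set D1" "a \<in> set E1" using 1 ne by auto
    qed
    show ?thesis
    proof (cases "M p c = 3")
      case True
      \<comment> \<open>Weight 3 forbids \<open>p c p\<close>, so the second segment would be a tail
        word enclosed by two \<open>c\<close>.\<close>
      have "D1 \<noteq> [p]"
        using no_cac[OF ok1, of "[]" p E0 c "[]" "E1 @ r1"] True 0(3) com by (auto simp: com_def)
      then have D1: "D1 = []" using D1 by simp
      then obtain r1' where "r1 = c # r1'" using last1 1(4) by auto
      then show ?thesis using tail_not_between[OF t com(1) m(1) 1(3) ok1, of "p # E0" r1'] D1 by auto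
    next
      case False
      then have t0: "t = []" using short by simp
      have E0: "E0 = [a]" using one_letter[of E0 a] ok_factor[OF ok0, of D0 E0 r0] 0(3) pa0(2) t0 by auto
      have "a \<notin> set E1"
      proof
        assume "a \<in> set E1"
        then obtain E' where "E1 = a # E'" using 1(3) t0 by (cases E1) auto
        then show False
          by (intro no_cac[OF ok1, of "[p]" a "[]" c D1 "E' @ r1"]) (use E0 m' com 1(2) in \<open>auto simp: com_def\<close>)
      qed
      then have E1: "E1 = []" using 1(3) t0 by (cases E1) auto
      then obtain r1' where r1: "r1 = c # r1'" "set r1' \<subseteq> {p, c} \<union> set (a # t)" using last1 1(4) by auto
      have "D1 \<noteq> []" using no_return[OF ok1, of "p # E0" c "[]" r1'] r1 E1 by (auto simp: com_def)
      then have D1: "D1 = [p]" using D1 by simp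
      \<comment> \<open>Commuting the first \<open>p\<close> past \<open>a\<close> exposes
        \<open>p c p c\<close>, which only weight 5 tolerates.\<close>
      have ok1': "ok (a # p # c # p # c # r1')"
        by (rule ok_move[OF ok1, of "[]" "[p]" "[a]" "c # p # c # r1'"]) (use E0 E1 D1 r1 com in \<open>auto simp: com_def\<close>)
      have "M p c \<noteq> 4" using no_braid_4[of p c _ "[a]" r1'] ok1' ne by auto
      then have m5: "M p c = 5" using False m by simp
      obtain D2 E2 r2 where 2: "ceq r1' (D2 @ E2 @ r2)" "set D2 \<subseteq> {p}" "set E2 \<subseteq> set (a # t)"
        "r2 = [] \<or> (\<exists>r'. r2 = c # r' \<and> set r' \<subseteq> {p, c} \<union> set (a # t))" using seg[OF r1(2)] by blast
      have w2: "ceq ws ((p # a # c # p # [c]) @ D2 @ E2 @ r2)"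
        using ceq_extend[of ws "p # a # c # p # [c]" r1'] w1 E0 E1 D1 2(1) r1 by simp
      have ok2: "ok (a # p # c # p # c # D2 @ E2 @ r2)"
        using ceq_ok[OF _ ok1'] ceq_extend[OF ceq_refl, of r1' "D2 @ E2 @ r2" "a # p # c # p # [c]"] 2(1) by simp
      have D2: "D2 = [] \<or> D2 = [p]" using one_letter[of D2 p] ok_factor[OF ok2, of "a # p # c # p # [c]" D2] 2(2) by auto
      \<comment> \<open>One more \<open>p\<close> would complete \<open>p c p c p\<close>, so the
        third segment has nothing in the left arm.\<close>
      then have D2: "D2 = []" using no_braid_5[of p c _ "[a]" "E2 @ r2"] ok2 m5 ne by auto
      have "r2 \<noteq> []"
      proof
        assume "r2 = []"
        then have "p \<in> set (D2 @ E2)"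
          by (intro rdesc_segment[of ws p "p # a # c # [p]" c]) (use desc w2 pa in auto)
        then show False using D2 2(3) ne by auto
      qed
      then obtain r2' where "r2 = c # r2'" using 2(4) by auto
      then show ?thesis using tail_not_between[OF t com(1) m(1) 2(3) ok2, of "a # p # c # [p]" r2'] D2 by auto
    qed
  qed
qed

section \<open>Arms that end in an edge of weight 4\<close>

fun double_tail :: "'l list \<Rightarrow> bool" where
  "double_tail [] = False"
| "double_tail [a] = True"
| "double_tail [a, b] = (M a b = 4)"
| "double_tail (a # b # d # t) = (M a b = 3 \<and> com {a} (set (d # t)) \<and> double_tail (b # d # t))"

text \<open>With edges of weight 3, the gap around \<open>j\<close> must contain the successor
  \<open>b\<close> and the last gap must contain it twice. The last \<open>b\<close> of the former
  and two of the latter form the same configuration one step further out, with \<open>k\<close> in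
  the role of \<open>j\<close>. At the outer edge it becomes \<open>b k b k\<close>, excluded by
  weight 4.\<close>

lemma double_tail_no_triple_return:
  assumes "double_tail (k # t)" "com {j} (set t)" "M k j = 3" "set U \<subseteq> set t" "set V \<subseteq> set t" "set Z \<subseteq> set t"
    "ok (k # U @ j # V @ k # Z @ [k])"
  shows False
  using assms
proof (induction t arbitrary: k j U V Z)
  case Nil
  then show ?case using no_return[OF Nil(7), of "k # U @ j # V" k Z "[]"] by (auto simp: com_def)
next
  case (Cons b t)
  note p = Cons.prems(7)
  have j: "ok (k # j # U @ V @ k # Z @ [k])"
    by (rule ok_move[OF p, of "[k]" U "[j]" "V @ k # Z @ [k]"]) (use Cons.prems in \<open>auto simp: com_def\<close>)
  have kb: "k \<noteq> b" "b \<noteq> k" using Cons.prems(1) M_self[of k] by (cases t; auto)+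
  have UV: "\<not> com {k} (set U \<union> set V)"
    using no_cac[OF j, of "[]" k "[]" j "U @ V" "Z @ [k]"] Cons.prems(3) by (auto simp: com_def)
  show ?case
  proof (cases t)
    case Nil
    have m: "M b k = 4" using Cons.prems(1) Nil M_sym[of k b] by simp
    have "ok Z" using ok_factor[OF p, of "k # U @ j # V @ [k]" Z "[k]"] by simp
    then have "Z = [] \<or> Z = [b]" using one_letter Cons.prems(6) Nil by auto
    moreover have "Z \<noteq> []" using no_return[OF p, of "k # U @ j # V" k "[]" "[]"] by (auto simp: com_def)
    ultimately have Z: "Z = [b]" by simp
    have "U @ V \<noteq> []" using UV by (auto simp: com_def)
    then obtain W y where W: "U @ V = W @ [y]" by (meson rev_exhaust)
    have "set (W @ [y]) \<subseteq> {b}" unfolding W[symmetric] using Cons.prems(4,5) Nil by auto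
    then have "(U @ V) @ k # Z @ [k] = W @ b # k # b # [k]" unfolding W using Z by simp
    then show False using no_braid_4[OF m kb(2) j, of "k # j # W" "[]"] by simp
  next
    case (Cons d t')
    have kt: "M k b = 3" "com {k} (set t)" "double_tail (b # t)" using \<open>double_tail (k # b # t)\<close> Cons by auto
    have "b \<in> set Z"
    proof (rule ccontr)
      assume "b \<notin> set Z"
      then show False using no_return[OF p, of "k # U @ j # V" k Z "[]"] \<open>set Z \<subseteq> _\<close> kt by (auto simp: com_def)
    qed
    from split_list_first[OF this] obtain Z0 Z' where Z: "Z = Z0 @ b # Z'" "b \<notin> set Z0" by blast
    have "b \<in> set Z'"
    proof (rule ccontr)
      assume "b \<notin> set Z'"
      then show False using no_cac[OF p, of "k # U @ j # V" k Z0 b Z' "[]"] Z \<open>set Z \<subseteq> _\<close> kt by (auto simp: com_def)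
    qed
    from split_list_first[OF this] obtain Z1 Z2 where Z': "Z' = Z1 @ b # Z2" "b \<notin> set Z1" by blast
    have "b \<in> set (U @ V)" using UV kt(2) \<open>set U \<subseteq> _\<close> \<open>set V \<subseteq> _\<close> by (auto simp: com_def)
    from split_list_last[OF this] obtain W W' where W: "U @ V = W @ b # W'" "b \<notin> set W'" by blast
    have sub: "set W' \<subseteq> set t" "set Z0 \<subseteq> set t" "set Z1 \<subseteq> set t"
      using arg_cong[OF W(1), of set] W(2) Z Z' Cons.prems(4-6) by auto
    have "ok (b # W' @ k # Z0 @ b # Z1 @ [b])"
      by (rule ok_factor[OF j, of "k # j # W" _ "Z2 @ [k]"])
        (use arg_cong[OF W(1), of "\<lambda>x. x @ k # Z @ [k]"] Z Z' in auto)
    then show False using Cons.IH[of b k W' Z0 Z1] kt sub M_sym[of k b] by auto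
  qed
qed

text \<open>The two \<open>c\<close> force two \<open>a\<close> between them, and the
  \<open>a\<close> in front of the first \<open>c\<close> makes three.\<close>

lemma double_tail_not_between:
  assumes t: "double_tail (a # t)" and c: "com {c} (set t)" "M a c = 3"
    and E: "set U \<subseteq> set t" "set E \<subseteq> set (a # t)" and p: "ok ws" "ws = us @ a # U @ c # E @ c # vs"
  shows False
proof -
  have m: "M c a = 3" using c M_sym by metis
  have "a \<in> set E"
  proof (rule ccontr)
    assume "a \<notin> set E"
    then show False using no_return[OF p(1), of "us @ a # U" c E vs] p(2) E c by (auto simp: com_def)
  qed
  from split_list_first[OF this] obtain V E' where 1: "E = V @ a # E'" "a \<notin> set V" by blast
  have "a \<in> set E'"
  proof (rule ccontr)
    assume "a \<notin> set E'"
    then show False using no_cac[OF p(1), of "us @ a # U" c V a E' vs] p(2) 1 E c m by (auto simp: com_def)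
  qed
  from split_list_first[OF this] obtain Z Z' where 2: "E' = Z @ a # Z'" "a \<notin> set Z" by blast
  have "ok (a # U @ c # V @ a # Z @ [a])"
    by (rule ok_factor[OF p(1), of us _ "Z' @ c # vs"]) (use p(2) 1 2 in auto)
  then show False using double_tail_no_triple_return[OF t c, of U V Z] E 1 2 by auto
qed

text \<open>The walk to the outer end of the arm and back; on the labels \<open>4, ..., n\<close> it
  is the word \<open>z\<close>.\<close>

fun updown :: "'l list \<Rightarrow> 'l list" where
  "updown [] = []"
| "updown [a] = [a]"
| "updown (a # t) = a # updown t @ [a]"

text \<open>The word starts and ends with \<open>k\<close>. The part in between avoids
  \<open>k\<close> and has \<open>b\<close> as its only descent, so induction applies to it one step
  further out.\<close>

lemma double_tail_words:
  assumes "double_tail (k # t)" "ok E" "set E \<subseteq> set (k # t)" "E \<noteq> []"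
    and "\<And>x. ldesc E x \<Longrightarrow> x = k" "\<And>x. rdesc E x \<Longrightarrow> x = k"
  shows "ceq E [k] \<or> ceq E (updown (k # t))"
  using assms
proof (induction t arbitrary: k E)
  case Nil
  have "E = [k]" using one_letter[OF Nil.prems(2)] Nil.prems(3,4) by auto
  then show ?case using ceq_refl[of "[k]"] by simp
next
  case (Cons b t)
  obtain x E' where E: "E = x # E'" using Cons.prems(4) by (cases E) auto
  have "x = k" using Cons.prems(5)[of x] E by simp
  then have E: "E = k # E'" using E by simp
  have kb: "k \<noteq> b" using Cons.prems(1) M_self[of k] by (cases t) auto
  show ?case
  proof (cases "E' = []")
    case True
    then show ?thesis using E ceq_refl[of "[k]"] by simp
  next
    case False
    then obtain E'' y where "E' = E'' @ [y]" by (meson rev_exhaust)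
    moreover from this have "y = k" using Cons.prems(6)[of y] E by (simp add: rdesc_Cons rdesc_append)
    ultimately have E: "E = k # E'' @ [k]" using E by simp
    have kE: "k \<notin> set E''"
    proof
      assume "k \<in> set E''"
      from split_list_first[OF this] obtain Z V where 1: "E'' = Z @ k # V" "k \<notin> set Z" by blast
      obtain Z' V' where 2: "V @ [k] = Z' @ k # V'" "k \<notin> set Z'" using split_list_first[of k "V @ [k]"] by auto
      have E2: "E = k # Z @ k # Z' @ k # V'" using E 1 2(1) by simp
      have sub: "set Z \<subseteq> set (b # t)" "set Z' \<subseteq> set (b # t)" using Cons.prems(3) E2 1 2(2) by auto
      show False
      proof (cases t)
        case Nil
        have "ok Z" "ok Z'" using ok_factor[OF Cons.prems(2), of "[k]" Z] ok_factor[OF Cons.prems(2), of "k # Z @ [k]" Z'] E2 by auto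
        then have "Z = [] \<or> Z = [b]" "Z' = [] \<or> Z' = [b]" using one_letter sub Nil by auto
        moreover have "Z \<noteq> []" "Z' \<noteq> []"
          using no_return[OF Cons.prems(2), of "[]" k Z] no_return[OF Cons.prems(2), of "k # Z" k Z'] E2 by (auto simp: com_def)
        ultimately show False using no_braid_4[of k b E "[]"] Cons.prems(1,2) Nil E2 kb by auto
      next
        case (Cons d t')
        have kt: "M k b = 3" "com {k} (set t)" "double_tail (b # t)" using \<open>double_tail (k # b # t)\<close> Cons by auto
        \<comment> \<open>Between two \<open>k\<close> joined by an edge of weight 3, no
          \<open>b\<close> would give \<open>k k\<close> and a single one
          \<open>k b k\<close>.\<close>
        have two: "\<exists>A B C. Y = A @ b # B @ b # C \<and> b \<notin> set A \<and> b \<notin> set B"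
          if "set Y \<subseteq> set (b # t)" "E = us @ k # Y @ k # vs" for Y us vs
        proof -
          have "b \<in> set Y"
          proof (rule ccontr)
            assume "b \<notin> set Y"
            then show False using no_return[OF \<open>ok E\<close> that(2)] that(1) kt by (auto simp: com_def)
          qed
          from split_list_first[OF this] obtain A Y' where 1: "Y = A @ b # Y'" "b \<notin> set A" by blast
          have "b \<in> set Y'"
          proof (rule ccontr)
            assume "b \<notin> set Y'"
            then show False using no_cac[OF \<open>ok E\<close>, of us k A b Y' vs] that 1 kt by (auto simp: com_def)
          qed
          from split_list_first[OF this] obtain B C where 2: "Y' = B @ b # C" "b \<notin> set B" by blast
          then show ?thesis using 1 by auto
        qed
        obtain Z0 Z1 Z2 where Z': "Z' = Z0 @ b # Z1 @ b # Z2" "b \<notin> set Z0" "b \<notin> set Z1"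
          using two[OF sub(2), of "k # Z" V'] E2 by auto
        obtain A B C where "Z = A @ b # B @ b # C" using two[OF sub(1), of "[]" "Z' @ k # V'"] E2 by auto
        then have "b \<in> set Z" by simp
        from split_list_last[OF this] obtain W W' where W: "Z = W @ b # W'" "b \<notin> set W'" by blast
        have "ok (b # W' @ k # Z0 @ b # Z1 @ [b])"
          by (rule ok_factor[OF Cons.prems(2), of "k # W" _ "Z2 @ k # V'"]) (use E2 Z' W in auto)
        then show False
          using double_tail_no_triple_return[OF kt(3,2), of W' Z0 Z1] kt(1) M_sym[of k b] sub W Z' by auto
      qed
    qed
    have okE: "ok E''" using ok_factor[OF Cons.prems(2), of "[k]" E'' "[k]"] E by simp
    have sub: "set E'' \<subseteq> set (b # t)" using Cons.prems(3) E kE by auto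
    have ne: "E'' \<noteq> []" using no_return[OF Cons.prems(2), of "[]" k "[]" "[]"] E by (auto simp: com_def)
    show ?thesis
    proof (cases t)
      case Nil
      then have "E'' = [b]" using one_letter[OF okE] sub ne by auto
      then show ?thesis using E Nil ceq_refl[of "[k, b, k]"] by simp
    next
      case (Cons d t')
      have kt: "M k b = 3" "com {k} (set t)" "double_tail (b # t)" using \<open>double_tail (k # b # t)\<close> Cons by auto
      have l: "x = b" if "ldesc E'' x" for x
      proof (rule ccontr)
        assume "x \<noteq> b"
        then have "com {x} {k}" "x \<noteq> k" using ldesc_set[OF that] sub kt kE by (auto simp: com_def)
        then have "ldesc E x" using that E by (simp add: ldesc_append)
        then show False using Cons.prems(5) \<open>x \<noteq> k\<close> by blast
      qed
      have r: "x = b" if "rdesc E'' x" for x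
      proof (rule ccontr)
        assume "x \<noteq> b"
        then have "com {x} {k}" "x \<noteq> k" using rdesc_set[OF that] sub kt kE by (auto simp: com_def)
        then have "rdesc E x" using that E by (simp add: rdesc_append rdesc_Cons)
        then show False using Cons.prems(6) \<open>x \<noteq> k\<close> by blast
      qed
      have "ceq E'' [b] \<or> ceq E'' (updown (b # t))" using Cons.IH[OF kt(3) okE sub ne l r] by blast
      \<comment> \<open>Turning back at \<open>b\<close> is only possible across the last edge,
        whose weight is 4; here the weight is 3.\<close>
      moreover have "\<not> ceq E'' [b]"
      proof
        assume "ceq E'' [b]"
        then have "ceq E [k, b, k]" using ceq_context[of E'' "[b]" "[k]" "[k]"] E by simp
        then have "ok [k, b, k]" using ceq_ok Cons.prems(2) by blast
        then show False by (rule no_cac[of _ "[]" k "[]" b "[]" "[]"]) (use kt(1) in simp_all)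
      qed
      ultimately have "ceq E (updown (k # b # t))"
        using ceq_context[of E'' "updown (b # t)" "[k]" "[k]"] unfolding E by simp
      then show ?thesis by blast
    qed
  qed
qed

section \<open>Thin words over the diagrams\<close>

text \<open>The path is \<open>p\<close>, \<open>q\<close>, \<open>c\<close>, \<open>a\<close>,
  \<open>t\<close> with heavy edge between \<open>p\<close> and \<open>q\<close>. The right arm
  enters mainly through \<open>bounce\<close> and \<open>right\<close>, so that simple tails and
  tails with an outer double edge share the argument. Weight 5 is only paired with a simple
  tail.\<close>

lemma double_left_arm:
  assumes ws: "ok ws" "set ws \<subseteq> {p, q, c} \<union> set (a # t)"
    and com: "com {c} (set t)" "com {p, q} (set (a # t))" "com {p} {c}"
    and m: "M q c = 3" "M c a = 3" "M p q = 4 \<or> M p q = 5 \<and> simple_tail (a # t)"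
    and bounce: "\<And>U E us vs ws. \<lbrakk>ok ws; ws = us @ a # U @ c # E @ c # vs; set U \<subseteq> set t; set E \<subseteq> set (a # t)\<rbrakk> \<Longrightarrow> False"
    and right: "\<And>E. \<lbrakk>ok E; set E \<subseteq> set (a # t); E \<noteq> []; \<And>x. ldesc E x \<Longrightarrow> x = a; \<And>x. rdesc E x \<Longrightarrow> x = a\<rbrakk>
      \<Longrightarrow> \<exists>E'\<in>Es. ceq E E'"
    and desc: "\<And>x. ldesc ws x \<longleftrightarrow> x \<in> {q, a}" "\<And>x. rdesc ws x \<longleftrightarrow> x \<in> {q, a}"
  shows "\<exists>D\<in>{[q], [q, p, q]}. \<exists>E\<in>Es. ceq ws (D @ E)"
proof -
  have m': "M a c = 3" "M c q = 3" "M q p = M p q" "M c p = 2" using m com(3) M_sym by (metis com_single)+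
  have pq: "p \<noteq> q" "q \<noteq> p" using m M_self by auto
  have ne: "c \<notin> {p, q}" "c \<noteq> a" "c \<notin> set t" "p \<notin> set (a # t)" "q \<notin> set (a # t)" "p \<noteq> a" "q \<noteq> a"
    using m m' M_self[of c] com_not_mem[OF com(1), of c] com_not_mem[OF com(2)] by auto
  have seg: "\<exists>D E r. ceq xs (D @ E @ r) \<and> set D \<subseteq> {p, q} \<and> set E \<subseteq> set (a # t) \<and>
      (r = [] \<or> (\<exists>r'. r = c # r' \<and> set r' \<subseteq> {p, q, c} \<union> set (a # t)))"
    if xs: "set xs \<subseteq> {p, q, c} \<union> set (a # t)" for xs
  proof -
    obtain D E r where "ceq xs (D @ E @ r)" "set D \<subseteq> {p, q}" "set E \<subseteq> set (a # t)" "r = [] \<or> (\<exists>r'. r = c # r' \<and> set r' \<subseteq> set xs)"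
      by (rule segment[of xs c "{p, q}" "set (a # t)"]) (use xs com ne in auto)
    then show ?thesis using xs by blast
  qed
  have qa: "M q c \<noteq> 2" "q \<noteq> c" "M a c \<noteq> 2" "a \<noteq> c" using m m' ne by auto
  obtain D0 E0 r0 where 0: "ceq ws (D0 @ E0 @ r0)" "set D0 \<subseteq> {p, q}" "set E0 \<subseteq> set (a # t)"
    "r0 = [] \<or> (\<exists>r'. r0 = c # r' \<and> set r' \<subseteq> {p, q, c} \<union> set (a # t))" using seg[OF ws(2)] by blast
  have "x \<in> set (D0 @ E0)" if "x \<in> {q, a}" for x
    by (rule ldesc_segment[of ws x "D0 @ E0" r0 c]) (use that desc 0 qa in auto)
  then have qa0: "q \<in> set D0" "a \<in> set E0" using 0 ne by auto
  have ok0: "ok (D0 @ E0 @ r0)" using ceq_ok[OF 0(1) ws(1)] .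
  have okD0: "ok D0" using ok_factor[OF ok0, of "[]" D0 "E0 @ r0"] by simp
  have comDE: "com (set D) (set E)" if "set D \<subseteq> {p, q}" "set E \<subseteq> set (a # t)" for D E
    using com_mono[OF com(2)] that by blast
  from 0(4) consider "r0 = []" | r0' where "r0 = c # r0'" "set r0' \<subseteq> {p, q, c} \<union> set (a # t)" by blast
  then show ?thesis
  proof cases
    case 1
    have "\<exists>E'\<in>Es. ceq E0 E'"
    proof (rule right)
      show "ok E0" using ok_factor[OF ok0, of D0 E0 r0] by simp
      show "x = a" if "ldesc E0 x" for x
      proof -
        have "x \<in> set (a # t)" using ldesc_set[OF that] 0(3) by auto
        then have "ldesc (D0 @ E0 @ r0) x"
          by (intro ldesc_middle that) (use com_sym[OF comDE[OF 0(2), of "[x]"]] in auto)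
        then show ?thesis using desc(1)[of x] ceq_ldesc[OF 0(1), of x] \<open>x \<in> set (a # t)\<close> ne by auto
      qed
      show "x = a" if "rdesc E0 x" for x
      proof -
        have "rdesc (D0 @ E0 @ r0) x" using rdesc_middle[OF that, of r0 D0] 1 by (simp add: com_def)
        then show ?thesis using desc(2)[of x] ceq_rdesc[OF 0(1), of x] rdesc_set[OF that] 0(3) ne by auto
      qed
    qed (use 0 qa0 in auto)
    then obtain E' where E': "E' \<in> Es" "ceq E0 E'" by blast
    have l: "x = q" if "ldesc D0 x" for x
      using desc(1)[of x] ceq_ldesc[OF 0(1), of x] ldesc_append[of D0 "E0 @ r0" x] that ldesc_set[OF that] 0(2) ne by auto
    have r: "x = q" if "rdesc D0 x" for x
    proof -
      have "x \<in> {p, q}" using rdesc_set[OF that] 0(2) by auto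
      then have "com {x} (set (E0 @ r0))" using comDE[OF _ 0(3), of "[x]"] 1 by auto
      then have "rdesc (D0 @ E0 @ r0) x" using that by (simp add: rdesc_append[of D0])
      then show ?thesis using desc(2)[of x] ceq_rdesc[OF 0(1), of x] \<open>x \<in> {p, q}\<close> ne by auto
    qed
    have "M p q = 4 \<or> M p q = 5" using m by blast
    then have "D0 \<in> {[], [p], [q], [p, q], [q, p], [p, q, p], [q, p, q], [p, q, p, q], [q, p, q, p]}"
      using dihedral_words_5[OF okD0 0(2) pq(1)] by simp
    moreover have "D0 \<noteq> []" "hd D0 = q" "last D0 = q"
    proof -
      show "D0 \<noteq> []" using qa0 by auto
      then obtain x D where "D0 = x # D" by (cases D0) auto
      then show "hd D0 = q" using l[of x] by simp
      from \<open>D0 \<noteq> []\<close> obtain y D' where "D0 = D' @ [y]" by (meson rev_exhaust)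
      then show "last D0 = q" using r[of y] by (simp add: rdesc_append)
    qed
    moreover from this have "hd D0 \<noteq> p" "last D0 \<noteq> p" using pq by simp_all
    ultimately have "D0 \<in> {[q], [q, p, q]}" by (elim insertE) simp_all
    moreover have "ceq ws (D0 @ E')" using ceq_extend[of ws D0 E0 E'] 0(1) 1 E' by simp
    ultimately show ?thesis using E'(1) by blast
  next
    case 2
    obtain D1 E1 r1 where 1: "ceq r0' (D1 @ E1 @ r1)" "set D1 \<subseteq> {p, q}" "set E1 \<subseteq> set (a # t)"
      "r1 = [] \<or> (\<exists>r'. r1 = c # r' \<and> set r' \<subseteq> {p, q, c} \<union> set (a # t))" using seg[OF 2(2)] by blast
    have w1: "ceq ws ((D0 @ E0 @ [c]) @ D1 @ E1 @ r1)"
      using ceq_extend[of ws "D0 @ E0 @ [c]" r0'] 0(1) 1(1) 2(1) by simp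
    have ok1: "ok (D0 @ E0 @ c # D1 @ E1 @ r1)" using ceq_ok[OF w1 ws(1)] by simp
    have okD1: "ok D1" using ok_factor[OF ok1, of "D0 @ E0 @ [c]" D1] by simp
    \<comment> \<open>By \<open>no_double_overlap\<close> the second segment cannot repeat both
      descents, hence it is not the last one.\<close>
    have both: "\<not> (q \<in> set D1 \<and> a \<in> set E1)"
    proof
      assume b: "q \<in> set D1 \<and> a \<in> set E1"
      show False
        by (rule no_double_overlap[OF ok1, of "[]" D0 E0 "[]" c D1 E1 r1 q a "{p}" "set t"])
          (use b qa0 0 1 com m m' in \<open>auto simp: com_def\<close>)
    qed
    have "r1 \<noteq> []"
    proof
      assume r1: "r1 = []"
      have "x \<in> set (D1 @ E1)" if "x \<in> {q, a}" for x
        by (rule rdesc_segment[of ws x "D0 @ E0" c]) (use that desc w1 qa r1 in auto)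
      then show False using both 1 ne by auto
    qed
    then obtain r1' where r1: "r1 = c # r1'" "set r1' \<subseteq> {p, q, c} \<union> set (a # t)" using 1(4) by auto
    show ?thesis
    proof (cases "q \<in> set D1")
      case False
      then have D1: "set D1 \<subseteq> {p}" using 1(2) by auto
      from split_list_last[OF qa0(2)] obtain N K where E0: "E0 = N @ a # K" "a \<notin> set K" by blast
      have c1: "com (set D1) (set (E1 @ [c]))" using D1 1(3) com by (auto simp: com_def)
      have "ok (D0 @ N @ a # K @ c # E1 @ [c])"
        by (rule drop_right[OF ok1 _ c1, of "D0 @ N @ a # K @ [c]" r1']) (simp_all add: E0 r1)
      then show ?thesis using bounce[of _ "D0 @ N" K E1 "[]"] 0(3) 1(3) E0 by auto
    next
      case q1: True
      then have E1: "set E1 \<subseteq> set t" using both 1(3) by auto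
      have m45: "M p q = 4 \<or> M p q = 5" using m by blast
      have cE1: "com {c} (set E1)" using com(1) E1 by (auto simp: com_def)
      \<comment> \<open>Now \<open>a\<close> is missing from \<open>E1\<close>, so \<open>c\<close>
        commutes with \<open>E1\<close>, and a single \<open>q\<close> would give
        \<open>c q c\<close>. Thus \<open>D1\<close> contains \<open>q\<close> twice.\<close>
      have two': "D1 \<noteq> U @ q # V" if "set U \<subseteq> {p}" "set V \<subseteq> {p}" for U V
      proof
        assume "D1 = U @ q # V"
        note UV = this that
        show False
          by (rule no_cac[OF ok1, of "D0 @ E0" c U q "V @ E1" r1'])
            (use UV r1 cE1 com m' in \<open>auto simp: com_def\<close>)
      qed
      have "D1 \<in> {[], [p], [q], [p, q], [q, p], [p, q, p], [q, p, q], [p, q, p, q], [q, p, q, p]}"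
        using dihedral_words_5[OF okD1 1(2) pq(1) m45] .
      moreover have "D1 \<notin> {[], [p]}" using q1 pq by auto
      moreover have "D1 \<noteq> [q]" "D1 \<noteq> [p, q]" "D1 \<noteq> [q, p]" "D1 \<noteq> [p, q, p]"
        using two'[of "[]" "[]"] two'[of "[p]" "[]"] two'[of "[]" "[p]"] two'[of "[p]" "[p]"] by simp_all
      ultimately have D1: "D1 \<in> {[q, p, q], [p, q, p, q], [q, p, q, p]}" by blast
      from split_list_last[OF qa0(1)] obtain Z L where D0: "D0 = Z @ q # L" "q \<notin> set L" by blast
      have "set L \<subseteq> {p}" using D0 0(2) by auto
      moreover have "ok L" using ok_factor[OF okD0, of "Z @ [q]" L "[]"] D0 by simp
      ultimately have L: "L = [] \<or> L = [p]" using one_letter by blast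
      have D1ne: "D1 \<noteq> []" using D1 by auto
      have D1q: "D1 \<in> {[q, p, q], [q, p, q, p]}" if "hd D1 = q" using that D1 pq by (elim insertE) simp_all
      \<comment> \<open>The end of \<open>D0\<close> and the start of \<open>D1\<close> meet across
        \<open>c\<close>: two \<open>q\<close> give \<open>q c q\<close>, and two \<open>p\<close>
        cancel because \<open>p\<close> commutes with \<open>c\<close>.\<close>
      have qcq: "\<not> (L = [] \<and> hd D1 = q)"
      proof
        assume h: "L = [] \<and> hd D1 = q"
        then obtain D1' where D1': "D1 = q # D1'" using D1ne by (cases D1) auto
        show False
          by (rule no_cac[OF ok1, of Z q E0 c "[]" "D1' @ E1 @ r1"])
            (use h D1' D0 m com_mono[OF com(2)] 0(3) in auto)
      qed
      have pp: "\<not> (L = [p] \<and> hd D1 = p)"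
      proof
        assume h: "L = [p] \<and> hd D1 = p"
        then obtain D1' where D1': "D1 = p # D1'" using D1ne by (cases D1) auto
        show False
          by (rule no_return[OF ok1, of "Z @ [q]" p "E0 @ [c]" "D1' @ E1 @ r1"])
            (use h D1' D0 com 0(3) in \<open>auto simp: com_def\<close>)
      qed
      have cpE: "com {p} (set (E0 @ [c]))" using com 0(3) by (auto simp: com_def)
      \<comment> \<open>Either the \<open>p\<close> at the end of \<open>D0\<close> is pushed across
        \<open>c\<close> in front of \<open>D1\<close>, or \<open>D1\<close> is
        \<open>p q p q\<close> itself. \<open>V\<close> records whether a fifth letter
        \<open>p\<close> follows.\<close>
      have "\<exists>us V. ok (us @ [p, q, p, q] @ V @ E1 @ r1) \<and> (V = [] \<and> (\<exists>W. D1 = W @ [q]) \<or> V = [p])"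
      proof (cases "hd D1 = q")
        case True
        then have L: "L = [p]" using L qcq by blast
        have okZ: "ok (Z @ q # E0 @ c # p # D1 @ E1 @ r1)"
          by (rule ok_move[OF ok1, of "Z @ [q]" "[p]" "E0 @ [c]" "D1 @ E1 @ r1"])
            (use L D0 cpE in auto)
        consider "D1 = [q, p, q]" | "D1 = [q, p, q, p]" using D1q[OF True] by blast
        then show ?thesis
        proof cases
          case 1
          then show ?thesis using okZ
            by (intro exI[of _ "Z @ q # E0 @ [c]"] exI[of _ "[]"]) simp
        next
          case 2
          then show ?thesis using okZ
            by (intro exI[of _ "Z @ q # E0 @ [c]"] exI[of _ "[p]"]) simp
        qed
      next
        case False
        then have "D1 = [p, q, p, q]" using D1 by (elim insertE) simp_all
        then show ?thesis using ok1 by (intro exI[of _ "D0 @ E0 @ [c]"] exI[of _ "[]"]) simp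
      qed
      then obtain us V where us: "ok (us @ [p, q, p, q] @ V @ E1 @ r1)"
        and V: "V = [] \<and> (\<exists>W. D1 = W @ [q]) \<or> V = [p]" by blast
      have "M p q \<noteq> 4" using no_braid_4[OF _ pq(1) us, of us "V @ E1 @ r1"] by auto
      then have m5: "M p q = 5" and t: "simple_tail (a # t)" using m by auto
      have "V \<noteq> [p]" using no_braid_5[OF m5 pq(1) us, of us "E1 @ r1"] by auto
      then have us: "ok (us @ p # q # p # q # E1 @ r1)" and D1: "\<exists>W. D1 = W @ [q]"
        using us V by auto
      obtain D2 E2 r2 where 2: "ceq r1' (D2 @ E2 @ r2)" "set D2 \<subseteq> {p, q}" "set E2 \<subseteq> set (a # t)"
        "r2 = [] \<or> (\<exists>r'. r2 = c # r' \<and> set r' \<subseteq> {p, q, c} \<union> set (a # t))" using seg[OF r1(2)] by blast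
      have w2: "ceq ws ((D0 @ E0 @ c # D1 @ E1 @ [c]) @ D2 @ E2 @ r2)"
        using ceq_extend[of ws "D0 @ E0 @ c # D1 @ E1 @ [c]" r1'] w1 2(1) r1 by simp
      have ok2: "ok (us @ p # q # p # q # E1 @ c # D2 @ E2 @ r2)"
        using ceq_ok[OF _ us] ceq_extend[OF ceq_refl, of r1' "D2 @ E2 @ r2" "us @ p # q # p # q # E1 @ [c]"] 2(1) r1 by simp
      \<comment> \<open>Otherwise \<open>D2\<close> consists of letters \<open>p\<close> that
        commute away, leaving a right-arm word enclosed by two \<open>c\<close>; and a last segment
        must contain \<open>q\<close> anyway.\<close>
      have "q \<in> set D2"
      proof (rule ccontr)
        assume q: "q \<notin> set D2"
        show False
        proof (cases r2)
          case Nil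
          then have "q \<in> set (D2 @ E2)"
            by (intro rdesc_segment[of ws q "D0 @ E0 @ c # D1 @ E1" c]) (use desc w2 qa in auto)
          then show False using q 2(3) ne by auto
        next
          case (Cons x r2')
          then have r2: "r2 = c # r2'" using 2(4) by auto
          have c1: "com (set D2) (set (E2 @ [c]))" using q 2(2,3) com by (auto simp: com_def)
          have "ok (us @ p # q # p # q # E1 @ c # E2 @ [c])"
            by (rule drop_right[OF ok2 _ c1, of "us @ p # q # p # q # E1 @ [c]" r2']) (simp_all add: r2)
          then show False
            using tail_not_between[OF t com(1) m(2) 2(3), of _ "us @ p # q # p # q # E1" "[]"] by simp
        qed
      qed
      then obtain x D2' where D2: "D2 = x # D2'" by (cases D2) auto
      consider "x = q" | "x = p" using D2 2(2) by auto
      then show ?thesis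
      proof cases
        case 1
        have "com {q} (set E1)" using com(2) E1 by (auto simp: com_def)
        then show ?thesis
          using no_cac[OF ok2, of "us @ [p, q, p]" q E1 c "[]" "D2' @ E2 @ r2"] D2 1 m by simp
      next
        case 2
        \<comment> \<open>Pulling this \<open>p\<close> back over \<open>c\<close> and
          \<open>E1\<close> completes the braid \<open>p q p q p\<close>.\<close>
        have c1: "com (set (E1 @ [c])) (set [p])" using com E1 by (auto simp: com_def)
        have "ok (us @ p # q # p # q # p # E1 @ c # D2' @ E2 @ r2)"
          by (rule ok_move[OF ok2 _ c1, of "us @ [p, q, p, q]" "D2' @ E2 @ r2"]) (simp_all add: D2 2)
        from no_braid_5[OF m5 pq(1) this, of us "E1 @ c # D2' @ E2 @ r2"] show ?thesis by simp
      qed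
    qed
  qed
qed

text \<open>The heavy edge joins \<open>q\<close> and \<open>c\<close>, so \<open>q c q\<close> is
  allowed. Two segments leave just one extra word; with three or more, \<open>a\<close> would lie in
  three consecutive segments, against \<open>tail_thrice\<close>.\<close>

lemma second_edge_heavy:
  assumes ws: "ok ws" "set ws \<subseteq> {p, q, c} \<union> set (a # t)"
    and com: "com {c} (set t)" "com {p, q} (set (a # t))" "com {p} {c}"
    and m: "M p q = 3" "M q c = 4" "M c a = 3" and t: "simple_tail (a # t)"
    and desc: "\<And>x. ldesc ws x \<longleftrightarrow> x \<in> {q, a}" "\<And>x. rdesc ws x \<longleftrightarrow> x \<in> {q, a}"
  shows "ceq ws [q, a] \<or> (\<exists>b t'. t = b # t' \<and> ceq ws [q, a, c, q, b, a])"
proof -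
  have m': "M a c = 3" "M c q = 4" "M q p = 3" "M c p = 2" using m com(3) M_sym by (metis com_single)+
  have pq: "p \<noteq> q" "q \<noteq> p" using m M_self by auto
  have ne: "c \<notin> {p, q}" "c \<noteq> a" "c \<notin> set t" "p \<notin> set (a # t)" "q \<notin> set (a # t)" "p \<noteq> a" "q \<noteq> a"
    using m m' M_self[of c] com_not_mem[OF com(1), of c] com_not_mem[OF com(2)] by auto
  \<comment> \<open>The left arm is itself an arm of weight 3, so \<open>q\<close> occurs at most
    once in each segment.\<close>
  have tq: "simple_tail (q # [p])" using m' by (simp add: com_def)
  have seg: "\<exists>D E r. ceq xs (D @ E @ r) \<and> set D \<subseteq> {p, q} \<and> set E \<subseteq> set (a # t) \<and>
      (r = [] \<or> (\<exists>r'. r = c # r' \<and> set r' \<subseteq> {p, q, c} \<union> set (a # t)))"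
    if xs: "set xs \<subseteq> {p, q, c} \<union> set (a # t)" for xs
  proof -
    obtain D E r where "ceq xs (D @ E @ r)" "set D \<subseteq> {p, q}" "set E \<subseteq> set (a # t)" "r = [] \<or> (\<exists>r'. r = c # r' \<and> set r' \<subseteq> set xs)"
      by (rule segment[of xs c "{p, q}" "set (a # t)"]) (use xs com ne in auto)
    then show ?thesis using xs by blast
  qed
  have qa: "M q c \<noteq> 2" "q \<noteq> c" "M a c \<noteq> 2" "a \<noteq> c" using m m' ne by auto
  have q_once: "\<exists>U V. D = U @ q # V \<and> set U \<subseteq> {p} \<and> set V \<subseteq> {p}" if D: "ok D" "set D \<subseteq> {p, q}" "q \<in> set D" for D
  proof -
    obtain U V where "D = U @ q # V" "set U \<subseteq> set [p]" "set V \<subseteq> set [p]"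
      by (rule tail_once[OF tq D(1)]) (use D in auto)
    then show ?thesis by auto
  qed
  \<comment> \<open>Without \<open>q\<close> the left letters of an inner segment commute away, and
    a tail word would be enclosed by two \<open>c\<close>.\<close>
  have qseg: "q \<in> set D" if "ok xs" "xs = us @ c # D @ E @ c # vs" "set D \<subseteq> {p, q}" "set E \<subseteq> set (a # t)" for xs us D E vs
  proof (rule ccontr)
    assume "q \<notin> set D"
    then have c1: "com (set D) (set (E @ [c]))" using that com by (auto simp: com_def)
    have "ok (us @ c # E @ [c])"
      by (rule drop_right[OF that(1) _ c1, of "us @ [c]" vs]) (use that in auto)
    then show False using tail_not_between[OF t com(1) m(3) that(4), of _ us "[]"] by simp
  qed
  have qcqc: False if "ok xs" "xs = us @ q # c # q # c # vs \<or> xs = us @ c # q # c # q # vs" for xs us vs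
    using that(2) by (elim disjE) (use no_braid_4[OF m(2) qa(2) that(1)] no_braid_4[OF m'(2) _ that(1)] qa in blast)+
  \<comment> \<open>If \<open>a\<close> is missing in the middle of three segments that contain
    \<open>q\<close>, what remains is \<open>q c (L @ Y) q (Y' @ V) c q\<close> with only
    \<open>p\<close> inside the brackets.\<close>
  have amid: "a \<in> set E1"
    if p: "ok xs" "xs = us @ D0 @ E0 @ c # D1 @ E1 @ c # D2 @ vs"
      and D: "set D0 \<subseteq> {p, q}" "set D1 \<subseteq> {p, q}" "set D2 \<subseteq> {p, q}" "q \<in> set D0" "q \<in> set D1" "q \<in> set D2"
      and E: "set E0 \<subseteq> set (a # t)" "set E1 \<subseteq> set (a # t)" for xs us D0 E0 D1 E1 D2 vs
  proof (rule ccontr)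
    assume "a \<notin> set E1"
    then have E1: "set E1 \<subseteq> set t" using E by auto
    from split_list_last[OF D(4)] obtain Z L where 0: "D0 = Z @ q # L" "q \<notin> set L" by blast
    have "ok D1" using ok_factor[OF p(1), of "us @ D0 @ E0 @ [c]" D1] p(2) by simp
    then obtain Y Y' where 1: "D1 = Y @ q # Y'" "set Y \<subseteq> {p}" "set Y' \<subseteq> {p}" using q_once D by blast
    from split_list_first[OF D(6)] obtain V V' where 2: "D2 = V @ q # V'" "q \<notin> set V" by blast
    have sub: "set L \<subseteq> {p}" "set V \<subseteq> {p}" using 0 2 D by auto
    have c1: "com (set (q # L)) (set E0)" by (rule com_mono[OF com(2)]) (use sub E(1) in auto)
    have c2: "com (set E1) (set (c # V @ [q]))" using com E1 sub by (auto simp: com_def)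
    have "ok (q # L @ c # Y @ q # Y' @ E1 @ c # V @ q # V' @ vs)"
      by (rule drop_left[OF p(1) _ c1, of "us @ Z" "c # Y @ q # Y' @ E1 @ c # V @ q # V' @ vs"])
        (simp_all add: p(2) 0 1 2)
    then have okA: "ok (q # L @ c # Y @ q # Y' @ c # V @ [q])"
      by (rule drop_right[OF _ _ c2, of _ "q # L @ c # Y @ q # Y'" "V' @ vs"]) simp_all
    have cp: "com (set L) {c}" "com (set Y') {c}" "com {c} (set V)" "com (set Y) {c}"
      using 1 sub com by (auto simp: com_def)
    have "ok (q # c # L @ Y @ q # Y' @ c # V @ [q])"
      by (rule ok_move[OF okA, of "[q]" L "[c]" "Y @ q # Y' @ c # V @ [q]"]) (use cp in auto)
    then have okB: "ok (q # c # (L @ Y) @ q # (Y' @ V) @ c # [q])"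
      by (rule ok_move[of _ "q # c # L @ Y @ q # Y'" "[c]" V "[q]"]) (use cp in auto)
    have LY: "set (L @ Y) \<subseteq> {p}" "set (Y' @ V) \<subseteq> {p}" using sub 1 by auto
    have c3: "com (set (Y' @ V)) {c}" "com {c} (set (L @ Y))" using LY com by (auto simp: com_def)
    show False
    \<comment> \<open>An empty left bracket gives \<open>q c q c\<close>, an empty right one
      \<open>c q c q\<close>, and otherwise \<open>p q p\<close> appears.\<close>
    proof (cases "L @ Y = []")
      case True
      have "ok (q # c # (L @ Y) @ q # c # (Y' @ V) @ [q])"
        by (rule ok_move[OF okB, of "q # c # (L @ Y) @ [q]" "Y' @ V" "[c]" "[q]"]) (use c3 in auto)
      from qcqc[OF this, of "[]" "(Y' @ V) @ [q]"] show False using True by simp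
    next
      case False
      then obtain W where W: "L @ Y = W @ [p]" using LY(1) by (cases "L @ Y" rule: rev_cases) auto
      show False
      proof (cases "Y' @ V")
        case Nil
        have "ok (q # (L @ Y) @ c # q # (Y' @ V) @ c # [q])"
          by (rule ok_move[OF okB, of "[q]" "[c]" "L @ Y" "q # (Y' @ V) @ c # [q]"]) (use c3 in auto)
        from qcqc[OF this, of "q # (L @ Y)" "[]"] show False using Nil by simp
      next
        case (Cons x W')
        then have "x = p" using LY(2) by simp
        then have "ok (q # c # W @ p # q # p # W' @ c # [q])" using okB W Cons by simp
        then show False using no_cac[of _ "q # c # W" p "[]" q "[]" "W' @ c # [q]"] m by (simp add: com_def)
      qed
    qed
  qed
  obtain D0 E0 r0 where 0: "ceq ws (D0 @ E0 @ r0)" "set D0 \<subseteq> {p, q}" "set E0 \<subseteq> set (a # t)"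
    "r0 = [] \<or> (\<exists>r'. r0 = c # r' \<and> set r' \<subseteq> {p, q, c} \<union> set (a # t))" using seg[OF ws(2)] by blast
  have "x \<in> set (D0 @ E0)" if "x \<in> {q, a}" for x
    by (rule ldesc_segment[of ws x "D0 @ E0" r0 c]) (use that desc 0 qa in auto)
  then have qa0: "q \<in> set D0" "a \<in> set E0" using 0 ne by auto
  have ok0: "ok (D0 @ E0 @ r0)" using ceq_ok[OF 0(1) ws(1)] .
  have okD0: "ok D0" and okE0: "ok E0"
    using ok_factor[OF ok0, of "[]" D0 "E0 @ r0"] ok_factor[OF ok0, of D0 E0 r0] by simp_all
  have comDE: "com (set D) (set E)" if "set D \<subseteq> {p, q}" "set E \<subseteq> set (a # t)" for D E
    using com_mono[OF com(2)] that by blast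
  have lD0: "x = q" if "ldesc D0 x" for x
    using desc(1)[of x] ceq_ldesc[OF 0(1), of x] ldesc_append[of D0 "E0 @ r0" x] that ldesc_set[OF that] 0(2) ne by auto
  have lE0: "x = a" if "ldesc E0 x" for x
  proof -
    have "x \<in> set (a # t)" using ldesc_set[OF that] 0(3) by auto
    then have "ldesc (D0 @ E0 @ r0) x"
      by (intro ldesc_middle that) (use com_sym[OF comDE[OF 0(2), of "[x]"]] in auto)
    then show ?thesis using desc(1)[of x] ceq_ldesc[OF 0(1), of x] \<open>x \<in> set (a # t)\<close> ne by auto
  qed
  obtain U0 L0 where D0: "D0 = U0 @ q # L0" "set U0 \<subseteq> {p}" "set L0 \<subseteq> {p}" using q_once[OF okD0 0(2) qa0(1)] by blast
  have "U0 = []" using D0 lD0 pq by (cases U0) auto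
  then have D0: "D0 = q # L0" "set L0 \<subseteq> {p}" using D0 by auto
  obtain N0 K0 where E0: "E0 = N0 @ a # K0" "set N0 \<subseteq> set t" "set K0 \<subseteq> set t" by (rule tail_once[OF t okE0 0(3) qa0(2)])
  have at: "a \<notin> set t" using t M_self[of a] by (cases t) (auto simp: com_def)
  have "N0 = []" using E0 lE0 at by (cases N0) auto
  then have E0: "E0 = a # K0" "set K0 \<subseteq> set t" using E0 by auto
  have cact: "com {a} {q, p}" "com {q} (set (a # t))" using com(2) by (auto simp: com_def)
  from 0(4) consider "r0 = []" | r0' where "r0 = c # r0'" "set r0' \<subseteq> {p, q, c} \<union> set (a # t)" by blast
  then show ?thesis
  proof cases
    case 1
    have rD0: "x = q" if "rdesc D0 x" for x
    proof -
      have "x \<in> {p, q}" using rdesc_set[OF that] 0(2) by auto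
      then have "com {x} (set (E0 @ r0))" using comDE[OF _ 0(3), of "[x]"] 1 by auto
      then have "rdesc (D0 @ E0 @ r0) x" using that by (simp add: rdesc_append[of D0])
      then show ?thesis using desc(2)[of x] ceq_rdesc[OF 0(1), of x] \<open>x \<in> {p, q}\<close> ne by auto
    qed
    have rE0: "x = a" if "rdesc E0 x" for x
    proof -
      have "rdesc (D0 @ E0 @ r0) x" using rdesc_middle[OF that, of r0 D0] 1 by (simp add: com_def)
      then show ?thesis using desc(2)[of x] ceq_rdesc[OF 0(1), of x] rdesc_set[OF that] 0(3) ne by auto
    qed
    have "E0 = [a]" by (rule tail_single[OF t okE0 0(3) _ lE0 rE0]) (use E0 in auto)
    moreover have "D0 = [q]" by (rule tail_single[OF tq okD0 _ _ lD0 rD0]) (use 0(2) D0 in auto)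
    ultimately show ?thesis using 0(1) 1 by simp
  next
    case 2
    obtain D1 E1 r1 where 1: "ceq r0' (D1 @ E1 @ r1)" "set D1 \<subseteq> {p, q}" "set E1 \<subseteq> set (a # t)"
      "r1 = [] \<or> (\<exists>r'. r1 = c # r' \<and> set r' \<subseteq> {p, q, c} \<union> set (a # t))" using seg[OF 2(2)] by blast
    have w1: "ceq ws ((D0 @ E0 @ [c]) @ D1 @ E1 @ r1)"
      using ceq_extend[of ws "D0 @ E0 @ [c]" r0'] 0(1) 1(1) 2(1) by simp
    have ok1: "ok (D0 @ E0 @ c # D1 @ E1 @ r1)" using ceq_ok[OF w1 ws(1)] by simp
    have okD1: "ok D1" and okE1: "ok E1"
      using ok_factor[OF ok1, of "D0 @ E0 @ [c]" D1] ok_factor[OF ok1, of "D0 @ E0 @ c # D1" E1] by simp_all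
    from 1(4) consider (last) "r1 = []" | (inner) r1' where "r1 = c # r1'" "set r1' \<subseteq> {p, q, c} \<union> set (a # t)" by blast
    then show ?thesis
    proof cases
      case last
      have "x \<in> set (D1 @ E1)" if "x \<in> {q, a}" for x
        by (rule rdesc_segment[of ws x "D0 @ E0" c]) (use that desc w1 qa last in auto)
      then have qa1: "q \<in> set D1" "a \<in> set E1" using 1 ne by auto
      have rE1: "x = a" if "rdesc E1 x" for x
        using desc(2)[of x] ceq_rdesc[OF w1, of x] rdesc_middle[OF that, of "[]" "D0 @ E0 @ c # D1"] that
          rdesc_set[OF that] 1(3) ne last by (auto simp: com_def)
      have rD1: "x = q" if "rdesc D1 x" for x
      proof -
        have x: "x \<in> {p, q}" using rdesc_set[OF that] 1(2) by auto
        then have "com {x} (set E1)" using comDE[OF _ 1(3), of "[x]"] by auto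
        then have "rdesc ((D0 @ E0 @ [c]) @ D1 @ E1 @ r1) x" using rdesc_middle[OF that, of "E1 @ r1" "D0 @ E0 @ [c]"] last by simp
        then show ?thesis using desc(2)[of x] ceq_rdesc[OF w1, of x] x ne by auto
      qed
      obtain Y Y' where D1: "D1 = Y @ q # Y'" "set Y \<subseteq> {p}" "set Y' \<subseteq> {p}" using q_once[OF okD1 1(2) qa1(1)] by blast
      have "Y' = []"
      proof (rule ccontr)
        assume "Y' \<noteq> []"
        then obtain W y where W: "Y' = W @ [y]" by (meson rev_exhaust)
        then have "rdesc D1 y" using D1 by (simp add: rdesc_append rdesc_Cons)
        then show False using rD1[of y] D1(3) W pq by auto
      qed
      then have D1: "D1 = Y @ [q]" "set Y \<subseteq> {p}" using D1 by auto
      obtain V V' where E1: "E1 = V @ a # V'" "set V \<subseteq> set t" "set V' \<subseteq> set t" by (rule tail_once[OF t okE1 1(3) qa1(2)])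
      have "V' = []"
      proof (rule ccontr)
        assume "V' \<noteq> []"
        then obtain W y where W: "V' = W @ [y]" by (meson rev_exhaust)
        then have "rdesc E1 y" using E1 by (simp add: rdesc_append rdesc_Cons)
        then show False using rE1[of y] E1(3) W at by auto
      qed
      then have E1: "E1 = V @ [a]" "set V \<subseteq> set t" using E1 by auto
      have ok1': "ok (q # L0 @ a # K0 @ c # Y @ q # V @ [a])" using ok1 D0 E0 D1 E1 last by simp
      have "K0 @ V \<noteq> []"
      proof
        assume "K0 @ V = []"
        then show False
          by (intro no_cac[OF ok1', of "q # L0" a "[]" c "Y @ [q]" "[]"]) (use D1 cact m' in \<open>auto simp: com_def\<close>)
      qed
      then obtain b' where b': "b' \<in> set (K0 @ V)" using ex_in_conv[of "set (K0 @ V)"] by auto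
      \<comment> \<open>A \<open>p\<close> in this gap, the letter \<open>b'\<close> in the gap of
        \<open>a\<close>, and \<open>c\<close> would be a commuting triple.\<close>
      have "L0 @ Y = []"
      proof (rule ccontr)
        assume n: "L0 @ Y \<noteq> []"
        have "set (L0 @ Y) \<subseteq> {p}" using D0(2) D1(2) by simp
        then have "p \<in> set (L0 @ Y)" using n by (cases "L0 @ Y") auto
        have c1: "com (set L0) {a}" using D0(2) com(2) by (auto simp: com_def)
        have c2: "com {q} (set V)" using E1 com(2) by (auto simp: com_def)
        have "ok (q # a # L0 @ K0 @ c # Y @ q # V @ [a])"
          by (rule ok_move[OF ok1', of "[q]" L0 "[a]" "K0 @ c # Y @ q # V @ [a]"]) (use c1 in auto)
        then have okT: "ok (q # a # L0 @ K0 @ c # Y @ V @ q # [a])"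
          by (rule ok_move[of _ "q # a # L0 @ K0 @ c # Y" "[q]" V "[a]"]) (use c2 in auto)
        show False
          by (rule no_triple[OF okT, of "[q, a]" L0 K0 c Y V "[q, a]" p b'])
            (use \<open>p \<in> set (L0 @ Y)\<close> b' D0(2) D1(2) E0(2) E1(2) com in \<open>auto simp: com_def\<close>)
      qed
      then have e: "L0 = []" "Y = []" by auto
      have c3: "com (set K0) (set [c, q])" using E0(2) com by (auto simp: com_def)
      have "ceq ([q, a] @ K0 @ [c, q] @ V @ [a]) ([q, a] @ [c, q] @ K0 @ V @ [a])"
        using ceq_move[OF c3, of "[q, a]" "V @ [a]"] .
      then have w3: "ceq ws (q # a # c # q # (K0 @ V) @ [a])"
        using ceq_trans w1 D0 E0 D1 E1 e last by simp
      have ok3: "ok (q # a # c # q # (K0 @ V) @ [a])" using ceq_ok[OF w3 ws(1)] .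
      obtain b t' where t': "t = b # t'" using b' E0(2) E1(2) by (cases t) auto
      have bt: "simple_tail (b # t')" "com {a} (set t')" "M a b = 3" using t t' by (cases t'; auto simp: com_def)+
      have sKV: "set (K0 @ V) \<subseteq> set (b # t')" using E0(2) E1(2) t' by auto
      have "b \<in> set (K0 @ V)"
      proof (rule ccontr)
        assume "b \<notin> set (K0 @ V)"
        then have "com {a} (set (q # K0 @ V))" using sKV bt cact by (auto simp: com_def)
        then show False using no_cac[OF ok3, of "[q]" a "[]" c "q # K0 @ V" "[]"] m' by simp
      qed
      moreover have "ok (K0 @ V)" using ok_factor[OF ok3, of "[q, a, c, q]" "K0 @ V" "[a]"] by simp
      ultimately obtain C D where CD: "K0 @ V = C @ b # D" "set C \<subseteq> set t'" "set D \<subseteq> set t'"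
        using tail_once[OF bt(1) _ sKV] by metis
      have w4: "ceq ws (q # a # c # q # C @ b # D @ [a])" using w3 CD(1) by simp
      have t'ne: "x \<noteq> q" "x \<noteq> a" "M x q = 2" "M x a = 2" "M x c = 2" if "x \<in> set t'" for x
        using that t' ne at com bt by (auto simp: com_def)
      \<comment> \<open>The letters of \<open>t'\<close> commute with everything in the word except
        \<open>b\<close> and other tail letters, so the first letter of \<open>C\<close> would be a
        left descent outside \<open>{q, a}\<close>. On the right the same holds for
        \<open>D\<close>.\<close>
      have "C = []"
      proof (rule ccontr)
        assume "C \<noteq> []"
        then obtain x C' where C: "C = x # C'" by (cases C) auto
        then have x: "x \<in> set t'" using CD by simp
        have "ldesc (q # a # c # q # C @ b # D @ [a]) x" using t'ne[OF x] C by simp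
        then show False using desc(1)[of x] ceq_ldesc[OF w4] t'ne[OF x] by simp
      qed
      moreover have "D = []"
      proof (rule ccontr)
        assume "D \<noteq> []"
        then obtain x D' where D: "D = D' @ [x]" by (meson rev_exhaust)
        then have x: "x \<in> set t'" using CD by simp
        have "rdesc (q # a # c # q # C @ b # D @ [a]) x" using t'ne[OF x] D by (simp add: rdesc_append rdesc_Cons)
        then show False using desc(2)[of x] ceq_rdesc[OF w4] t'ne[OF x] by simp
      qed
      ultimately show ?thesis using w4 t' by simp
    next
      case inner
      have q1: "q \<in> set D1" using qseg[OF ok1, of "D0 @ E0" D1 E1 r1'] 1 inner by simp
      obtain D2 E2 r2 where 2: "ceq r1' (D2 @ E2 @ r2)" "set D2 \<subseteq> {p, q}" "set E2 \<subseteq> set (a # t)"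
        "r2 = [] \<or> (\<exists>r'. r2 = c # r' \<and> set r' \<subseteq> {p, q, c} \<union> set (a # t))" using seg[OF inner(2)] by blast
      have w2: "ceq ws ((D0 @ E0 @ c # D1 @ E1 @ [c]) @ D2 @ E2 @ r2)"
        using ceq_extend[of ws "D0 @ E0 @ c # D1 @ E1 @ [c]" r1'] w1 2(1) inner by simp
      have ok2: "ok (D0 @ E0 @ c # D1 @ E1 @ c # D2 @ E2 @ r2)" using ceq_ok[OF w2 ws(1)] by simp
      have last2: "q \<in> set D2 \<and> a \<in> set E2" if "r2 = []"
      proof -
        have "x \<in> set (D2 @ E2)" if "x \<in> {q, a}" for x
          by (rule rdesc_segment[of ws x "D0 @ E0 @ c # D1 @ E1" c]) (use that desc w2 qa \<open>r2 = []\<close> in auto)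
        then show ?thesis using 2 ne by auto
      qed
      have q2: "q \<in> set D2" using last2 2 qseg[OF ok2, of "D0 @ E0 @ c # D1 @ E1" D2 E2] by auto
      have a1: "a \<in> set E1"
        by (rule amid[OF ok2, of "[]" D0 E0 D1 E1 D2 "E2 @ r2"]) (use 0 1 2 qa0 q1 q2 in auto)
      \<comment> \<open>If the third segment is not the last, the fourth one contains
        \<open>q\<close>, and \<open>amid\<close> applies to the second, third and fourth.\<close>
      have a2: "a \<in> set E2"
      proof (cases "r2 = []")
        case False
        then obtain r2' where r2: "r2 = c # r2'" "set r2' \<subseteq> {p, q, c} \<union> set (a # t)" using 2(4) by blast
        obtain D3 E3 r3 where 3: "ceq r2' (D3 @ E3 @ r3)" "set D3 \<subseteq> {p, q}" "set E3 \<subseteq> set (a # t)"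
          "r3 = [] \<or> (\<exists>r'. r3 = c # r' \<and> set r' \<subseteq> {p, q, c} \<union> set (a # t))" using seg[OF r2(2)] by blast
        have w3: "ceq ws ((D0 @ E0 @ c # D1 @ E1 @ c # D2 @ E2 @ [c]) @ D3 @ E3 @ r3)"
          using ceq_extend[of ws "D0 @ E0 @ c # D1 @ E1 @ c # D2 @ E2 @ [c]" r2'] w2 3(1) r2 by simp
        have ok3: "ok (D0 @ E0 @ c # D1 @ E1 @ c # D2 @ E2 @ c # D3 @ E3 @ r3)" using ceq_ok[OF w3 ws(1)] by simp
        have "q \<in> set D3"
        proof (cases "r3 = []")
          case True
          have "q \<in> set (D3 @ E3)"
            by (rule rdesc_segment[of ws q "D0 @ E0 @ c # D1 @ E1 @ c # D2 @ E2" c]) (use desc w3 qa True in auto)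
          then show ?thesis using 3(3) ne by auto
        next
          case False
          then show ?thesis using qseg[OF ok3, of "D0 @ E0 @ c # D1 @ E1 @ c # D2 @ E2" D3 E3] 3 by auto
        qed
        then show ?thesis
          by (intro amid[OF ok3, of "D0 @ E0 @ [c]" D1 E1 D2 E2 D3 "E3 @ r3"]) (use 1 2 3 q1 q2 in auto)
      qed (use last2 in blast)
      \<comment> \<open>Here \<open>q\<close> plays the part of \<open>e\<close>, the letter outside
        the tail that lies in the middle segment.\<close>
      show ?thesis
        using tail_thrice[OF t com(1) m'(1), of D1 D2 q E0 E1 E2 _ D0 r2] ok2 0(3) 1(2,3) 2(2,3) qa0 q1 a1 a2
          com_mono[OF com(2), of "set D1 \<union> set D2" "set (a # t)"] by auto
    qed
  qed
qed

section \<open>Three arms meeting in one vertex\<close>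

definition three_arms :: "'l \<Rightarrow> 'l list \<Rightarrow> 'l \<Rightarrow> 'l list \<Rightarrow> 'l \<Rightarrow> 'l \<Rightarrow> bool" where
  "three_arms a s b t v c \<longleftrightarrow> simple_tail (a # s) \<and> simple_tail (b # t) \<and> com {c} (set s) \<and> com {c} (set t) \<and>
     M a c = 3 \<and> M b c = 3 \<and> M v c = 3 \<and> com (set (a # s)) (set (b # t)) \<and> com {v} (set (a # s) \<union> set (b # t))"

lemma three_arms_sym: "three_arms a s b t v c \<Longrightarrow> three_arms b t a s v c"
  by (auto simp: three_arms_def com_def)

text \<open>Everything around \<open>U\<close> commutes with its arm, so the descents of
  \<open>U\<close> are descents of the whole word and \<open>tail_single\<close> applies.\<close>

lemma arm_single:
  assumes ok: "ok ws" "ws = us @ U @ vs" and U: "set U \<subseteq> set (a # s)" and t: "simple_tail (a # s)"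
    and com: "com (set (a # s)) (set us)" "com (set (a # s)) (set vs)"
    and desc: "\<And>x. ldesc ws x \<longleftrightarrow> x \<in> X1" "\<And>x. rdesc ws x \<longleftrightarrow> x \<in> X1" and X1: "X1 \<inter> set (a # s) \<subseteq> {a}"
  shows "U = (if a \<in> X1 then [a] else [])"
proof -
  have cU: "com {x} (set us)" "com {x} (set vs)" if "x \<in> set U" for x using that U com by (auto simp: com_def)
  have l: "x = a \<and> a \<in> X1" if "ldesc U x" for x
    using ldesc_middle[OF that, of us vs] cU ldesc_set[OF that] ok(2) desc(1)[of x] X1 U by auto
  have r: "x = a" if "rdesc U x" for x
    using rdesc_middle[OF that, of vs us] cU rdesc_set[OF that] ok(2) desc(2)[of x] X1 U by auto
  show ?thesis
  proof (cases "U = []")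
    case True
    have "a \<notin> X1"
    proof
      assume "a \<in> X1"
      then have "a \<in> set ws" using desc(1) ldesc_set by blast
      then show False using ok(2) True com M_self[of a] by (auto simp: com_def)
    qed
    then show ?thesis using True by simp
  next
    case False
    have "ok U" using ok_factor[OF ok] .
    then have "U = [a]" using tail_single[OF t _ U False] l r by blast
    then show ?thesis using l[of a] by simp
  qed
qed

context
  fixes a s b t v c
  assumes arms: "three_arms a s b t v c"
begin

lemma arms_simps: "simple_tail (a # s)" "simple_tail (b # t)" "com {c} (set s)" "com {c} (set t)"
  "M a c = 3" "M b c = 3" "M v c = 3" "M c a = 3" "M c b = 3" "M c v = 3"
  "com (set (a # s)) (set (b # t))" "com {v} (set (a # s))" "com {v} (set (b # t))"
proof -
  show "M c a = 3" "M c b = 3" "M c v = 3" using arms M_sym unfolding three_arms_def by metis+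
qed (use arms in \<open>auto simp: three_arms_def com_def\<close>)

lemma arms_distinct: "c \<notin> set (a # s)" "c \<notin> set (b # t)" "c \<noteq> v" "v \<notin> set (a # s)" "v \<notin> set (b # t)"
    "set (a # s) \<inter> set (b # t) = {}"
  using arms_simps M_self[of c] com_not_mem[OF arms_simps(3)] com_not_mem[OF arms_simps(4)]
    com_not_mem[OF arms_simps(11)] com_not_mem[OF arms_simps(12)] com_not_mem[OF arms_simps(13)]
  by auto

abbreviation segs :: "'l list \<Rightarrow> 'l list \<Rightarrow> 'l list \<Rightarrow> bool" where
  "segs U T V \<equiv> set U \<subseteq> set (a # s) \<and> set T \<subseteq> set (b # t) \<and> set V \<subseteq> {v}"

lemma segs_com:
  assumes "segs U T V" "segs U' T' V'"
  shows "com (set U) (set T')" "com (set U) (set V')" "com (set T) (set V')"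
proof -
  show "com (set U) (set T')" by (rule com_mono[OF arms_simps(11)]) (use assms in auto)
  show "com (set U) (set V')" by (rule com_mono[OF com_sym[OF arms_simps(12)]]) (use assms in auto)
  show "com (set T) (set V')" by (rule com_mono[OF com_sym[OF arms_simps(13)]]) (use assms in auto)
qed

lemma arms_segment:
  assumes "set xs \<subseteq> {c, v} \<union> set (a # s) \<union> set (b # t)"
  shows "\<exists>U T V r. ceq xs (U @ T @ V @ r) \<and> segs U T V \<and>
    (r = [] \<or> (\<exists>r'. r = c # r' \<and> set r' \<subseteq> {c, v} \<union> set (a # s) \<union> set (b # t)))"
proof -
  obtain U E r where 1: "ceq xs (U @ E @ r)" "set U \<subseteq> set (a # s)" "set E \<subseteq> insert v (set (b # t))"
    "r = [] \<or> (\<exists>r'. r = c # r' \<and> set r' \<subseteq> set xs)"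
    by (rule segment[of xs c "set (a # s)" "insert v (set (b # t))"])
      (use assms arms_simps arms_distinct in \<open>auto simp: com_def\<close>)
  have E: "x = v" if "x \<in> set E" "x \<notin> set (b # t)" for x using that 1(3) by blast
  have "com {x \<in> set E. x \<in> set (b # t)} {x \<in> set E. x \<notin> set (b # t)}"
    using E arms_simps(13) unfolding com_def by blast
  from ceq_filter[OF this]
  have "ceq E (filter (\<lambda>x. x \<in> set (b # t)) E @ filter (\<lambda>x. x \<notin> set (b # t)) E)" .
  from ceq_context[OF this, of U r]
  have "ceq (U @ E @ r) (U @ filter (\<lambda>x. x \<in> set (b # t)) E @ filter (\<lambda>x. x \<notin> set (b # t)) E @ r)" by simp
  then have "ceq xs (U @ filter (\<lambda>x. x \<in> set (b # t)) E @ filter (\<lambda>x. x \<notin> set (b # t)) E @ r)"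
    using ceq_trans 1(1) by blast
  moreover have "segs U (filter (\<lambda>x. x \<in> set (b # t)) E) (filter (\<lambda>x. x \<notin> set (b # t)) E)"
    using 1(2) E by auto
  ultimately show ?thesis using 1(4) assms by blast
qed

lemma v_segment: "ok ws \<Longrightarrow> ws = us @ V @ vs \<Longrightarrow> set V \<subseteq> {v} \<Longrightarrow> v \<in> set V \<Longrightarrow> V = [v]"
  using one_letter[of V v] ok_factor[of ws us V vs] by auto

text \<open>With at most one neighbour of \<open>c\<close> in an inner segment, the enclosing
  \<open>c\<close> form \<open>c c\<close> or \<open>c x c\<close>.\<close>

lemma two_of_three:
  assumes ok: "ok ws" "ws = us @ c # U @ T @ V @ c # vs" and S: "segs U T V"
  shows "a \<in> set U \<and> b \<in> set T \<or> a \<in> set U \<and> v \<in> set V \<or> b \<in> set T \<and> v \<in> set V"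
proof (rule ccontr)
  assume n: "\<not> ?thesis"
  have okU: "ok U" "ok T" using ok_factor[OF ok(1), of "us @ [c]" U] ok_factor[OF ok(1), of "us @ c # U" T] ok(2) by simp_all
  have cU: "a \<notin> set U \<Longrightarrow> com {c} (set U)" and cT: "b \<notin> set T \<Longrightarrow> com {c} (set T)" and cV: "v \<notin> set V \<Longrightarrow> com {c} (set V)"
    using S arms_simps(3,4) by (auto simp: com_def)
  consider "a \<in> set U" "b \<notin> set T" "v \<notin> set V" | "a \<notin> set U" "b \<in> set T" "v \<notin> set V"
    | "a \<notin> set U" "b \<notin> set T" "v \<in> set V" | "a \<notin> set U" "b \<notin> set T" "v \<notin> set V"
    using n by blast
  then show False
  proof cases
    case 1
    obtain N K where "U = N @ a # K" "set N \<subseteq> set s" "set K \<subseteq> set s"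
      by (rule tail_once[OF arms_simps(1) okU(1) _ 1(1)]) (use S in auto)
    then show False
      by (intro no_cac[OF ok(1), of us c N a "K @ T @ V" vs]) (use ok(2) cT[OF 1(2)] cV[OF 1(3)] arms_simps in \<open>auto simp: com_def\<close>)
  next
    case 2
    obtain N K where "T = N @ b # K" "set N \<subseteq> set t" "set K \<subseteq> set t"
      by (rule tail_once[OF arms_simps(2) okU(2) _ 2(2)]) (use S in auto)
    then show False
      by (intro no_cac[OF ok(1), of us c "U @ N" b "K @ V" vs]) (use ok(2) cU[OF 2(1)] cV[OF 2(3)] arms_simps in \<open>auto simp: com_def\<close>)
  next
    case 3
    have "V = [v]" by (rule v_segment[OF ok(1), of "us @ c # U @ T" _ "c # vs"]) (use ok(2) S 3 in auto)
    then show False using no_cac[OF ok(1), of us c "U @ T" v "[]" vs] ok(2) cU[OF 3(1)] cT[OF 3(2)] arms_simps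
      by (auto simp: com_def)
  next
    case 4
    then show False using no_return[OF ok(1), of us c "U @ T @ V" vs] ok(2) cU cT cV by (auto simp: com_def)
  qed
qed

lemma not_all_three:
  assumes ok: "ok ws" "ws = us @ U @ T @ V @ vs" and S: "segs U T V" and "a \<in> set U" "b \<in> set T" "v \<in> set V"
  shows False
  using pick_triple[OF ok assms(4-6) segs_com(1)[OF S S] segs_com(2)[OF S S] segs_com(3)[OF S S]] .

lemma v_not_twice:
  assumes ok: "ok ws" "ws = us @ V0 @ c # U @ T @ V @ vs" and S: "segs U T V" "set V0 \<subseteq> {v}" and v: "v \<in> set V0" "v \<in> set V"
  shows False
proof -
  have "V0 = [v]" by (rule v_segment[OF ok(1), of us _ "c # U @ T @ V @ vs"]) (use ok(2) S v in auto)
  moreover have "V = [v]" by (rule v_segment[OF ok(1), of "us @ V0 @ c # U @ T" _ vs]) (use ok(2) S v in auto)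
  moreover have "com {v} (set (U @ T))" using S arms_simps(12,13) by (auto simp: com_def)
  ultimately show False using no_cac[OF ok(1), of us v "[]" c "U @ T" vs] ok(2) arms_simps(7) by simp
qed

lemma not_both_twice:
  assumes ok: "ok ws" "ws = us @ U0 @ T0 @ V0 @ c # U1 @ T1 @ vs" and S: "segs U0 T0 V0" "segs U1 T1 V1"
    and a: "a \<in> set U0" "a \<in> set U1" "b \<in> set T0" "b \<in> set T1"
  shows False
  by (rule no_double_overlap[OF ok a(1,2,3,4), of "set s" "set t"]) (use S arms_simps in \<open>auto simp: com_def\<close>)

text \<open>The blocks are reordered to match \<open>tail_thrice\<close>, with the other two arms of
  the middle segment as the block containing \<open>e\<close>.\<close>

lemma a_not_thrice:
  assumes ok: "ok ws" "ws = us @ U0 @ T0 @ V0 @ c # U1 @ T1 @ V1 @ c # U2 @ vs"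
    and S: "segs U0 T0 V0" "segs U1 T1 V1" "set U2 \<subseteq> set (a # s)"
    and a: "a \<in> set U0" "a \<in> set U1" "a \<in> set U2" and e: "e \<in> set T1 \<union> set V1"
  shows False
proof -
  have c1: "com (set U0) (set (T0 @ V0))" "com (set U1) (set (T1 @ V1))"
    using segs_com[OF S(1) S(1)] segs_com[OF S(2) S(2)] by (auto simp: com_def)
  have "ok (us @ T0 @ V0 @ U0 @ c # U1 @ T1 @ V1 @ c # U2 @ vs)"
    by (rule ok_move[OF ok(1) _ c1(1), of us "c # U1 @ T1 @ V1 @ c # U2 @ vs"]) (simp_all add: ok(2))
  then have 1: "ok (us @ T0 @ V0 @ U0 @ c # (T1 @ V1) @ U1 @ c # U2 @ vs)"
    by (rule ok_move[OF _ _ c1(2), of _ "us @ T0 @ V0 @ U0 @ [c]" "c # U2 @ vs"]) simp_all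
  have c2: "com (set (T1 @ V1) \<union> set []) (set (a # s))"
    using S(2) arms_simps(11,12) by (auto simp: com_def)
  show False
    by (rule tail_thrice[OF arms_simps(1,3,5) c2 _ _ _ _ a 1, of e "us @ T0 @ V0" vs]) (use e S in auto)
qed

end

text \<open>The mirror image of \<open>a_not_thrice\<close>; segments list the arm of
  \<open>a\<close> first, so the two arms are swapped inside each segment beforehand.\<close>

lemma b_not_thrice:
  assumes arms: "three_arms a s b t v c"
    and ok: "ok ws" "ws = us @ U0 @ T0 @ V0 @ c # U1 @ T1 @ V1 @ c # U2 @ T2 @ vs"
    and S: "set U0 \<subseteq> set (a # s) \<and> set T0 \<subseteq> set (b # t) \<and> set V0 \<subseteq> {v}"
      "set U1 \<subseteq> set (a # s) \<and> set T1 \<subseteq> set (b # t) \<and> set V1 \<subseteq> {v}"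
      "set U2 \<subseteq> set (a # s)" "set T2 \<subseteq> set (b # t)"
    and b: "b \<in> set T0" "b \<in> set T1" "b \<in> set T2" and e: "e \<in> set U1 \<union> set V1"
  shows False
proof -
  have com: "com (set (a # s)) (set (b # t))" using arms_simps[OF arms] by simp
  have c: "com (set U0) (set T0)" "com (set U1) (set T1)" "com (set U2) (set T2)"
    by (rule com_mono[OF com]; use S in simp)+
  have "ok (us @ T0 @ U0 @ V0 @ c # U1 @ T1 @ V1 @ c # U2 @ T2 @ vs)"
    by (rule ok_move[OF ok(1) _ c(1), of us "V0 @ c # U1 @ T1 @ V1 @ c # U2 @ T2 @ vs"]) (simp_all add: ok(2))
  then have "ok (us @ T0 @ U0 @ V0 @ c # T1 @ U1 @ V1 @ c # U2 @ T2 @ vs)"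
    by (rule ok_move[OF _ _ c(2), of _ "us @ T0 @ U0 @ V0 @ [c]" "V1 @ c # U2 @ T2 @ vs"]) simp_all
  then have 1: "ok (us @ T0 @ U0 @ V0 @ c # T1 @ U1 @ V1 @ c # T2 @ U2 @ vs)"
    by (rule ok_move[OF _ _ c(3), of _ "us @ T0 @ U0 @ V0 @ c # T1 @ U1 @ V1 @ [c]" "vs"]) simp_all
  show False
    by (rule a_not_thrice[OF three_arms_sym[OF arms] 1 refl]) (use S b e in auto)
qed

text \<open>Record which of \<open>a\<close>, \<open>b\<close>, \<open>v\<close> occur in each
  segment. For \<open>Y = {a, v}\<close> the second and third segments must be \<open>{a, b}\<close>
  and \<open>{b, v}\<close>, and nothing can follow. For \<open>Y = {a, b}\<close> the second
  contains \<open>v\<close> and exactly one of \<open>a\<close>, \<open>b\<close>, so a third would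
  have to be \<open>{a, b}\<close>, with that letter occurring three times in a row. No segment
  after the first can be last, since it would have to contain \<open>Y\<close>.\<close>

lemma three_arms_words:
  assumes arms: "three_arms a s b t v c"
    and ws: "ok ws" "set ws \<subseteq> {c, v} \<union> set (a # s) \<union> set (b # t)"
    and desc: "\<And>x. ldesc ws x \<longleftrightarrow> x \<in> Y" "\<And>x. rdesc ws x \<longleftrightarrow> x \<in> Y" and Y: "Y = {a, v} \<or> Y = {a, b}"
  shows "ceq ws [a, if Y = {a, v} then v else b]"
proof -
  note simps = arms_simps[OF arms] and dist = arms_distinct[OF arms]
  have avb: "v \<noteq> a" "v \<noteq> b" "a \<noteq> b" "c \<noteq> a" "c \<noteq> b" using dist by auto
  have Yc: "M y c \<noteq> 2" "y \<noteq> c" if "y \<in> Y" for y using that Y simps dist by auto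
  let ?seg = "\<lambda>U T V. set U \<subseteq> set (a # s) \<and> set T \<subseteq> set (b # t) \<and> set V \<subseteq> {v}"
  let ?rest = "\<lambda>r. r = [] \<or> (\<exists>r'. r = c # r' \<and> set r' \<subseteq> {c, v} \<union> set (a # s) \<union> set (b # t))"
  have inY: "(a \<in> Y \<longrightarrow> a \<in> set U) \<and> (b \<in> Y \<longrightarrow> b \<in> set T) \<and> (v \<in> Y \<longrightarrow> v \<in> set V)"
    if "Y \<subseteq> set (U @ T @ V)" "?seg U T V" for U T V
    using that dist by auto
  have last: "(a \<in> Y \<longrightarrow> a \<in> set U) \<and> (b \<in> Y \<longrightarrow> b \<in> set T) \<and> (v \<in> Y \<longrightarrow> v \<in> set V)"
    if w: "ceq ws (us @ c # U @ T @ V)" and S: "?seg U T V" for us U T V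
  proof (rule inY[OF _ S], rule)
    fix y assume y: "y \<in> Y"
    show "y \<in> set (U @ T @ V)" by (rule rdesc_segment[OF _ w Yc[OF y]]) (use desc y in blast)
  qed
  obtain U0 T0 V0 r0 where 0: "ceq ws (U0 @ T0 @ V0 @ r0)" and S0: "?seg U0 T0 V0" and r0: "?rest r0"
    using arms_segment[OF arms ws(2)] by blast
  have ok0: "ok (U0 @ T0 @ V0 @ r0)" using ceq_ok[OF 0 ws(1)] .
  have Y0: "(a \<in> Y \<longrightarrow> a \<in> set U0) \<and> (b \<in> Y \<longrightarrow> b \<in> set T0) \<and> (v \<in> Y \<longrightarrow> v \<in> set V0)"
  proof (rule inY[OF _ S0], rule)
    fix y assume y: "y \<in> Y"
    show "y \<in> set (U0 @ T0 @ V0)"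
      by (rule ldesc_segment[of ws y _ r0 c]) (use desc y 0 r0 Yc in auto)
  qed
  show ?thesis
  proof (cases "r0 = []")
    case True
    have ok': "ok (U0 @ T0 @ V0)" using ok0 True by simp
    have d: "ldesc (U0 @ T0 @ V0) x \<longleftrightarrow> x \<in> Y" "rdesc (U0 @ T0 @ V0) x \<longleftrightarrow> x \<in> Y" for x
      using desc ceq_ldesc[OF 0] ceq_rdesc[OF 0] True by simp_all
    have cU: "com (set (a # s)) (set (T0 @ V0))" "com (set (b # t)) (set U0)" "com (set (b # t)) (set V0)"
      "com {v} (set (U0 @ T0))"
      using simps(11-13) S0 unfolding com_def by fastforce+
    have "U0 = (if a \<in> Y then [a] else [])"
      by (rule arm_single[OF ok', of "[]" U0 "T0 @ V0" a s Y]) (use S0 simps cU d Y dist in auto)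
    moreover have "T0 = (if b \<in> Y then [b] else [])"
      by (rule arm_single[OF ok', of "U0" T0 "V0" b t Y]) (use S0 simps cU d Y dist in auto)
    moreover have "V0 = (if v \<in> Y then [v] else [])"
      by (rule arm_single[OF ok', of "U0 @ T0" V0 "[]" v "[]" Y]) (use S0 simps cU d Y dist in auto)
    ultimately show ?thesis using 0 True Y avb by auto
  next
    case False
    then obtain r0' where r0': "r0 = c # r0'" "set r0' \<subseteq> {c, v} \<union> set (a # s) \<union> set (b # t)" using r0 by blast
    obtain U1 T1 V1 r1 where 1: "ceq r0' (U1 @ T1 @ V1 @ r1)" and S1: "?seg U1 T1 V1" and r1: "?rest r1"
      using arms_segment[OF arms r0'(2)] by blast
    have w1: "ceq ws (U0 @ T0 @ V0 @ c # U1 @ T1 @ V1 @ r1)"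
      using ceq_extend[of ws "U0 @ T0 @ V0 @ [c]" r0'] 0 1 r0'(1) by simp
    have ok1: "ok (U0 @ T0 @ V0 @ c # U1 @ T1 @ V1 @ r1)" using ceq_ok[OF w1 ws(1)] .
    have vv1: "\<not> (v \<in> set V0 \<and> v \<in> set V1)"
      using v_not_twice[OF arms ok1, of "U0 @ T0" V0 U1 T1 V1 r1] S0 S1 by auto
    have ab1: "\<not> (a \<in> set U0 \<and> a \<in> set U1 \<and> b \<in> set T0 \<and> b \<in> set T1)"
      using not_both_twice[OF arms ok1, of "[]" U0 T0 V0 U1 T1 "V1 @ r1"] S0 S1 by auto
    have "r1 \<noteq> []"
    proof
      assume "r1 = []"
      then have "ceq ws ((U0 @ T0 @ V0) @ c # U1 @ T1 @ V1)" using w1 by simp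
      from last[OF this S1] show False using Y Y0 vv1 ab1 by auto
    qed
    then obtain r1' where r1': "r1 = c # r1'" "set r1' \<subseteq> {c, v} \<union> set (a # s) \<union> set (b # t)" using r1 by blast
    obtain U2 T2 V2 r2 where 2: "ceq r1' (U2 @ T2 @ V2 @ r2)" and S2: "?seg U2 T2 V2" and r2: "?rest r2"
      using arms_segment[OF arms r1'(2)] by blast
    have w2: "ceq ws (U0 @ T0 @ V0 @ c # U1 @ T1 @ V1 @ c # U2 @ T2 @ V2 @ r2)"
      using ceq_extend[of ws "U0 @ T0 @ V0 @ c # U1 @ T1 @ V1 @ [c]" r1'] w1 2 r1'(1) by simp
    have ok2: "ok (U0 @ T0 @ V0 @ c # U1 @ T1 @ V1 @ c # U2 @ T2 @ V2 @ r2)" using ceq_ok[OF w2 ws(1)] .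
    have two1: "a \<in> set U1 \<and> b \<in> set T1 \<or> a \<in> set U1 \<and> v \<in> set V1 \<or> b \<in> set T1 \<and> v \<in> set V1"
      by (rule two_of_three[OF arms ok1, of "U0 @ T0 @ V0" U1 T1 V1 r1']) (use r1' S1 in auto)
    have three1: "\<not> (a \<in> set U1 \<and> b \<in> set T1 \<and> v \<in> set V1)"
      using not_all_three[OF arms ok1, of "U0 @ T0 @ V0 @ [c]" U1 T1 V1 r1] S1 by auto
    have vv2: "\<not> (v \<in> set V1 \<and> v \<in> set V2)"
      using v_not_twice[OF arms ok2, of "U0 @ T0 @ V0 @ c # U1 @ T1" V1 U2 T2 V2 r2] S1 S2 by auto
    have aaa2: "\<not> (a \<in> set U0 \<and> a \<in> set U1 \<and> a \<in> set U2 \<and> (b \<in> set T1 \<or> v \<in> set V1))"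
      using a_not_thrice[OF arms ok2, of "[]" U0 T0 V0 U1 T1 V1 U2 "T2 @ V2 @ r2"] S0 S1 S2 by auto
    have bbb2: "\<not> (b \<in> set T0 \<and> b \<in> set T1 \<and> b \<in> set T2 \<and> (a \<in> set U1 \<or> v \<in> set V1))"
      using b_not_thrice[OF arms ok2, of "[]" U0 T0 V0 U1 T1 V1 U2 T2 "V2 @ r2"] S0 S1 S2 by auto
    have "r2 \<noteq> []"
    proof
      assume "r2 = []"
      then have "ceq ws ((U0 @ T0 @ V0 @ c # U1 @ T1 @ V1) @ c # U2 @ T2 @ V2)" using w2 by simp
      from last[OF this S2] show False using Y Y0 vv1 ab1 vv2 aaa2 bbb2 two1 three1 by auto
    qed
    then obtain r2' where r2': "r2 = c # r2'" "set r2' \<subseteq> {c, v} \<union> set (a # s) \<union> set (b # t)" using r2 by blast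
    have two2: "a \<in> set U2 \<and> b \<in> set T2 \<or> a \<in> set U2 \<and> v \<in> set V2 \<or> b \<in> set T2 \<and> v \<in> set V2"
      by (rule two_of_three[OF arms ok2, of "U0 @ T0 @ V0 @ c # U1 @ T1 @ V1" U2 T2 V2 r2']) (use r2' S2 in auto)
    obtain U3 T3 V3 r3 where 3: "ceq r2' (U3 @ T3 @ V3 @ r3)" and S3: "?seg U3 T3 V3" and r3: "?rest r3"
      using arms_segment[OF arms r2'(2)] by blast
    have w3: "ceq ws (U0 @ T0 @ V0 @ c # U1 @ T1 @ V1 @ c # U2 @ T2 @ V2 @ c # U3 @ T3 @ V3 @ r3)"
      using ceq_extend[of ws "U0 @ T0 @ V0 @ c # U1 @ T1 @ V1 @ c # U2 @ T2 @ V2 @ [c]" r2'] w2 3 r2'(1) by simp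
    have ok3: "ok (U0 @ T0 @ V0 @ c # U1 @ T1 @ V1 @ c # U2 @ T2 @ V2 @ c # U3 @ T3 @ V3 @ r3)"
      using ceq_ok[OF w3 ws(1)] .
    have vv3: "\<not> (v \<in> set V2 \<and> v \<in> set V3)"
      using v_not_twice[OF arms ok3, of "U0 @ T0 @ V0 @ c # U1 @ T1 @ V1 @ c # U2 @ T2" V2 U3 T3 V3 r3] S2 S3 by auto
    have bbb3: "\<not> (b \<in> set T1 \<and> b \<in> set T2 \<and> b \<in> set T3 \<and> (a \<in> set U2 \<or> v \<in> set V2))"
      using b_not_thrice[OF arms ok3, of "U0 @ T0 @ V0 @ [c]" U1 T1 V1 U2 T2 V2 U3 T3 "V3 @ r3"] S1 S2 S3 by auto
    have "r3 \<noteq> []"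
    proof
      assume "r3 = []"
      then have "ceq ws ((U0 @ T0 @ V0 @ c # U1 @ T1 @ V1 @ c # U2 @ T2 @ V2) @ c # U3 @ T3 @ V3)" using w3 by simp
      from last[OF this S3] show False using Y Y0 vv1 ab1 vv2 aaa2 bbb2 two1 three1 two2 vv3 bbb3 by auto
    qed
    then obtain r3' where r3': "r3 = c # r3'" using r3 by blast
    have two3: "a \<in> set U3 \<and> b \<in> set T3 \<or> a \<in> set U3 \<and> v \<in> set V3 \<or> b \<in> set T3 \<and> v \<in> set V3"
      by (rule two_of_three[OF arms ok3, of "U0 @ T0 @ V0 @ c # U1 @ T1 @ V1 @ c # U2 @ T2 @ V2" U3 T3 V3 r3'])
        (use r3' S3 in auto)
    \<comment> \<open>Four segments suffice: the recorded memberships are already propositionally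
      inconsistent.\<close>
    show ?thesis using Y Y0 vv1 ab1 vv2 aaa2 bbb2 two1 three1 two2 vv3 bbb3 two3 by auto
  qed
qed

section \<open>Intervals of labels as tails\<close>

lemma simple_tail_upt:
  assumes "\<And>i. k \<le> i \<Longrightarrow> Suc i < h \<Longrightarrow> M (f i) (f (Suc i)) = 3"
    and "\<And>i j. k \<le> i \<Longrightarrow> Suc i < j \<Longrightarrow> j < h \<Longrightarrow> M (f i) (f j) = 2"
  shows "simple_tail (map f [k..<h])"
  using assms
proof (induction "h - k" arbitrary: k)
  case (Suc d)
  have 1: "[k..<h] = k # [Suc k..<h]" using Suc.hyps(2) by (simp add: upt_conv_Cons)
  have IH: "simple_tail (map f [Suc k..<h])" by (rule Suc.hyps(1)) (use Suc in auto)
  show ?case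
  proof (cases "Suc k < h")
    case True
    then have 2: "[Suc k..<h] = Suc k # [Suc (Suc k)..<h]" by (simp add: upt_conv_Cons)
    have "com {f k} (set (map f [Suc (Suc k)..<h]))"
      using Suc.prems(2)[of k] M_sym[of "f k"] by (auto simp: com_def)
    then show ?thesis unfolding 1 2 using IH Suc.prems(1)[of k] True 2 by simp
  qed (simp add: 1)
qed simp

lemma double_tail_upt:
  assumes "k < h" "\<And>i. k \<le> i \<Longrightarrow> Suc (Suc i) < h \<Longrightarrow> M (f i) (f (Suc i)) = 3"
    and "\<And>i. k \<le> i \<Longrightarrow> Suc (Suc i) = h \<Longrightarrow> M (f i) (f (Suc i)) = 4"
    and "\<And>i j. k \<le> i \<Longrightarrow> Suc i < j \<Longrightarrow> j < h \<Longrightarrow> M (f i) (f j) = 2"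
  shows "double_tail (map f [k..<h])"
  using assms
proof (induction "h - k" arbitrary: k)
  case (Suc d)
  have 1: "[k..<h] = k # [Suc k..<h]" using Suc.hyps(2) by (simp add: upt_conv_Cons)
  consider "Suc k = h" | "Suc (Suc k) = h" | "Suc (Suc k) < h" using Suc.prems(1) by linarith
  then show ?case
  proof cases
    case 1
    then have "[k..<h] = [k]" using upt_conv_Cons[of k h] by simp
    then show ?thesis by simp
  next
    case 2
    then have "[k..<h] = [k, Suc k]" using upt_conv_Cons[of k h] upt_conv_Cons[of "Suc k" h] by simp
    then show ?thesis using Suc.prems(3)[of k] 2 by simp
  next
    case 3
    then have 2: "[Suc k..<h] = Suc k # Suc (Suc k) # [Suc (Suc (Suc k))..<h]" by (simp add: upt_conv_Cons)
    have IH: "double_tail (map f [Suc k..<h])" by (rule Suc.hyps(1)) (use Suc 3 in auto)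
    have "com {f k} (set (map f [Suc (Suc k)..<h]))"
      using Suc.prems(4)[of k] M_sym[of "f k"] by (auto simp: com_def)
    moreover have "set (map f [Suc (Suc k)..<h]) = set (f (Suc (Suc k)) # map f [Suc (Suc (Suc k))..<h])"
      using 3 by (simp add: upt_conv_Cons)
    ultimately show ?thesis using IH Suc.prems(2)[of k] 3 unfolding 1 2 by simp
  qed
qed simp

lemma updown_snoc: "updown (xs @ [y]) = xs @ [y] @ rev xs"
proof (induction xs)
  case (Cons x xs)
  then show ?case by (cases "xs @ [y]") auto
qed simp

lemma double_left_arm_simple:
  assumes ws: "ok ws" "set ws \<subseteq> {p, q, c} \<union> set (a # t)"
    and com: "com {c} (set t)" "com {p, q} (set (a # t))" "com {p} {c}"
    and m: "M q c = 3" "M c a = 3" "M p q = 4 \<or> M p q = 5" and t: "simple_tail (a # t)"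
    and desc: "\<And>x. ldesc ws x \<longleftrightarrow> x \<in> {q, a}" "\<And>x. rdesc ws x \<longleftrightarrow> x \<in> {q, a}"
  shows "ceq ws [q, a] \<or> ceq ws [q, p, q, a]"
proof -
  have m': "M p q = 4 \<or> M p q = 5 \<and> simple_tail (a # t)" using m t by blast
  have "\<exists>D\<in>{[q], [q, p, q]}. \<exists>E\<in>{[a]}. ceq ws (D @ E)"
  proof (rule double_left_arm[OF ws com m(1,2) m' _ _ desc])
    show False if "ok ws'" "ws' = us @ a # U @ c # E @ c # vs" "set U \<subseteq> set t" "set E \<subseteq> set (a # t)" for U E us vs ws'
      by (rule tail_not_between[OF t com(1) m(2) that(4,1), of "us @ a # U" vs]) (use that(2) in simp)
    show "\<exists>E'\<in>{[a]}. ceq E E'" if "ok E" "set E \<subseteq> set (a # t)" "E \<noteq> []"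
      "\<And>x. ldesc E x \<Longrightarrow> x = a" "\<And>x. rdesc E x \<Longrightarrow> x = a" for E
      using tail_single[OF t that] ceq_refl[of "[a]"] by simp
  qed
  then show ?thesis by auto
qed

lemma double_left_arm_double:
  assumes ws: "ok ws" "set ws \<subseteq> {p, q, c} \<union> set (a # t)"
    and com: "com {c} (set t)" "com {p, q} (set (a # t))" "com {p} {c}"
    and m: "M q c = 3" "M a c = 3" "M p q = 4" and t: "double_tail (a # t)"
    and desc: "\<And>x. ldesc ws x \<longleftrightarrow> x \<in> {q, a}" "\<And>x. rdesc ws x \<longleftrightarrow> x \<in> {q, a}"
  shows "\<exists>D\<in>{[q], [q, p, q]}. \<exists>E\<in>{[a], updown (a # t)}. ceq ws (D @ E)"
proof -
  have m': "M c a = 3" "M p q = 4 \<or> M p q = 5 \<and> simple_tail (a # t)" using m M_sym[of c a] by simp_all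
  show ?thesis
  proof (rule double_left_arm[OF ws com m(1) m' _ _ desc])
    show False if "ok ws'" "ws' = us @ a # U @ c # E @ c # vs" "set U \<subseteq> set t" "set E \<subseteq> set (a # t)" for U E us vs ws'
      by (rule double_tail_not_between[OF t com(1) m(2) that(3,4,1,2)])
    show "\<exists>E'\<in>{[a], updown (a # t)}. ceq E E'" if "ok E" "set E \<subseteq> set (a # t)" "E \<noteq> []"
      "\<And>x. ldesc E x \<Longrightarrow> x = a" "\<And>x. rdesc E x \<Longrightarrow> x = a" for E
      using double_tail_words[OF t that] by blast
  qed
qed

end

section \<open>From label words back to group elements\<close>

lemma map_alternating: "map f (alternating k s t) = alternating k (f s) (f t)"
  by (induction k arbitrary: s t) auto

context coxeter
begin

text \<open>A forbidden reduced word for the factor could be substituted inside the large word,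
  keeping its length and its product.\<close>

lemma thin_factor:
  assumes "reduced (xs @ ys @ zs)" "thin (wp (xs @ ys @ zs))" shows "thin (wp ys)"
  unfolding thin_def
proof (intro allI impI)
  fix xs' c ys' assume r: "reduced (xs' @ c @ ys')" "wp (xs' @ c @ ys') = wp ys"
  have S: "set xs \<subseteq> S" "set ys \<subseteq> S" "set zs \<subseteq> S" "set (xs' @ c @ ys') \<subseteq> S"
    using reduced_S[OF assms(1)] reduced_S[OF r(1)] by auto
  have e: "wp ((xs @ xs') @ c @ (ys' @ zs)) = wp (xs @ ys @ zs)"
  proof -
    have "wp (xs @ (xs' @ c @ ys') @ zs) = wp xs \<otimes> (wp (xs' @ c @ ys') \<otimes> wp zs)"
      using S by (simp only: wp_append set_append Un_subset_iff)
    also have "\<dots> = wp (xs @ ys @ zs)" unfolding r(2) using S by simp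
    finally show ?thesis by simp
  qed
  have "reduced ys" using reduced_append[OF assms(1)] reduced_append by blast
  then have "length (xs' @ c @ ys') = length ys" using r unfolding reduced_def by metis
  then have "reduced ((xs @ xs') @ c @ (ys' @ zs))"
    using assms(1) S e unfolding reduced_def by simp
  from thinD[OF assms(2) this e] show "\<not> braid_word c \<and> \<not> commuting_triple c" by blast
qed

text \<open>The last letter of the alternating word is a descent, so by
  \<open>not_both_descents\<close> the next letter is not, and the length goes up.\<close>

lemma coset_length:
  assumes st: "s \<in> S" "t \<in> S" "s \<noteq> t" and u: "u \<in> carrier W" "s \<notin> R u" "t \<notin> R u"
    and k: "m s t = 0 \<or> k \<le> m s t"
  shows "len (u \<otimes> wp (alternating k s t)) = len u + k"
  using k
proof (induction k)
  case (Suc k)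
  define e where "e = (if even k then s else t)"
  have S: "set (alternating j s t) \<subseteq> S" "e \<in> S" for j using alternating_S st by (auto simp: e_def)
  have IH: "len (u \<otimes> wp (alternating k s t)) = len u + k" using Suc by auto
  have "e \<notin> R (u \<otimes> wp (alternating k s t))"
  proof (cases k)
    case 0
    then show ?thesis using u by (simp add: e_def)
  next
    case (Suc j)
    \<comment> \<open>\<open>d\<close> is the last letter of the word so far, \<open>e\<close> the
      one to be appended.\<close>
    define d where "d = (if even j then s else t)"
    have "u \<otimes> wp (alternating k s t) \<otimes> d = u \<otimes> wp (alternating j s t)"
      unfolding Suc alternating_snoc using S(1)[of j] st u(1) by (simp add: d_def m_assoc S_sq)
    then have "len (u \<otimes> wp (alternating k s t) \<otimes> d) \<le> len u + j"
      using len_mult_le[of u "wp (alternating j s t)"] len_le[OF S(1), of j] u(1) S(1)[of j] by simp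
    then have "d \<in> R (u \<otimes> wp (alternating k s t))"
      using IH Suc st by (simp add: right_descent_def d_def)
    moreover have "\<not> (s \<in> R (u \<otimes> wp (alternating k s t)) \<and> t \<in> R (u \<otimes> wp (alternating k s t)))"
    proof (cases "odd k")
      case True
      then show ?thesis using not_both_descents[OF st u, of k] Suc.prems rev_alternating[of k s t] by auto
    next
      case False
      then show ?thesis
        using not_both_descents[of t s u k] st u Suc.prems rev_alternating[of k t s] m_sym[of s t] by auto
    qed
    moreover have "{d, e} = {s, t}" using Suc by (auto simp: d_def e_def)
    ultimately show ?thesis by (auto simp: doubleton_eq_iff)
  qed
  then have "len (u \<otimes> wp (alternating k s t) \<otimes> e) = Suc (len u + k)"
    using len_mult_gen(2)[of "u \<otimes> wp (alternating k s t)" e] IH u(1) S by simp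
  moreover have "u \<otimes> wp (alternating (Suc k) s t) = u \<otimes> wp (alternating k s t) \<otimes> e"
    unfolding alternating_snoc using S(1)[of k] S(2) u(1) by (simp add: e_def m_assoc)
  ultimately show ?case by simp
qed (use u in simp)

lemma word_in_generate: "set ws \<subseteq> I \<Longrightarrow> wp ws \<in> generate W I"
  by (induction ws) (auto intro: generate.intros)

lemma right_upper_starI:
  assumes st: "s \<in> S" "t \<in> S" "s \<noteq> t" and us: "set us \<subseteq> S" "s \<notin> R (wp us)" "t \<notin> R (wp us)"
    and k: "1 \<le> k" "k + 2 \<le> m s t"
  shows "right_upper_star W S (wp (us @ alternating k s t)) (wp (us @ alternating (Suc k) s t))"
proof -
  have S: "set (alternating j s t) \<subseteq> S" for j using alternating_S st by simp
  have one: "R \<one> = {}" using no_descent_outside_support[of "[]"] R_sub by auto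
  have "len (wp (alternating k s t)) = k" using coset_length[OF st one_closed, of k] one k S[of k] by simp
  then have "right_coset_decomp W S {s, t} (wp (us @ alternating k s t)) (wp us) (wp (alternating k s t))"
    unfolding right_coset_decomp_def
    using coset_length[OF st wp_closed[OF us(1)] us(2,3), of k] us S k word_in_generate[OF set_alternating[of k s t]]
    by auto
  then show ?thesis unfolding right_upper_star_def
    using st k us(1) S[of "Suc k"]
    by (intro bexI[of _ s] bexI[of _ t] exI[of _ "wp us"] exI[of _ k]) (auto simp del: alternating.simps)
qed

text \<open>The element \<open>w r\<close> has a reduced word ending in \<open>j r\<close>, and one
  ending in \<open>r j r\<close> if the two do not commute; removing the final letters gives the
  claims. Read contrapositively, this certifies non-descents.\<close>

lemma descent_below:
  assumes w: "w \<in> carrier W" and r: "r \<in> S" "r \<notin> R w" and j: "j \<in> R (w \<otimes> r)" "j \<noteq> r"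
  shows "j \<in> R w" "m r j \<noteq> 2 \<Longrightarrow> r \<in> R (w \<otimes> j)"
proof -
  have jS: "j \<in> S" using j R_sub by blast
  have rw: "r \<in> R (w \<otimes> r)" using descent_mult w r by simp
  have wr: "w \<otimes> r \<otimes> r = w" using w r by (simp add: S_cancel)
  have c: "w \<otimes> r \<in> carrier W" using w r by simp
  have m: "m r j \<noteq> 0" "m r j \<noteq> 1" using descents_m_ne_0[OF rw j(1) _ c] m_ne_1[OF r(1) jS] j by auto
  obtain us where us: "reduced (us @ rev (alternating 2 r j))" "w \<otimes> r = wp (us @ rev (alternating 2 r j))"
    using dihedral_factor[OF rw j(1) _ c, of 2] j m by auto
  then have 1: "reduced ((us @ [j]) @ [r])" "w \<otimes> r = wp ((us @ [j]) @ [r])" by (simp_all add: numeral_eq_Suc)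
  have "w = wp (us @ [j])" using descent_snoc[OF 1(1)] wr unfolding 1(2) by simp
  then show "j \<in> R w" using descent_snoc[of us j] reduced_append[OF 1(1)] by simp
  show "r \<in> R (w \<otimes> j)" if "m r j \<noteq> 2"
  proof -
    have "m r j = 0 \<or> 3 \<le> m r j" using m that by linarith
    then obtain us where us: "reduced (us @ rev (alternating 3 r j))" "w \<otimes> r = wp (us @ rev (alternating 3 r j))"
      using dihedral_factor[OF rw j(1) _ c, of 3] j by auto
    then have 1: "reduced (((us @ [r]) @ [j]) @ [r])" "w \<otimes> r = wp (((us @ [r]) @ [j]) @ [r])" by (simp_all add: numeral_eq_Suc)
    have w': "w = wp ((us @ [r]) @ [j])" using descent_snoc[OF 1(1)] wr unfolding 1(2) by simp
    have 2: "reduced ((us @ [r]) @ [j])" using reduced_append[OF 1(1)] by simp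
    have "w \<otimes> j = wp (us @ [r])" using descent_snoc[OF 2] unfolding w' by blast
    then show ?thesis using descent_snoc[of us r] reduced_append[OF 2] by simp
  qed
qed

end

locale labelled_coxeter = coxeter W S for W (structure) and S +
  fixes V :: "'l set" and M :: "'l \<Rightarrow> 'l \<Rightarrow> nat" and \<sigma> :: "'l \<Rightarrow> 'a"
  assumes type: "has_type W S V M \<sigma>"
    and M_refl: "M i i = 1" and M_commute: "M i j = M j i"
begin

abbreviation lw :: "'l list \<Rightarrow> 'a" where
  "lw ls \<equiv> labelled_word W \<sigma> ls"

lemma inj: "inj_on \<sigma> V" and image: "\<sigma> ` V = S" and m_label: "i \<in> V \<Longrightarrow> j \<in> V \<Longrightarrow> m (\<sigma> i) (\<sigma> j) = M i j"
  using type by (auto simp: has_type_def bij_betw_def)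

lemma label_S [simp]: "i \<in> V \<Longrightarrow> \<sigma> i \<in> S"
  using image by auto

lemma map_S [simp]: "set ls \<subseteq> V \<Longrightarrow> set (map \<sigma> ls) \<subseteq> S"
  by auto

lemma label_eq: "i \<in> V \<Longrightarrow> j \<in> V \<Longrightarrow> \<sigma> i = \<sigma> j \<longleftrightarrow> i = j"
  using inj by (auto dest: inj_onD)

lemma lw_append: "set xs \<subseteq> V \<Longrightarrow> set ys \<subseteq> V \<Longrightarrow> lw (xs @ ys) = lw xs \<otimes> lw ys"
  unfolding labelled_word_def map_append by (rule wp_append) auto

lemma lw_carrier: "set xs \<subseteq> V \<Longrightarrow> lw xs \<in> carrier W"
  unfolding labelled_word_def by (rule wp_closed) auto

lemma lw_rev: "set xs \<subseteq> V \<Longrightarrow> lw (rev xs) = inv (lw xs)"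
  unfolding labelled_word_def rev_map[symmetric] by (rule wp_rev) auto

lemma lw_swap:
  assumes "set (xs @ [a, b] @ ys) \<subseteq> V" "M a b = 2"
  shows "lw (xs @ [b, a] @ ys) = lw (xs @ [a, b] @ ys)"
proof -
  have V: "set xs \<subseteq> V" "a \<in> V" "b \<in> V" "set ys \<subseteq> V" using assms(1) by auto
  have "lw [b, a] = lw [a, b]"
    using m_2_commute[of "\<sigma> a" "\<sigma> b"] m_label[of a b] V assms(2) by (simp add: labelled_word_def)
  moreover have "lw (xs @ [x, y] @ ys) = lw xs \<otimes> (lw [x, y] \<otimes> lw ys)" if "x \<in> V" "y \<in> V" for x y
    using V that by (simp only: lw_append set_append Un_subset_iff set_simps insert_subset empty_subsetI)
  ultimately show ?thesis using V(2,3) by simp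
qed

definition thin_word :: "'l list \<Rightarrow> bool" where
  "thin_word ls \<longleftrightarrow> set ls \<subseteq> V \<and> reduced (map \<sigma> ls) \<and> thin (lw ls)"

text \<open>Connects the word analysis with the group: commuting letters can be swapped without
  changing the element, and factors of thin elements are thin.\<close>

sublocale thin_words M thin_word
proof
  show "thin_word ys" if "thin_word (xs @ ys @ zs)" for xs ys zs
  proof -
    have r: "reduced (map \<sigma> xs @ map \<sigma> ys @ map \<sigma> zs)" "thin (wp (map \<sigma> xs @ map \<sigma> ys @ map \<sigma> zs))"
      using that by (simp_all add: thin_word_def labelled_word_def)
    have "reduced (map \<sigma> ys)"
      using reduced_append[of "map \<sigma> ys" "map \<sigma> zs"] reduced_append[OF r(1)] by blast
    then show ?thesis using that thin_factor[OF r] by (simp add: thin_word_def labelled_word_def)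
  qed
  show "thin_word (xs @ [b, a] @ ys)" if t: "thin_word (xs @ [a, b] @ ys)" and m: "M a b = 2" for xs a b ys
  proof -
    have V: "set (xs @ [a, b] @ ys) \<subseteq> V" using t by (simp add: thin_word_def)
    have "lw (xs @ [b, a] @ ys) = lw (xs @ [a, b] @ ys)" by (rule lw_swap[OF V m])
    then show ?thesis using t unfolding thin_word_def reduced_def labelled_word_def by auto
  qed
  show "\<not> thin_word [a, a]" for a
    by (auto simp: thin_word_def reduced_def S_sq)
  show "\<not> thin_word (alternating (M a b) a b)" if ne: "a \<noteq> b" "3 \<le> M a b" for a b
  proof
    assume t: "thin_word (alternating (M a b) a b)"
    define k where "k = M a b - 2"
    have k: "M a b = Suc (Suc k)" using ne(2) by (simp add: k_def)
    have ab: "a \<in> V" "b \<in> V" using t k by (auto simp: thin_word_def)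
    have "braid_word (map \<sigma> (alternating (M a b) a b))"
      unfolding braid_word_def
      by (rule bexI[of _ "\<sigma> a"], rule bexI[of _ "\<sigma> b"])
        (use ab ne label_eq[of a b] m_label[of a b] in \<open>simp_all add: map_alternating\<close>)
    then show False using t thinD[of "lw (alternating (M a b) a b)" "[]" "map \<sigma> (alternating (M a b) a b)" "[]"]
      by (auto simp: thin_word_def labelled_word_def)
  qed
  show "\<not> thin_word [a, b, c]" if "M a b = 2" "M a c = 2" "M b c = 2" for a b c
  proof
    assume t: "thin_word [a, b, c]"
    then have ab: "a \<in> V" "b \<in> V" "c \<in> V" by (auto simp: thin_word_def)
    have "commuting_triple (map \<sigma> [a, b, c])"
      unfolding commuting_triple_def using ab that m_label by auto
    then show False using t thinD[of "lw [a, b, c]" "[]" "map \<sigma> [a, b, c]" "[]"]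
      by (auto simp: thin_word_def labelled_word_def)
  qed
qed (use M_refl M_commute in auto)

lemma ceq_lw: "ceq xs ys \<Longrightarrow> set xs \<subseteq> V \<Longrightarrow> lw xs = lw ys"
proof (induction rule: ceq.induct)
  case (ceq_swap zs xs a b ys)
  have "set (xs @ [a, b] @ ys) \<subseteq> V" using ceq_set[OF ceq_swap(1)] ceq_swap.prems by blast
  then show ?case using lw_swap[of xs a b ys] ceq_swap by simp
qed simp

text \<open>A letter commuting to the end is plainly a descent; the converse is
  \<open>thin_descent_word\<close>.\<close>

lemma rdesc_iff:
  assumes "thin_word ls" shows "rdesc ls i \<longleftrightarrow> i \<in> V \<and> \<sigma> i \<in> R (lw ls)"
proof
  assume "rdesc ls i"
  then obtain xs ys where d: "ls = xs @ i # ys" "com {i} (set ys)" by (auto simp: rdesc_def)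
  have "ceq ls (xs @ ys @ [i])" using ceq_move[of "[i]" ys xs "[]"] d by simp
  then have t: "thin_word (xs @ ys @ [i])" "lw ls = lw (xs @ ys @ [i])"
    using ceq_ok[OF \<open>ceq ls _\<close> assms] ceq_lw[OF \<open>ceq ls _\<close>] assms by (simp_all only: thin_word_def)
  then have "reduced (map \<sigma> (xs @ ys) @ [\<sigma> i])" by (simp add: thin_word_def)
  then show "i \<in> V \<and> \<sigma> i \<in> R (lw ls)"
    using descent_snoc[of "map \<sigma> (xs @ ys)" "\<sigma> i"] t by (simp add: thin_word_def labelled_word_def)
next
  assume i: "i \<in> V \<and> \<sigma> i \<in> R (lw ls)"
  have V: "set ls \<subseteq> V" using assms by (simp add: thin_word_def)
  obtain xs ys where d: "map \<sigma> ls = xs @ \<sigma> i # ys" "\<forall>y\<in>set ys. m (\<sigma> i) y = 2"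
    using thin_descent_word[of "map \<sigma> ls" "\<sigma> i"] assms i by (auto simp: thin_word_def labelled_word_def)
  obtain xs' j ys' where l: "ls = xs' @ j # ys'" "map \<sigma> xs' = xs" "\<sigma> j = \<sigma> i" "map \<sigma> ys' = ys"
    using d(1) by (auto simp: map_eq_append_conv map_eq_Cons_conv)
  then have "j = i" using V i label_eq[of j i] by auto
  moreover have "com {i} (set ys')"
  proof -
    have "M i b = 2 \<and> M b i = 2" if b: "b \<in> set ys'" for b
    proof -
      have "b \<in> V" "m (\<sigma> i) (\<sigma> b) = 2" using b l V d(2) by auto
      then show ?thesis using m_label[of i b] i M_commute[of b i] by simp
    qed
    then show ?thesis by (auto simp: com_def)
  qed
  ultimately show "rdesc ls i" using l(1) by (auto simp: rdesc_def)
qed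

lemma thin_word_rev: "thin_word ls \<Longrightarrow> thin_word (rev ls)"
  using reduced_rev[of "map \<sigma> ls"] thin_inv[of "lw ls"] lw_rev[of ls] lw_carrier[of ls]
  by (simp add: thin_word_def rev_map)

lemma ldesc_iff:
  assumes "thin_word ls" shows "ldesc ls i \<longleftrightarrow> i \<in> V \<and> \<sigma> i \<in> R (inv (lw ls))"
  using rdesc_iff[OF thin_word_rev[OF assms]] rdesc_rev[of "rev ls" i] lw_rev[of ls] assms
  by (simp add: thin_word_def)

lemma no_descent_label: "set ls \<subseteq> V \<Longrightarrow> i \<in> V \<Longrightarrow> i \<notin> set ls \<Longrightarrow> \<sigma> i \<notin> R (lw ls)"
  unfolding labelled_word_def by (rule no_descent_outside_support) (auto simp: label_eq)

lemma commuting_pair: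
  assumes ij: "i \<in> V" "j \<in> V" "M i j = 2"
  shows "thin_word [i, j]" "R (lw [i, j]) = {\<sigma> i, \<sigma> j}" "inv (lw [i, j]) = lw [i, j]"
proof -
  have ne: "i \<noteq> j" using ij M_refl[of i] by auto
  have "reduced [\<sigma> i]" using len_gen ij by (simp add: reduced_def)
  moreover have "\<sigma> j \<notin> R (wp [\<sigma> i])" using no_descent_label[of "[i]" j] ij ne by (simp add: labelled_word_def)
  ultimately have r: "reduced [\<sigma> i, \<sigma> j]" using reduced_snoc[of "[\<sigma> i]" "\<sigma> j"] ij by simp
  have "thin (lw [i, j])"
    unfolding thin_def
  proof (intro allI impI)
    fix xs c ys assume x: "reduced (xs @ c @ ys)" "wp (xs @ c @ ys) = lw [i, j]"
    have "len (lw [i, j]) = 2" using r ij by (simp add: reduced_def labelled_word_def)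
    then have "length (xs @ c @ ys) = 2" using x unfolding reduced_def by simp
    then have "length c \<le> 2" by simp
    then show "\<not> braid_word c \<and> \<not> commuting_triple c" by (auto simp: braid_word_def commuting_triple_def)
  qed
  then show t: "thin_word [i, j]" using r ij by (simp add: thin_word_def)
  have rd: "rdesc [i, j] x \<longleftrightarrow> x \<in> {i, j}" for x
    using ij M_commute[of i j] M_refl[of j] by (auto simp: rdesc_Cons com_def)
  show "R (lw [i, j]) = {\<sigma> i, \<sigma> j}"
  proof
    show "R (lw [i, j]) \<subseteq> {\<sigma> i, \<sigma> j}"
    proof
      fix s assume s: "s \<in> R (lw [i, j])"
      then obtain k where "k \<in> V" "s = \<sigma> k" using R_sub image by blast
      then show "s \<in> {\<sigma> i, \<sigma> j}" using rdesc_iff[OF t, of k] rd[of k] s by auto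
    qed
    show "{\<sigma> i, \<sigma> j} \<subseteq> R (lw [i, j])"
      using rdesc_iff[OF t, of i] rdesc_iff[OF t, of j] rd by simp
  qed
  have "lw [j, i] = lw [i, j]" using lw_swap[of "[]" i j "[]"] ij by simp
  then show "inv (lw [i, j]) = lw [i, j]" using lw_rev[of "[i, j]"] ij by simp
qed

text \<open>Upper star operations fix the left descents. Applied to \<open>z\<close> and, since
  \<open>z\<close> is an inverse of a reachable element, to \<open>inv z\<close>, this fixes both
  descent sets of \<open>z\<close>.\<close>

lemma I_set_words:
  assumes ij: "i \<in> V" "j \<in> V" "M i j = 2" and z: "z \<in> I_set W S (lw [i, j]) (lw [i, j])"
  obtains ls where "thin_word ls" "z = lw ls" "\<And>x. ldesc ls x \<longleftrightarrow> x \<in> {i, j}" "\<And>x. rdesc ls x \<longleftrightarrow> x \<in> {i, j}"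
proof -
  note x = commuting_pair[OF ij]
  have xc: "lw [i, j] \<in> carrier W" "thin (lw [i, j])" using x(1) lw_carrier[of "[i, j]"] ij by (simp_all add: thin_word_def)
  obtain z' where z': "z \<in> right_upper_closure W S (lw [i, j])" "z' \<in> right_upper_closure W S (lw [i, j])" "z = inv z'"
    using z by (auto simp: I_set_def)
  have 1: "z \<in> carrier W" "thin z" "R (inv z) = {\<sigma> i, \<sigma> j}"
    using right_upper_closure_invariants[OF z'(1) xc(2,1)] x by auto
  have 2: "R z = {\<sigma> i, \<sigma> j}"
    using right_upper_closure_invariants[OF z'(2) xc(2,1)] x z'(3) by simp
  obtain ws where ws: "reduced ws" "wp ws = z" using reduced_word_exists 1 by blast
  define ls where "ls = map (inv_into V \<sigma>) ws"
  have wsS: "set ws \<subseteq> \<sigma> ` V" using reduced_S[OF ws(1)] image by simp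
  have m: "map \<sigma> ls = ws" unfolding ls_def using wsS by (auto simp: f_inv_into_f intro!: map_idI)
  have V: "set ls \<subseteq> V" unfolding ls_def using wsS by (auto intro: inv_into_into)
  have t: "thin_word ls" using V m ws 1 by (simp add: thin_word_def labelled_word_def)
  have zl: "z = lw ls" using m ws by (simp add: labelled_word_def)
  have "x \<in> V \<and> \<sigma> x \<in> {\<sigma> i, \<sigma> j} \<longleftrightarrow> x \<in> {i, j}" for x using ij label_eq by auto
  then have "ldesc ls x \<longleftrightarrow> x \<in> {i, j}" "rdesc ls x \<longleftrightarrow> x \<in> {i, j}" for x
    using ldesc_iff[OF t, of x] rdesc_iff[OF t, of x] 1(3) 2 zl by simp_all
  then show thesis using that t zl by blast
qed

abbreviation reach :: "'l list \<Rightarrow> 'l list \<Rightarrow> bool" where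
  "reach xs ys \<equiv> (right_upper_star W S)\<^sup>*\<^sup>* (lw xs) (lw ys)"

lemma reach_step:
  assumes "reach xs (us @ alternating k i j)" "set us \<subseteq> V" "i \<in> V" "j \<in> V" "1 \<le> k" "k + 2 \<le> M i j"
    and "\<sigma> i \<notin> R (lw us)" "\<sigma> j \<notin> R (lw us)"
  shows "reach xs (us @ alternating (Suc k) i j)"
proof -
  have ne: "i \<noteq> j" using assms(6) M_refl[of i] by auto
  have "right_upper_star W S (wp (map \<sigma> us @ alternating k (\<sigma> i) (\<sigma> j))) (wp (map \<sigma> us @ alternating (Suc k) (\<sigma> i) (\<sigma> j)))"
    by (rule right_upper_starI) (use assms ne label_eq m_label in \<open>auto simp: labelled_word_def\<close>)
  then have "right_upper_star W S (lw (us @ alternating k i j)) (lw (us @ alternating (Suc k) i j))"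
    unfolding labelled_word_def map_append map_alternating .
  then show ?thesis using assms(1) by (rule rtranclp.rtrancl_into_rtrancl[rotated])
qed

lemma reach_ceq: "reach xs ys \<Longrightarrow> ceq ys zs \<Longrightarrow> set ys \<subseteq> V \<Longrightarrow> reach xs zs"
  using ceq_lw by simp

text \<open>A word equal to its reversal up to commutation is an involution, so reachability alone
  gives both memberships.\<close>

lemma in_I_set:
  assumes "reach [i, j] ls" "set ls \<subseteq> V" "ceq (rev ls) ls"
  shows "lw ls \<in> I_set W S (lw [i, j]) (lw [i, j])"
proof -
  have "inv (lw ls) = lw ls" using lw_rev[OF assms(2)] ceq_lw[OF assms(3)] assms(2) by simp
  then show ?thesis using assms(1) unfolding I_set_def right_upper_closure_def
    by (intro IntI image_eqI[of _ _ "lw ls"]) simp_all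
qed

lemma pair_in_I_set:
  assumes "i \<in> V" "j \<in> V" "M i j = 2" shows "lw [i, j] \<in> I_set W S (lw [i, j]) (lw [i, j])"
  by (rule in_I_set) (use assms ceq_swap[OF ceq_refl, of j i "[]" "[]"] M_commute[of i j] in auto)

end

section \<open>The sets I(x,x)\<close>

lemma labelled_coxeterI:
  assumes "coxeter_system W S" "has_type W S V M \<sigma>" "\<And>i. M i i = 1" "\<And>i j. M i j = M j i"
  shows "labelled_coxeter W S V M \<sigma>"
  using assms
  by (simp add: labelled_coxeter_def labelled_coxeter_axioms_def coxeter_def coxeter_axioms_def coxeter_system_def)

context labelled_coxeter
begin

lemma I_set_eq:
  assumes ij: "i \<in> V" "j \<in> V" "M i j = 2"
    and upper: "\<And>ls. thin_word ls \<Longrightarrow> set ls \<subseteq> V \<Longrightarrow> (\<And>x. ldesc ls x \<longleftrightarrow> x \<in> {i, j}) \<Longrightarrow>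
      (\<And>x. rdesc ls x \<longleftrightarrow> x \<in> {i, j}) \<Longrightarrow> \<exists>l\<in>Ls. ceq ls l"
    and lower: "\<And>l. l \<in> Ls \<Longrightarrow> lw l \<in> I_set W S (lw [i, j]) (lw [i, j])"
  shows "I_set W S (lw [i, j]) (lw [i, j]) = lw ` Ls"
proof
  show "I_set W S (lw [i, j]) (lw [i, j]) \<subseteq> lw ` Ls"
  proof
    fix z assume "z \<in> I_set W S (lw [i, j]) (lw [i, j])"
    then obtain ls where ls: "thin_word ls" "z = lw ls" "\<And>x. ldesc ls x \<longleftrightarrow> x \<in> {i, j}" "\<And>x. rdesc ls x \<longleftrightarrow> x \<in> {i, j}"
      using I_set_words[OF ij] by metis
    have V: "set ls \<subseteq> V" using ls(1) by (simp add: thin_word_def)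
    obtain l where "l \<in> Ls" "ceq ls l" using upper[OF ls(1) V ls(3,4)] by blast
    then show "z \<in> lw ` Ls" using ceq_lw V ls(2) by auto
  qed
qed (use lower in blast)

lemma I_set_singleton:
  assumes ij: "i \<in> V" "j \<in> V" "M i j = 2"
    and upper: "\<And>ls. thin_word ls \<Longrightarrow> set ls \<subseteq> V \<Longrightarrow> (\<And>x. ldesc ls x \<longleftrightarrow> x \<in> {i, j}) \<Longrightarrow>
      (\<And>x. rdesc ls x \<longleftrightarrow> x \<in> {i, j}) \<Longrightarrow> ceq ls [i, j]"
  shows "I_set W S (lw [i, j]) (lw [i, j]) = {lw [i, j]}"
  using I_set_eq[OF ij, of "{[i, j]}"] upper pair_in_I_set[OF ij] by simp

text \<open>With \<open>a\<close> as coset representative, two upper stars lead from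
  \<open>q\<close> to \<open>q p q\<close>; the second one needs weight at least 4.\<close>

lemma reach_double:
  assumes V: "p \<in> V" "q \<in> V" "a \<in> V" and m: "4 \<le> M q p" and com: "com {a} {p, q}"
  shows "reach [q, a] [q, p, q, a]"
proof -
  have ne: "a \<noteq> p" "a \<noteq> q" using com M_refl[of a] by (auto simp: com_def)
  have nd: "\<sigma> p \<notin> R (lw [a])" "\<sigma> q \<notin> R (lw [a])" using no_descent_label[of "[a]"] V ne by auto
  have "ceq [q, a] [a, q]" using ceq_swap[OF ceq_refl, of q a "[]" "[]"] com by (simp add: com_def)
  then have "reach [q, a] ([a] @ alternating 1 q p)" using reach_ceq[of "[q, a]" "[q, a]" "[a, q]"] V by simp
  then have "reach [q, a] ([a] @ alternating (Suc 1) q p)" by (rule reach_step) (use V m nd in auto)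
  then have "reach [q, a] ([a] @ alternating (Suc (Suc 1)) q p)" by (rule reach_step) (use V m nd in auto)
  moreover have "ceq ([a] @ alternating (Suc (Suc 1)) q p) [q, p, q, a]"
    using ceq_move[of "[a]" "[q, p, q]" "[]" "[]"] com by (auto simp: com_def)
  ultimately show ?thesis by (rule reach_ceq) (use V in simp)
qed

lemma double_in_I_set:
  assumes V: "p \<in> V" "q \<in> V" "a \<in> V" and m: "4 \<le> M q p" and com: "com {a} {p, q}"
  shows "lw [q, p, q, a] \<in> I_set W S (lw [q, a]) (lw [q, a])"
proof (rule in_I_set[OF reach_double[OF assms]])
  show "ceq (rev [q, p, q, a]) [q, p, q, a]"
    using ceq_move[of "[a]" "[q, p, q]" "[]" "[]"] com by (auto simp: com_def)
qed (use V in simp)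

text \<open>A letter appended in ascending direction creates no descent other than itself.\<close>

lemma no_descent_snoc:
  assumes V: "set us \<subseteq> V" "r \<in> V" "j \<in> V" "j \<noteq> r" and nd: "\<sigma> r \<notin> R (lw us)" "\<sigma> j \<notin> R (lw us)"
  shows "\<sigma> j \<notin> R (lw (us @ [r]))"
proof
  assume "\<sigma> j \<in> R (lw (us @ [r]))"
  moreover have "lw (us @ [r]) = lw us \<otimes> \<sigma> r"
    using lw_append[OF V(1), of "[r]"] V by (simp add: labelled_word_def)
  ultimately have "\<sigma> j \<in> R (lw us \<otimes> \<sigma> r)" by simp
  then show False using descent_below(1)[OF lw_carrier[OF V(1)] label_S[OF V(2)] nd(1)] V nd label_eq by auto
qed

text \<open>If \<open>j\<close> remained a descent after appending the non-commuting
  \<open>r\<close>, then \<open>r\<close> would have been a descent before \<open>j\<close> was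
  appended.\<close>

lemma no_descent_snoc_adjacent:
  assumes V: "set us \<subseteq> V" "r \<in> V" "j \<in> V" and m: "j \<noteq> r" "M r j \<noteq> 2"
    and nd: "\<sigma> r \<notin> R (lw us)" "\<sigma> r \<notin> R (lw (us @ [j]))"
  shows "\<sigma> j \<notin> R (lw (us @ [j, r]))"
proof
  have V': "set (us @ [j]) \<subseteq> V" using V by simp
  assume "\<sigma> j \<in> R (lw (us @ [j, r]))"
  moreover have "lw (us @ [j, r]) = lw (us @ [j]) \<otimes> \<sigma> r"
    using lw_append[OF V', of "[r]"] V by (simp add: labelled_word_def)
  ultimately have "\<sigma> r \<in> R (lw (us @ [j]) \<otimes> \<sigma> j)"
    using descent_below(2)[OF lw_carrier[OF V'] label_S[OF V(2)] nd(2)] V m m_label label_eq by auto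
  moreover have "lw (us @ [j]) \<otimes> \<sigma> j = lw us"
    using lw_append[OF V(1), of "[j]"] V S_cancel[of "\<sigma> j" "lw us"] lw_carrier[OF V(1)] by (simp add: labelled_word_def)
  ultimately show False using nd by simp
qed

end

section \<open>The concrete diagrams\<close>

lemma path_matrix_simps:
  "path_matrix b i i = 1" "path_matrix b i (Suc i) = b i" "path_matrix b (Suc i) i = b i"
  "Suc i < j \<Longrightarrow> path_matrix b i j = 2" "Suc i < j \<Longrightarrow> path_matrix b j i = 2"
  by (auto simp: path_matrix_def)

lemma path_matrix_sym: "path_matrix b i j = path_matrix b j i"
  by (auto simp: path_matrix_def)

lemma E_matrix_sym: "E_matrix i j = E_matrix j i"
  by (cases i; cases j) (auto simp: abs_minus_commute)

lemma E_matrix_refl: "E_matrix i i = 1"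
  by (cases i) auto

text \<open>Serves types A, B of rank 3 and H of rank 3: vertex 1 is the left arm, 2 the joining
  generator, and the tail starts at 3.\<close>

lemma I_set_short_left_arm:
  assumes cs: "coxeter_system W S" and type: "has_type W S {1..n} (path_matrix b) \<sigma>"
    and n: "3 \<le> n" and b: "3 \<le> b 1" "b 1 \<le> 5" "\<And>i. 2 \<le> i \<Longrightarrow> b i = 3" and short: "b 1 = 3 \<or> n = 3"
  shows "I_set W S (labelled_word W \<sigma> [1,3]) (labelled_word W \<sigma> [1,3]) = {labelled_word W \<sigma> [1,3]}"
proof -
  let ?M = "path_matrix b"
  interpret labelled_coxeter W S "{1..n}" ?M \<sigma>
    by (rule labelled_coxeterI[OF cs type]) (auto simp: path_matrix_simps(1) path_matrix_sym)
  have u: "3 # [4..<Suc n] = map (\<lambda>i. i) [3..<Suc n]" using n by (simp add: upt_conv_Cons)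
  have t: "simple_tail (3 # [4..<Suc n])"
    unfolding u by (rule simple_tail_upt) (auto simp: path_matrix_def b(3))
  show ?thesis
  proof (rule I_set_singleton)
    show "ceq ls [1, 3]" if "thin_word ls" "set ls \<subseteq> {1..n}"
      "\<And>x. ldesc ls x \<longleftrightarrow> x \<in> {1, 3}" "\<And>x. rdesc ls x \<longleftrightarrow> x \<in> {1, 3}" for ls
      by (rule short_left_arm[of ls 1 2 3 "[4..<Suc n]"])
        (use that t n b short in \<open>auto simp: com_def path_matrix_def\<close>)
  qed (use n in \<open>auto simp: path_matrix_def\<close>)
qed

text \<open>Serves types B and H of rank above 3: the left arm is 1, 2, the joining generator 3, and
  the tail starts at 4.\<close>

lemma I_set_double_left_arm:
  assumes cs: "coxeter_system W S" and type: "has_type W S {1..n} (path_matrix b) \<sigma>"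
    and n: "4 \<le> n" and b: "b 1 = 4 \<or> b 1 = 5" "\<And>i. 2 \<le> i \<Longrightarrow> b i = 3"
  shows "I_set W S (labelled_word W \<sigma> [2,4]) (labelled_word W \<sigma> [2,4]) =
    {labelled_word W \<sigma> [2,4], labelled_word W \<sigma> [2,1,2,4]}"
proof -
  let ?M = "path_matrix b"
  interpret labelled_coxeter W S "{1..n}" ?M \<sigma>
    by (rule labelled_coxeterI[OF cs type]) (auto simp: path_matrix_simps(1) path_matrix_sym)
  have u: "4 # [5..<Suc n] = map (\<lambda>i. i) [4..<Suc n]" using n by (simp add: upt_conv_Cons)
  have t: "simple_tail (4 # [5..<Suc n])"
    unfolding u by (rule simple_tail_upt) (auto simp: path_matrix_def b(2))
  have "I_set W S (lw [2, 4]) (lw [2, 4]) = lw ` {[2, 4], [2, 1, 2, 4]}"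
  proof (rule I_set_eq)
    show "\<exists>l\<in>{[2, 4], [2, 1, 2, 4]}. ceq ls l" if "thin_word ls" "set ls \<subseteq> {1..n}"
      "\<And>x. ldesc ls x \<longleftrightarrow> x \<in> {2, 4}" "\<And>x. rdesc ls x \<longleftrightarrow> x \<in> {2, 4}" for ls
    proof -
      have "ceq ls [2, 4] \<or> ceq ls [2, 1, 2, 4]"
        by (rule double_left_arm_simple[of ls 1 2 3 4 "[5..<Suc n]"])
          (use that t n b in \<open>auto simp: com_def path_matrix_def\<close>)
      then show ?thesis by blast
    qed
    show "lw l \<in> I_set W S (lw [2, 4]) (lw [2, 4])" if "l \<in> {[2, 4], [2, 1, 2, 4]}" for l
    proof -
      have "lw [2, 4] \<in> I_set W S (lw [2, 4]) (lw [2, 4])"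
        by (rule pair_in_I_set) (use n in \<open>auto simp: path_matrix_def\<close>)
      moreover have "lw [2, 1, 2, 4] \<in> I_set W S (lw [2, 4]) (lw [2, 4])"
        by (rule double_in_I_set) (use n b in \<open>auto simp: path_matrix_def com_def\<close>)
      ultimately show ?thesis using that by auto
    qed
  qed (use n in \<open>auto simp: path_matrix_def\<close>)
  then show ?thesis by simp
qed

lemma I_set_second_edge:
  assumes cs: "coxeter_system W S" and type: "has_type W S {1..n} (path_matrix b) \<sigma>"
    and n: "4 \<le> n" and b: "b 2 = 4" "\<And>i. i \<noteq> 2 \<Longrightarrow> b i = 3"
  shows "I_set W S (labelled_word W \<sigma> [2,4]) (labelled_word W \<sigma> [2,4]) =
    (if n = 4 then {labelled_word W \<sigma> [2,4]} else {labelled_word W \<sigma> [2,4], labelled_word W \<sigma> [2,4,3,5,2,4]})"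
proof -
  let ?M = "path_matrix b"
  interpret labelled_coxeter W S "{1..n}" ?M \<sigma>
    by (rule labelled_coxeterI[OF cs type]) (auto simp: path_matrix_simps(1) path_matrix_sym)
  have u: "4 # [5..<Suc n] = map (\<lambda>i. i) [4..<Suc n]" using n by (simp add: upt_conv_Cons)
  have t: "simple_tail (4 # [5..<Suc n])"
    unfolding u by (rule simple_tail_upt) (auto simp: path_matrix_def b)
  define Ls where "Ls = (if n = 4 then {[2, 4]} else {[2, 4], [2, 4, 3, 5, 2, 4 :: nat]})"
  have "I_set W S (lw [2, 4]) (lw [2, 4]) = lw ` Ls"
  proof (rule I_set_eq)
    show "\<exists>l\<in>Ls. ceq ls l" if "thin_word ls" "set ls \<subseteq> {1..n}"
      "\<And>x. ldesc ls x \<longleftrightarrow> x \<in> {2, 4}" "\<And>x. rdesc ls x \<longleftrightarrow> x \<in> {2, 4}" for ls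
    proof -
      have "ceq ls [2, 4] \<or> (\<exists>b' t'. [5..<Suc n] = b' # t' \<and> ceq ls [2, 4, 3, 2, b', 4])"
        by (rule second_edge_heavy[of ls 1 2 3 4 "[5..<Suc n]"])
          (use that t n b in \<open>auto simp: com_def path_matrix_def\<close>)
      then show ?thesis
      proof
        assume "\<exists>b' t'. [5..<Suc n] = b' # t' \<and> ceq ls [2, 4, 3, 2, b', 4]"
        then obtain b' t' where b': "[5..<Suc n] = b' # t'" "ceq ls [2, 4, 3, 2, b', 4]" by blast
        \<comment> \<open>For \<open>n = 4\<close> the tail behind vertex 4 is empty; the long word
          needs the vertex 5 as its head.\<close>
        then have n4: "4 < n" by (cases "5 \<le> n") auto
        then have "[5..<Suc n] = 5 # [6..<Suc n]" by (simp add: upt_conv_Cons)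
        then have "b' = 5" using b'(1) by (metis list.inject)
        then have "ceq ls [2, 4, 3, 5, 2, 4]"
          using ceq_swap[of ls "[2, 4, 3]" 2 5 "[4]"] b'(2) by (simp add: path_matrix_def)
        then show ?thesis using n4 by (auto simp: Ls_def)
      qed (auto simp: Ls_def)
    qed
    have "lw [2, 4] \<in> I_set W S (lw [2, 4]) (lw [2, 4])"
      by (rule pair_in_I_set) (use n in \<open>auto simp: path_matrix_def\<close>)
    moreover have "lw [2, 4, 3, 5, 2, 4] \<in> I_set W S (lw [2, 4]) (lw [2, 4])" if n: "4 < n"
    proof (rule in_I_set)
      have c: "ceq (xs @ [a, b] @ ys) (xs @ [b, a] @ ys)" if "?M a b = 2" for xs a b ys
        using ceq_swap[OF ceq_refl that] .
      have m: "?M 2 4 = 2" "?M 4 2 = 2" "?M 2 5 = 2" "?M 5 2 = 2" "?M 3 5 = 2" "?M 5 3 = 2"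
        by (auto simp: path_matrix_def)
      show "ceq (rev [2, 4, 3, 5, 2, 4]) [2, 4, 3, 5, 2, 4]"
      proof -
        have "ceq [2, 4, 5, 3, 4, 2] [2, 4, 3, 5, 4, 2]" using c[OF m(6), of "[2, 4]" "[4, 2]"] by simp
        moreover have "ceq [4, 2, 5, 3, 4, 2] [2, 4, 5, 3, 4, 2]" using c[OF m(2), of "[]" "[5, 3, 4, 2]"] by simp
        moreover have "ceq [2, 4, 3, 5, 4, 2] [2, 4, 3, 5, 2, 4]" using c[OF m(2), of "[2, 4, 3, 5]" "[]"] by simp
        ultimately show ?thesis by (auto intro: ceq_trans)
      qed
      have nd: "\<sigma> i \<notin> R (lw us)" if "set us \<subseteq> {1..n}" "i \<in> {1..n}" "i \<notin> set us" for i us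
        using no_descent_label that by blast
      \<comment> \<open>The chain is 24, 245, then 4523 and 45232 with the pair 2, 3 of weight 4,
        and finally 423254. Commutations in between bring the active pair to the end.\<close>
      have "reach [2, 4] ([2] @ alternating 1 4 5)" by simp
      then have "reach [2, 4] ([2] @ alternating (Suc 1) 4 5)"
        by (rule reach_step) (use n nd[of "[2]"] b in \<open>auto simp: path_matrix_def\<close>)
      then have "reach [2, 4] [2, 4, 5]" by simp
      moreover have "ceq [2, 4, 5] ([4, 5] @ alternating 1 2 3)"
      proof -
        have "ceq [2, 4, 5] [4, 2, 5]" using c[OF m(1), of "[]" "[5]"] by simp
        moreover have "ceq [4, 2, 5] [4, 5, 2]" using c[OF m(3), of "[4]" "[]"] by simp
        ultimately show ?thesis by (auto intro: ceq_trans)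
      qed
      ultimately have "reach [2, 4] ([4, 5] @ alternating 1 2 3)" by (rule reach_ceq) (use n in auto)
      then have "reach [2, 4] ([4, 5] @ alternating (Suc 1) 2 3)"
        by (rule reach_step) (use n nd[of "[4, 5]"] b in \<open>auto simp: path_matrix_def\<close>)
      then have "reach [2, 4] ([4, 5] @ alternating (Suc (Suc 1)) 2 3)"
        by (rule reach_step) (use n nd[of "[4, 5]"] b in \<open>auto simp: path_matrix_def\<close>)
      then have "reach [2, 4] [4, 5, 2, 3, 2]" by simp
      \<comment> \<open>Moving 5 to the end makes 4232 the coset representative for the pair 5,
        4.\<close>
      moreover have "ceq [4, 5, 2, 3, 2] ([4, 2, 3, 2] @ alternating 1 5 4)"
      proof -
        have "ceq [4, 5, 2, 3, 2] [4, 2, 5, 3, 2]" using c[OF m(4), of "[4]" "[3, 2]"] by simp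
        moreover have "ceq [4, 2, 5, 3, 2] [4, 2, 3, 5, 2]" using c[OF m(6), of "[4, 2]" "[2]"] by simp
        moreover have "ceq [4, 2, 3, 5, 2] [4, 2, 3, 2, 5]" using c[OF m(4), of "[4, 2, 3]" "[]"] by simp
        ultimately show ?thesis by (auto intro: ceq_trans)
      qed
      ultimately have r: "reach [2, 4] ([4, 2, 3, 2] @ alternating 1 5 4)" by (rule reach_ceq) (use n in auto)
      \<comment> \<open>The representative 4232 contains the letter 4, so its support does not
        decide whether 4 is a descent. After 3 neither 2 nor 4 is one, and appending 2 does not
        bring 4 back.\<close>
      have s2: "\<sigma> 2 \<notin> R (lw [4, 2, 3])"
        using no_descent_snoc_adjacent[of "[4]" 3 2] nd[of "[4]" 3] nd[of "[4, 2]" 3] n b by (simp add: path_matrix_def)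
      have "\<sigma> 4 \<notin> R (lw [2, 4, 3])"
        using no_descent_snoc_adjacent[of "[2]" 3 4] nd[of "[2]" 3] nd[of "[2, 4]" 3] n b by (simp add: path_matrix_def)
      moreover have "lw [2, 4, 3] = lw [4, 2, 3]"
        using ceq_lw[OF c[OF m(1), of "[]" "[3]"]] n by simp
      ultimately have s4: "\<sigma> 4 \<notin> R (lw [4, 2, 3])" by simp
      have "\<sigma> 4 \<notin> R (lw [4, 2, 3, 2])"
        using no_descent_snoc[of "[4, 2, 3]" 2 4] s2 s4 n by simp
      then have "reach [2, 4] ([4, 2, 3, 2] @ alternating (Suc 1) 5 4)"
        using nd[of "[4, 2, 3, 2]" 5] by (intro reach_step[OF r]) (use n b in \<open>auto simp: path_matrix_def\<close>)
      then have "reach [2, 4] [4, 2, 3, 2, 5, 4]" by simp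
      moreover have "ceq [4, 2, 3, 2, 5, 4] [2, 4, 3, 5, 2, 4]"
      proof -
        have "ceq [4, 2, 3, 2, 5, 4] [2, 4, 3, 2, 5, 4]" using c[OF m(2), of "[]" "[3, 2, 5, 4]"] by simp
        moreover have "ceq [2, 4, 3, 2, 5, 4] [2, 4, 3, 5, 2, 4]" using c[OF m(3), of "[2, 4, 3]" "[4]"] by simp
        ultimately show ?thesis by (rule ceq_trans[rotated])
      qed
      ultimately show "reach [2, 4] [2, 4, 3, 5, 2, 4]" by (rule reach_ceq) (use n in auto)
    qed (use n in auto)
    ultimately show "lw l \<in> I_set W S (lw [2, 4]) (lw [2, 4])" if "l \<in> Ls" for l
      using that n by (auto simp: Ls_def split: if_splits)
  qed (use n in \<open>auto simp: path_matrix_def\<close>)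
  then show ?thesis by (auto simp: Ls_def)
qed

lemma I_set_double_edges:
  assumes cs: "coxeter_system W S" and type: "has_type W S {1..n} (path_matrix b) \<sigma>"
    and n: "5 \<le> n" and b: "b 1 = 4" "b (n - 1) = 4" "\<And>i. i \<noteq> 1 \<Longrightarrow> i \<noteq> n - 1 \<Longrightarrow> b i = 3"
  shows "I_set W S (labelled_word W \<sigma> [2,4]) (labelled_word W \<sigma> [2,4]) =
    {labelled_word W \<sigma> [2,4], labelled_word W \<sigma> [2,1,2,4],
     labelled_word W \<sigma> ([2] @ z_word n), labelled_word W \<sigma> ([2,1,2] @ z_word n)}"
proof -
  let ?M = "path_matrix b"
  interpret labelled_coxeter W S "{1..n}" ?M \<sigma>
    by (rule labelled_coxeterI[OF cs type]) (auto simp: path_matrix_simps(1) path_matrix_sym)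
  have u: "4 # [5..<Suc n] = map (\<lambda>i. i) [4..<Suc n]" using n by (simp add: upt_conv_Cons)
  have t: "double_tail (4 # [5..<Suc n])"
    unfolding u by (rule double_tail_upt) (use n b(2) in \<open>auto simp: path_matrix_def b(3)\<close>)
  have z: "updown (4 # [5..<Suc n]) = z_word n"
    unfolding u using updown_snoc[of "[4..<n]" n] n by (simp add: z_word_def)
  have zset: "set (z_word n) \<subseteq> {4..n}" using n by (auto simp: z_word_def)
  define Ls where "Ls = {[2, 4], [2, 1, 2, 4], [2] @ z_word n, [2, 1, 2] @ z_word n}"
  have pair: "lw [2, 4] \<in> I_set W S (lw [2, 4]) (lw [2, 4])"
    by (rule pair_in_I_set) (use n in \<open>auto simp: path_matrix_def\<close>)
  have com: "com {4} {1, 2}" by (auto simp: com_def path_matrix_def)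
  \<comment> \<open>Both \<open>2 z\<close> and \<open>212 z\<close> are obtained by the same walk
    along the right arm, behind the fixed prefix \<open>D\<close>.\<close>
  have long: "lw (D @ z_word n) \<in> I_set W S (lw [2, 4]) (lw [2, 4])" if D: "D = [2] \<or> D = [2, 1, 2]" for D
  proof (rule in_I_set)
    have DV: "set D \<subseteq> {1, 2}" "rev D = D" using D by auto
    show "set (D @ z_word n) \<subseteq> {1..n}" using DV zset n by auto
    have "rev (z_word n) = z_word n" by (simp add: z_word_def)
    moreover have "com (set (z_word n)) (set D)" using DV zset by (fastforce simp: com_def path_matrix_def)
    ultimately show "ceq (rev (D @ z_word n)) (D @ z_word n)"
      using ceq_move[of "z_word n" D "[]" "[]"] DV(2) by simp
    have nd: "\<sigma> i \<notin> R (lw us)" if "set us \<subseteq> {1..n}" "i \<in> {1..n}" "i \<notin> set us" for i us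
      using no_descent_label that by blast
    \<comment> \<open>Climbing: each new label \<open>h + 1\<close> is appended by a star operation
      for the pair \<open>h\<close>, \<open>h + 1\<close>, whose letters do not occur in the
      representative.\<close>
    have up: "reach [2, 4] (D @ [4..<Suc h])" if "4 \<le> h" "h \<le> n" for h
      using that
    proof (induction h rule: dec_induct)
      case base
      have "reach [2, 4] [2, 1, 2, 4]" by (rule reach_double) (use n b com in \<open>auto simp: path_matrix_def\<close>)
      then show ?case using D by auto
    next
      case (step h)
      have "reach [2, 4] ((D @ [4..<h]) @ alternating 1 h (Suc h))" using step by simp
      moreover have "\<sigma> h \<notin> R (lw (D @ [4..<h]))" "\<sigma> (Suc h) \<notin> R (lw (D @ [4..<h]))"
        by (rule nd; use step DV in auto)+
      moreover have "b h = 3 \<or> b h = 4" using b by metis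
      ultimately have "reach [2, 4] ((D @ [4..<h]) @ alternating (Suc 1) h (Suc h))"
        by (intro reach_step) (use step DV in \<open>auto simp: path_matrix_def\<close>)
      then show ?case using step by simp
    qed
    \<comment> \<open>On the way down the letters of the climb occur in the representative, so
      support no longer excludes descents; this shows that only the top label is a descent from the
      arm.\<close>
    have nd_up: "\<sigma> j \<notin> R (lw (D @ [4..<Suc h]))" if "4 \<le> j" "j < h" "h \<le> n" for j h
      using that
    proof (induction h)
      case (Suc h)
      have w: "D @ [4..<Suc (Suc h)] = (D @ [4..<Suc h]) @ [Suc h]" using Suc.prems by simp
      have s: "\<sigma> (Suc h) \<notin> R (lw (D @ [4..<Suc h]))" "\<sigma> (Suc h) \<notin> R (lw (D @ [4..<h]))"
        by (rule nd; use Suc.prems DV in auto)+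
      show ?case
      proof (cases "j = h")
        case True
        have w': "D @ [4..<Suc h] = (D @ [4..<h]) @ [h]" using True Suc.prems by simp
        have bh: "b h = 3 \<or> b h = 4" using b by metis
        have "\<sigma> h \<notin> R (lw ((D @ [4..<h]) @ [h, Suc h]))"
          by (rule no_descent_snoc_adjacent) (use Suc.prems True DV s w' bh in \<open>auto simp: path_matrix_def\<close>)
        then show ?thesis using True w w' by simp
      next
        case False
        have "\<sigma> j \<notin> R (lw ((D @ [4..<Suc h]) @ [Suc h]))"
          by (rule no_descent_snoc) (use Suc False DV s in auto)
        then show ?thesis unfolding w .
      qed
    qed simp
    \<comment> \<open>The stage at which the walk has come back down to \<open>l\<close>;
      \<open>l = n\<close> means that it has just reached the top.\<close>
    let ?V = "\<lambda>l. D @ [4..<n] @ [n] @ rev [l..<n]"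
    have Vn: "?V n = D @ [4..<Suc n]" using n by simp
    have Vsuc: "?V l = ?V (Suc l) @ [l]" if "l < n" for l using that by (simp add: upt_conv_Cons)
    have VV: "set (?V l) \<subseteq> {1..n}" if "4 \<le> l" for l using that DV n by auto
    have nd_down: "\<forall>j. 4 \<le> j \<and> j < l \<longrightarrow> \<sigma> j \<notin> R (lw (?V l))" if "4 \<le> l" "l \<le> n" for l
      using that(2,1)
    proof (induction rule: inc_induct)
      case base
      then show ?case using nd_up[of _ n] unfolding Vn by blast
    next
      case (step l)
      show ?case
      proof (intro allI impI)
        fix j assume j: "4 \<le> j \<and> j < l"
        show "\<sigma> j \<notin> R (lw (?V l))"
          unfolding Vsuc[OF step(2)]
          by (rule no_descent_snoc[OF VV]) (use j step in auto)
      qed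
    qed
    have "reach [2, 4] (?V l)" if "4 \<le> l" "l \<le> n - 1" for l
      using that(2,1)
    proof (induction rule: inc_induct)
      case base
      have "[4..<n] = [4..<n - 1] @ [n - 1]" using n by (cases n) auto
      moreover have "rev [n - 1..<n] = [n - 1]" using n by (cases n) auto
      \<comment> \<open>The turn at the top: weight 4 allows the step from \<open>n - 1, n\<close>
        to \<open>n - 1, n, n - 1\<close>.\<close>
      moreover have "reach [2, 4] ((D @ [4..<n - 1]) @ alternating (Suc (Suc 1)) (n - 1) n)"
      proof (rule reach_step)
        show "reach [2, 4] ((D @ [4..<n - 1]) @ alternating (Suc 1) (n - 1) n)"
          using up[of n] n \<open>[4..<n] = _\<close> by simp
        show "\<sigma> (n - 1) \<notin> R (lw (D @ [4..<n - 1]))" "\<sigma> n \<notin> R (lw (D @ [4..<n - 1]))"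
          by (rule nd; use DV n in auto)+
      qed (use DV n b in \<open>auto simp: path_matrix_def\<close>)
      ultimately show ?case by simp
    next
      case (step l)
      have 1: "reach [2, 4] (?V (Suc (Suc l)) @ alternating 1 (Suc l) l)"
        using step Vsuc[of "Suc l"] by simp
      \<comment> \<open>For the pair \<open>l + 1\<close>, \<open>l\<close> the representative is
        the stage before \<open>l + 1\<close> was appended, where by \<open>nd_down\<close> neither
        letter is a descent.\<close>
      have "reach [2, 4] (?V (Suc (Suc l)) @ alternating (Suc 1) (Suc l) l)"
        by (rule reach_step[OF 1 VV])
          (use step nd_down[of "Suc (Suc l)"] b in \<open>auto simp: path_matrix_def\<close>)
      then show ?case using step Vsuc[of "Suc l"] Vsuc[of l] by simp
    qed
    from this[of 4] show "reach [2, 4] (D @ z_word n)" using n by (simp add: z_word_def)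
  qed
  have "I_set W S (lw [2, 4]) (lw [2, 4]) = lw ` Ls"
  proof (rule I_set_eq)
    show "\<exists>l\<in>Ls. ceq ls l" if "thin_word ls" "set ls \<subseteq> {1..n}"
      "\<And>x. ldesc ls x \<longleftrightarrow> x \<in> {2, 4}" "\<And>x. rdesc ls x \<longleftrightarrow> x \<in> {2, 4}" for ls
    proof -
      have "\<exists>D\<in>{[2], [2, 1, 2]}. \<exists>E\<in>{[4], updown (4 # [5..<Suc n])}. ceq ls (D @ E)"
        by (rule double_left_arm_double[of ls 1 2 3 4 "[5..<Suc n]"])
          (use that t n b in \<open>auto simp: com_def path_matrix_def\<close>)
      then show ?thesis unfolding z by (auto simp: Ls_def)
    qed
    have "lw [2, 1, 2, 4] \<in> I_set W S (lw [2, 4]) (lw [2, 4])"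
      by (rule double_in_I_set) (use n b com in \<open>auto simp: path_matrix_def\<close>)
    then show "lw l \<in> I_set W S (lw [2, 4]) (lw [2, 4])" if "l \<in> Ls" for l
      using that pair long[of "[2]"] long[of "[2, 1, 2]"] by (auto simp: Ls_def)
  qed (use n in \<open>auto simp: path_matrix_def\<close>)
  then show ?thesis by (simp add: Ls_def)
qed

lemma I_set_type_E:
  assumes cs: "coxeter_system W S" and type: "type_E W S q r \<sigma>" and qr: "1 \<le> q" "1 \<le> r"
    and x: "x \<in> {labelled_word W \<sigma> [Arm (-1), Vtx], labelled_word W \<sigma> [Arm 1, Vtx], labelled_word W \<sigma> [Arm (-1), Arm 1]}"
  shows "I_set W S x x = {x}"
proof -
  let ?V = "insert Vtx (Arm ` {- int q..int r})"
  interpret labelled_coxeter W S ?V E_matrix \<sigma>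
    by (rule labelled_coxeterI[OF cs]) (use type in \<open>auto simp: type_E_def E_matrix_refl E_matrix_sym\<close>)
  \<comment> \<open>The vertices beyond the neighbour of 0, listed outwards, are negated on this
    arm; the list is empty when \<open>q = 1\<close>.\<close>
  define s where "s = map (\<lambda>k. Arm (- int k)) [2..<Suc q]"
  define t where "t = map (\<lambda>k. Arm (int k)) [2..<Suc r]"
  have s: "Arm (-1) # s = map (\<lambda>k. Arm (- int k)) [1..<Suc q]" and t: "Arm 1 # t = map (\<lambda>k. Arm (int k)) [1..<Suc r]"
    using qr by (simp_all add: s_def t_def upt_conv_Cons numeral_2_eq_2)
  have "simple_tail (Arm (-1) # s)" "simple_tail (Arm 1 # t)"
    unfolding s t by (rule simple_tail_upt; auto)+
  then have arms: "three_arms (Arm (-1)) s (Arm 1) t Vtx (Arm 0)"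
    by (auto simp: three_arms_def com_def s_def t_def)
  have V: "?V \<subseteq> {Arm 0, Vtx} \<union> set (Arm (-1) # s) \<union> set (Arm 1 # t)"
  proof
    fix y assume "y \<in> ?V"
    then consider "y = Vtx" | i where "y = Arm i" "- int q \<le> i" "i \<le> int r" by auto
    then show "y \<in> {Arm 0, Vtx} \<union> set (Arm (-1) # s) \<union> set (Arm 1 # t)"
    proof cases
      case 2
      consider "i = 0" | "i < 0" | "0 < i" by linarith
      then show ?thesis
      proof cases
        case 2
        then have "y = Arm (- int (nat (- i)))" "nat (- i) \<in> {1..<Suc q}" using \<open>y = Arm i\<close> \<open>- int q \<le> i\<close> by auto
        then have "y \<in> set (Arm (-1) # s)" unfolding s set_map set_upt by (rule image_eqI)
        then show ?thesis by blast
      next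
        case 3
        then have "y = Arm (int (nat i))" "nat i \<in> {1..<Suc r}" using \<open>y = Arm i\<close> \<open>i \<le> int r\<close> by auto
        then have "y \<in> set (Arm 1 # t)" unfolding t set_map set_upt by (rule image_eqI)
        then show ?thesis by blast
      qed (use \<open>y = Arm i\<close> in simp)
    qed simp
  qed
  have 1: "I_set W S (lw [Arm (-1), Vtx]) (lw [Arm (-1), Vtx]) = {lw [Arm (-1), Vtx]}"
  proof (rule I_set_singleton)
    show "ceq ls [Arm (-1), Vtx]" if "thin_word ls" "set ls \<subseteq> ?V"
      "\<And>x. ldesc ls x \<longleftrightarrow> x \<in> {Arm (-1), Vtx}" "\<And>x. rdesc ls x \<longleftrightarrow> x \<in> {Arm (-1), Vtx}" for ls
      using three_arms_words[OF arms that(1) subset_trans[OF that(2) V] that(3,4)] by simp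
  qed (use qr in auto)
  have 2: "I_set W S (lw [Arm 1, Vtx]) (lw [Arm 1, Vtx]) = {lw [Arm 1, Vtx]}"
  proof (rule I_set_singleton)
    \<comment> \<open>\<open>three_arms_words\<close> treats a pair consisting of its first arm and
      \<open>v\<close>; for the positive arm the two long arms change roles.\<close>
    have V': "?V \<subseteq> {Arm 0, Vtx} \<union> set (Arm 1 # t) \<union> set (Arm (-1) # s)" using V by blast
    show "ceq ls [Arm 1, Vtx]" if "thin_word ls" "set ls \<subseteq> ?V"
      "\<And>x. ldesc ls x \<longleftrightarrow> x \<in> {Arm 1, Vtx}" "\<And>x. rdesc ls x \<longleftrightarrow> x \<in> {Arm 1, Vtx}" for ls
      using three_arms_words[OF three_arms_sym[OF arms] that(1) subset_trans[OF that(2) V'] that(3,4)] by simp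
  qed (use qr in auto)
  have 3: "I_set W S (lw [Arm (-1), Arm 1]) (lw [Arm (-1), Arm 1]) = {lw [Arm (-1), Arm 1]}"
  proof (rule I_set_singleton)
    show "ceq ls [Arm (-1), Arm 1]" if "thin_word ls" "set ls \<subseteq> ?V"
      "\<And>x. ldesc ls x \<longleftrightarrow> x \<in> {Arm (-1), Arm 1}" "\<And>x. rdesc ls x \<longleftrightarrow> x \<in> {Arm (-1), Arm 1}" for ls
      using three_arms_words[OF arms that(1) subset_trans[OF that(2) V] that(3,4)] by (simp add: doubleton_eq_iff)
  qed (use qr in auto)
  show ?thesis using x 1 2 3 by auto
qed

theorem theorem4p17:
  fixes W :: "('a, 'b) monoid_scheme" and S :: "'a set"
  assumes "coxeter_system W S"
    and "irreducible_coxeter W S"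
    and "lusztig_bounded W S"
    and "nontrivially_a2_finite W S"
  shows
    "(\<forall>n \<sigma>. 3 \<le> n \<and> type_A W S n \<sigma> \<longrightarrow>
        I_set W S (labelled_word W \<sigma> [1,3]) (labelled_word W \<sigma> [1,3]) = {labelled_word W \<sigma> [1,3]}) \<and>
     (\<forall>\<sigma>. type_B W S 3 \<sigma> \<longrightarrow>
        I_set W S (labelled_word W \<sigma> [1,3]) (labelled_word W \<sigma> [1,3]) = {labelled_word W \<sigma> [1,3]}) \<and>
     (\<forall>n \<sigma>. 3 < n \<and> type_B W S n \<sigma> \<longrightarrow>
        I_set W S (labelled_word W \<sigma> [2,4]) (labelled_word W \<sigma> [2,4]) =
          {labelled_word W \<sigma> [2,4], labelled_word W \<sigma> [2,1,2,4]}) \<and>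
     (\<forall>n \<sigma>. 5 \<le> n \<and> type_C_tilde W S n \<sigma> \<longrightarrow>
        I_set W S (labelled_word W \<sigma> [2,4]) (labelled_word W \<sigma> [2,4]) =
          {labelled_word W \<sigma> [2,4], labelled_word W \<sigma> [2,1,2,4],
           labelled_word W \<sigma> ([2] @ z_word n), labelled_word W \<sigma> ([2,1,2] @ z_word n)}) \<and>
     (\<forall>q r \<sigma>. 1 \<le> q \<and> q \<le> r \<and> type_E W S q r \<sigma> \<longrightarrow>
        (\<forall>x \<in> {labelled_word W \<sigma> [Arm (-1), Vtx], labelled_word W \<sigma> [Arm 1, Vtx],
               labelled_word W \<sigma> [Arm (-1), Arm 1]}.
          I_set W S x x = {x})) \<and>
     (\<forall>\<sigma>. type_F W S 4 \<sigma> \<longrightarrow>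
        I_set W S (labelled_word W \<sigma> [2,4]) (labelled_word W \<sigma> [2,4]) = {labelled_word W \<sigma> [2,4]}) \<and>
     (\<forall>n \<sigma>. 4 < n \<and> type_F W S n \<sigma> \<longrightarrow>
        I_set W S (labelled_word W \<sigma> [2,4]) (labelled_word W \<sigma> [2,4]) =
          {labelled_word W \<sigma> [2,4], labelled_word W \<sigma> [2,4,3,5,2,4]}) \<and>
     (\<forall>\<sigma>. type_H W S 3 \<sigma> \<longrightarrow>
        I_set W S (labelled_word W \<sigma> [1,3]) (labelled_word W \<sigma> [1,3]) = {labelled_word W \<sigma> [1,3]}) \<and>
     (\<forall>n \<sigma>. 3 < n \<and> type_H W S n \<sigma> \<longrightarrow>
        I_set W S (labelled_word W \<sigma> [2,4]) (labelled_word W \<sigma> [2,4]) =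
          {labelled_word W \<sigma> [2,4], labelled_word W \<sigma> [2,1,2,4]})"
proof (intro conjI allI impI ballI; (elim conjE)?)
  note cs = assms(1)
  note defs = type_A_def type_B_def type_C_tilde_def type_F_def type_H_def
  fix n :: nat and \<sigma> :: "nat \<Rightarrow> 'a"
  show "I_set W S (labelled_word W \<sigma> [1,3]) (labelled_word W \<sigma> [1,3]) = {labelled_word W \<sigma> [1,3]}"
    if "3 \<le> n" "type_A W S n \<sigma>"
    by (rule I_set_short_left_arm[OF cs that(2)[unfolded defs]]) (use that in auto)
  show "I_set W S (labelled_word W \<sigma> [1,3]) (labelled_word W \<sigma> [1,3]) = {labelled_word W \<sigma> [1,3]}"
    if "type_B W S 3 \<sigma>"
    by (rule I_set_short_left_arm[OF cs that[unfolded defs]]) auto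
  show "I_set W S (labelled_word W \<sigma> [1,3]) (labelled_word W \<sigma> [1,3]) = {labelled_word W \<sigma> [1,3]}"
    if "type_H W S 3 \<sigma>"
    by (rule I_set_short_left_arm[OF cs that[unfolded defs]]) auto
  show "I_set W S (labelled_word W \<sigma> [2,4]) (labelled_word W \<sigma> [2,4]) =
      {labelled_word W \<sigma> [2,4], labelled_word W \<sigma> [2,1,2,4]}" if "3 < n" "type_B W S n \<sigma>"
    by (rule I_set_double_left_arm[OF cs that(2)[unfolded defs]]) (use that in auto)
  show "I_set W S (labelled_word W \<sigma> [2,4]) (labelled_word W \<sigma> [2,4]) =
      {labelled_word W \<sigma> [2,4], labelled_word W \<sigma> [2,1,2,4]}" if "3 < n" "type_H W S n \<sigma>"
    by (rule I_set_double_left_arm[OF cs that(2)[unfolded defs]]) (use that in auto)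
  show "I_set W S (labelled_word W \<sigma> [2,4]) (labelled_word W \<sigma> [2,4]) =
      {labelled_word W \<sigma> [2,4], labelled_word W \<sigma> [2,1,2,4],
       labelled_word W \<sigma> ([2] @ z_word n), labelled_word W \<sigma> ([2,1,2] @ z_word n)}"
    if "5 \<le> n" "type_C_tilde W S n \<sigma>"
    by (rule I_set_double_edges[OF cs that(2)[unfolded defs] that(1)]) simp_all
  show "I_set W S (labelled_word W \<sigma> [2,4]) (labelled_word W \<sigma> [2,4]) = {labelled_word W \<sigma> [2,4]}"
    if "type_F W S 4 \<sigma>"
    using I_set_second_edge[OF cs that[unfolded defs]] by simp
  show "I_set W S (labelled_word W \<sigma> [2,4]) (labelled_word W \<sigma> [2,4]) =
      {labelled_word W \<sigma> [2,4], labelled_word W \<sigma> [2,4,3,5,2,4]}" if "4 < n" "type_F W S n \<sigma>"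
    using I_set_second_edge[OF cs that(2)[unfolded defs]] that(1) by simp
next
  fix q r :: nat and \<sigma> :: "E_vertex \<Rightarrow> 'a" and x
  assume "1 \<le> q" "q \<le> r" "type_E W S q r \<sigma>"
    "x \<in> {labelled_word W \<sigma> [Arm (-1), Vtx], labelled_word W \<sigma> [Arm 1, Vtx], labelled_word W \<sigma> [Arm (-1), Arm 1]}"
  then show "I_set W S x x = {x}" using I_set_type_E[OF assms(1)] by simp
qed

end
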